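(* Let $n\ge 3$ and let $f:M\to S^n$ be a minimal isometric immersion of an oriented surface $M$ ($\dim M=2$) into the unit sphere. Then the geodesic Gauss map $\gamma:UM^\perp\to\mathcal Q\cong\mathrm{Gr}(2,n+1)$ of $f$ is a minimal Lagrangian immersion.
   Context: $S^n\subset\mathbb{R}^{n+1}$ has the round metric of curvature $1$. $UM^\perp$ is the unit normal bundle of $f$ and $US^n$ the unit tangent bundle of $S^n$. The spherical Gauss map $\mu:UM^\perp\to US^n$ sends a unit normal vector to itself regarded as a unit tangent vector of $S^n$. $\mathcal Q=US^n/S^1$ is the quotient of $US^n$ by geodesic flow, i.e. the manifold of oriented geodesics of $S^n$, identified with the Grassmannian $\mathrm{Gr}(2,n+1)=SO(n+1)/(SO(n-1)\times SO(2))$ of oriented $2$-planes in $\mathbb{R}^{n+1}$. $US^n=SO(n+1)/SO(n-1)$ and $\mathcal Q$ carry the normal homogeneous metrics $h$, $h_{\mathcal Q}$ induced by the inner product $\langle\eta,\zeta\rangle=-\tfrac12\operatorname{tr}(\eta\zeta)$ on $\mathfrak{so}(n+1)$ ($h$ is the restriction of the Sasaki metric), and the quotient map $\pi_{\mathcal Q}:US^n\to\mathcal Q$ is a Riemannian submersion. With $\theta$ the canonical contact form $\theta(Z)=g(d\pi(Z),v)$, $Z\in T_vUS^n$ ($\pi:US^n\to S^n$ the projection), the symplectic form $\lambda_{\mathcal Q}$ on $\mathcal Q$ is the form to which $-d\theta$ descends; it is the Kähler form of a Hermitian symmetric (Kähler–Einstein) structure on $(\mathcal Q,h_{\mathcal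 Q})$. The geodesic Gauss map is $\gamma=\pi_{\mathcal Q}\circ\mu$, assigning to each unit normal vector the oriented geodesic it generates. Minimal means vanishing mean curvature vector; Lagrangian means $\gamma^*\lambda_{\mathcal Q}=0$ and $\dim UM^\perp=\tfrac12\dim\mathcal Q$. *)

theory Defs
  imports "HOL-Analysis.Analysis"
begin

section \<open>Smooth maps\<close>

fun times_differentiable_on ::
  "nat \<Rightarrow> 'a::real_normed_vector set \<Rightarrow> ('a \<Rightarrow> 'b::real_normed_vector) \<Rightarrow> bool" where
  "times_differentiable_on 0 S f \<longleftrightarrow> continuous_on S f"
| "times_differentiable_on (Suc k) S f \<longleftrightarrow>
     (\<forall>x\<in>S. f differentiable (at x)) \<and>
     (\<forall>X. times_differentiable_on k S (\<lambda>x. frechet_derivative f (at x) X))"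

text \<open>Smoothness on an arbitrary subset of a Euclidean space means the existence of local
  smooth extensions; on an open set this is the usual \<open>C\<^sup>\<infinity>\<close> condition.\<close>

definition smooth_on ::
  "'a::real_normed_vector set \<Rightarrow> ('a \<Rightarrow> 'b::real_normed_vector) \<Rightarrow> bool" where
  "smooth_on S f \<longleftrightarrow>
     (\<forall>x\<in>S. \<exists>U F. open U \<and> x \<in> U \<and> (\<forall>k. times_differentiable_on k U F) \<and>
        (\<forall>y\<in>S \<inter> U. F y = f y))"


section \<open>Manifolds given by atlases\<close>

text \<open>A chart is a domain together with a coordinate map into the model space.  The values of
  the coordinate map outside the domain are irrelevant.\<close>

type_synonym ('p, 'e) chart = "'p set \<times> ('p \<Rightarrow> 'e)"

record ('p, 'e) manifold =
  carrier :: "'p set"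
  atlas :: "('p, 'e) chart set"

abbreviation charts_at :: "('p, 'e) manifold \<Rightarrow> 'p \<Rightarrow> ('p, 'e) chart set" where
  "charts_at M p \<equiv> {c \<in> atlas M. p \<in> fst c}"

abbreviation param :: "('p, 'e) chart \<Rightarrow> 'e \<Rightarrow> 'p" where
  "param c \<equiv> inv_into (fst c) (snd c)"

definition local_rep ::
  "('p, 'e) chart \<Rightarrow> ('q, 'h) chart \<Rightarrow> ('p \<Rightarrow> 'q) \<Rightarrow> 'e \<Rightarrow> 'h" where
  "local_rep c c' F = snd c' \<circ> F \<circ> param c"

definition differential ::
  "('p, 'e::euclidean_space) chart \<Rightarrow> ('q, 'h::euclidean_space) chart \<Rightarrow> ('p \<Rightarrow> 'q) \<Rightarrow> 'p \<Rightarrow> 'e \<Rightarrow> 'h" where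
  "differential c c' F p = frechet_derivative (local_rep c c' F) (at (snd c p))"

definition manifold_topology :: "('p, 'e::euclidean_space) manifold \<Rightarrow> 'p topology" where
  "manifold_topology M =
     topology (\<lambda>W. W \<subseteq> carrier M \<and> (\<forall>c\<in>atlas M. open (snd c ` (fst c \<inter> W))))"

definition smooth_manifold :: "('p, 'e::euclidean_space) manifold \<Rightarrow> bool" where
  "smooth_manifold M \<longleftrightarrow>
     (\<Union>c\<in>atlas M. fst c) = carrier M \<and>
     (\<forall>c\<in>atlas M. inj_on (snd c) (fst c) \<and> open (snd c ` fst c)) \<and>
     (\<forall>c\<in>atlas M. \<forall>c'\<in>atlas M.
        open (snd c ` (fst c \<inter> fst c')) \<and>
        smooth_on (snd c ` (fst c \<inter> fst c')) (local_rep c c' id)) \<and>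
     Hausdorff_space (manifold_topology M) \<and> second_countable (manifold_topology M)"

definition oriented_manifold :: "('p, real^'d) manifold \<Rightarrow> bool" where
  "oriented_manifold M \<longleftrightarrow> smooth_manifold M \<and>
     (\<forall>p\<in>carrier M. \<forall>c\<in>charts_at M p. \<forall>c'\<in>charts_at M p.
        det (matrix (differential c c' id p)) > 0)"

definition smooth_map ::
  "('p, 'e::euclidean_space) manifold \<Rightarrow> ('q, 'h::euclidean_space) manifold \<Rightarrow> ('p \<Rightarrow> 'q) \<Rightarrow> bool" where
  "smooth_map M N F \<longleftrightarrow> F ` carrier M \<subseteq> carrier N \<and>
     (\<forall>p\<in>carrier M. \<exists>c\<in>charts_at M p. \<exists>c'\<in>charts_at N (F p). \<exists>W.
        open W \<and> snd c p \<in> W \<and> W \<subseteq> snd c ` fst c \<and> F ` param c ` W \<subseteq> fst c' \<and>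
        smooth_on W (local_rep c c' F))"

definition immersion ::
  "('p, 'e::euclidean_space) manifold \<Rightarrow> ('q, 'h::euclidean_space) manifold \<Rightarrow> ('p \<Rightarrow> 'q) \<Rightarrow> bool" where
  "immersion M N F \<longleftrightarrow> smooth_map M N F \<and>
     (\<forall>p\<in>carrier M. \<forall>c\<in>charts_at M p. \<forall>c'\<in>charts_at N (F p). inj (differential c c' F p))"

text \<open>The embedded submanifold of \<open>N\<close> with underlying set \<open>S\<close>: its charts are all
  diffeomorphisms from relatively open subsets of \<open>S\<close> onto open subsets of the model space.
  The dimension is that of the model space \<open>'d\<close>.\<close>

definition submanifold ::
  "('p, 'e::euclidean_space) manifold \<Rightarrow> 'p set \<Rightarrow> ('p, 'd::euclidean_space) manifold" where
  "submanifold N S = \<lparr> carrier = S,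
     atlas = {c. fst c \<subseteq> S \<and> inj_on (snd c) (fst c) \<and> open (snd c ` fst c) \<and>
       (\<forall>b\<in>atlas N.
          openin (top_of_set (snd b ` (S \<inter> fst b))) (snd b ` (fst c \<inter> fst b)) \<and>
          open (snd c ` (fst c \<inter> fst b)) \<and>
          smooth_on (snd b ` (fst c \<inter> fst b)) (local_rep b c id) \<and>
          smooth_on (snd c ` (fst c \<inter> fst b)) (local_rep c b id))} \<rparr>"

definition euclidean_manifold :: "('e::euclidean_space, 'e) manifold" where
  "euclidean_manifold = \<lparr> carrier = UNIV, atlas = {(UNIV, id)} \<rparr>"

definition times_euclidean ::
  "('p, 'e::euclidean_space) manifold \<Rightarrow> ('p \<times> 'v::euclidean_space, 'e \<times> 'v) manifold" where
  "times_euclidean M = \<lparr> carrier = carrier M \<times> UNIV,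
     atlas = (\<lambda>c. (fst c \<times> UNIV, map_prod (snd c) id)) ` atlas M \<rparr>"

text \<open>The quotient of a Euclidean submanifold \<open>S\<close> by the map \<open>\<pi>\<close>: the smooth structure for
  which \<open>\<pi>\<close> is a smooth submersion, that is, smooth with smooth local sections.\<close>

definition quotient_manifold ::
  "'v::euclidean_space set \<Rightarrow> ('v \<Rightarrow> 'q) \<Rightarrow> ('q, 'h::euclidean_space) manifold" where
  "quotient_manifold S \<pi> = \<lparr> carrier = \<pi> ` S,
     atlas = {c. fst c \<subseteq> \<pi> ` S \<and> inj_on (snd c) (fst c) \<and> open (snd c ` fst c) \<and>
       openin (top_of_set S) (S \<inter> \<pi> -` fst c) \<and>
       smooth_on (S \<inter> \<pi> -` fst c) (snd c \<circ> \<pi>) \<and>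
       (\<forall>y\<in>snd c ` fst c. \<exists>V s. open V \<and> y \<in> V \<and> V \<subseteq> snd c ` fst c \<and>
          smooth_on V s \<and> s ` V \<subseteq> S \<and> (\<forall>w\<in>V. \<pi> (s w) = param c w))} \<rparr>"

text \<open>\<open>d(\<phi> \<circ> \<pi>)\<^sub>p(Z) = X\<close> for a tangent vector \<open>Z\<close> of the Euclidean submanifold \<open>S\<close> at \<open>p\<close>, where
  \<open>\<phi>\<close> is the coordinate map of \<open>c\<close>; tangent vectors of \<open>S\<close> are velocities of curves in \<open>S\<close>.\<close>

definition pushes_forward ::
  "'v::euclidean_space set \<Rightarrow> ('v \<Rightarrow> 'q) \<Rightarrow> ('q, 'h::euclidean_space) chart \<Rightarrow> 'v \<Rightarrow> 'v \<Rightarrow> 'h \<Rightarrow> bool" where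
  "pushes_forward S \<pi> c p Z X \<longleftrightarrow>
     (\<exists>\<alpha>::real \<Rightarrow> 'v. range \<alpha> \<subseteq> S \<and> \<alpha> 0 = p \<and>
        (\<alpha> has_vector_derivative Z) (at 0) \<and>
        ((snd c \<circ> \<pi> \<circ> \<alpha>) has_vector_derivative X) (at 0))"


section \<open>Riemannian metrics and minimal immersions\<close>

text \<open>Covariant 2-tensor fields are given by their components in every chart:
  \<open>T c p X Y\<close> is the value at \<open>p\<close> on the tangent vectors with coordinates \<open>X\<close>, \<open>Y\<close> in the chart \<open>c\<close>.\<close>

type_synonym ('p, 'e) tensor2 = "('p, 'e) chart \<Rightarrow> 'p \<Rightarrow> 'e \<Rightarrow> 'e \<Rightarrow> real"

definition riemannian_metric ::
  "('p, 'e::euclidean_space) manifold \<Rightarrow> ('p, 'e) tensor2 \<Rightarrow> bool" where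
  "riemannian_metric M g \<longleftrightarrow>
     (\<forall>p\<in>carrier M. \<forall>c\<in>charts_at M p.
        bilinear (g c p) \<and> (\<forall>X Y. g c p X Y = g c p Y X) \<and> (\<forall>X. X \<noteq> 0 \<longrightarrow> g c p X X > 0) \<and>
        (\<forall>c'\<in>charts_at M p. \<forall>X Y.
           g c p X Y = g c' p (differential c c' id p X) (differential c c' id p Y))) \<and>
     (\<forall>c\<in>atlas M. \<forall>X Y. smooth_on (snd c ` fst c) (\<lambda>u. g c (param c u) X Y))"

definition isometric_immersion ::
  "('p, 'e::euclidean_space) manifold \<Rightarrow> ('p, 'e) tensor2 \<Rightarrow>
   ('q, 'h::euclidean_space) manifold \<Rightarrow> ('q, 'h) tensor2 \<Rightarrow> ('p \<Rightarrow> 'q) \<Rightarrow> bool" where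
  "isometric_immersion M g N h F \<longleftrightarrow> immersion M N F \<and>
     (\<forall>p\<in>carrier M. \<forall>c\<in>charts_at M p. \<forall>c'\<in>charts_at N (F p). \<forall>X Y.
        h c' (F p) (differential c c' F p X) (differential c c' F p Y) = g c p X Y)"

text \<open>In the next definitions \<open>G y\<close> is the metric of the target at the point with coordinates \<open>y\<close>,
  and \<open>\<Phi>\<close> is the coordinate expression of an immersion.\<close>

definition christoffel ::
  "('h::euclidean_space \<Rightarrow> 'h \<Rightarrow> 'h \<Rightarrow> real) \<Rightarrow> 'h \<Rightarrow> 'h \<Rightarrow> 'h \<Rightarrow> 'h" where
  "christoffel G y X Y = (THE Z. \<forall>W. G y Z W = 1/2 *
      (frechet_derivative (\<lambda>z. G z Y W) (at y) X +
       frechet_derivative (\<lambda>z. G z X W) (at y) Y -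
       frechet_derivative (\<lambda>z. G z X Y) (at y) W))"

definition normal_part ::
  "('h::euclidean_space \<Rightarrow> 'h \<Rightarrow> 'h \<Rightarrow> real) \<Rightarrow> ('e::euclidean_space \<Rightarrow> 'h) \<Rightarrow> 'e \<Rightarrow> 'h \<Rightarrow> 'h" where
  "normal_part G \<Phi> u Z = (THE N.
     (\<forall>X. G (\<Phi> u) N (frechet_derivative \<Phi> (at u) X) = 0) \<and>
     Z - N \<in> range (frechet_derivative \<Phi> (at u)))"

definition second_fundamental_form ::
  "('h::euclidean_space \<Rightarrow> 'h \<Rightarrow> 'h \<Rightarrow> real) \<Rightarrow> ('e::euclidean_space \<Rightarrow> 'h) \<Rightarrow> 'e \<Rightarrow> 'e \<Rightarrow> 'e \<Rightarrow> 'h" where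
  "second_fundamental_form G \<Phi> u X Y = normal_part G \<Phi> u
     (frechet_derivative (\<lambda>w. frechet_derivative \<Phi> (at w) Y) (at u) X +
      christoffel G (\<Phi> u) (frechet_derivative \<Phi> (at u) X) (frechet_derivative \<Phi> (at u) Y))"

definition orthonormal_frame ::
  "('h::euclidean_space \<Rightarrow> 'h \<Rightarrow> 'h \<Rightarrow> real) \<Rightarrow> ('e::euclidean_space \<Rightarrow> 'h) \<Rightarrow> 'e \<Rightarrow> 'e set \<Rightarrow> bool" where
  "orthonormal_frame G \<Phi> u E \<longleftrightarrow> card E = DIM('e) \<and>
     (\<forall>X\<in>E. \<forall>Y\<in>E.
        G (\<Phi> u) (frechet_derivative \<Phi> (at u) X) (frechet_derivative \<Phi> (at u) Y) =
          (if X = Y then 1 else 0))"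

text \<open>The mean curvature vector is the trace of the second fundamental form with respect to the
  induced metric, hence independent of the chosen orthonormal frame.\<close>

definition mean_curvature ::
  "('h::euclidean_space \<Rightarrow> 'h \<Rightarrow> 'h \<Rightarrow> real) \<Rightarrow> ('e::euclidean_space \<Rightarrow> 'h) \<Rightarrow> 'e \<Rightarrow> 'h" where
  "mean_curvature G \<Phi> u =
     (\<Sum>X\<in>(SOME E. orthonormal_frame G \<Phi> u E). second_fundamental_form G \<Phi> u X X)"

definition minimal_immersion ::
  "('p, 'e::euclidean_space) manifold \<Rightarrow> ('q, 'h::euclidean_space) manifold \<Rightarrow>
   ('q, 'h) tensor2 \<Rightarrow> ('p \<Rightarrow> 'q) \<Rightarrow> bool" where
  "minimal_immersion M N h F \<longleftrightarrow> immersion M N F \<and>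
     (\<forall>p\<in>carrier M. \<forall>c\<in>charts_at M p. \<forall>c'\<in>charts_at N (F p).
        mean_curvature (\<lambda>y. h c' (param c' y)) (local_rep c c' F) (snd c p) = 0)"

definition lagrangian ::
  "('p, 'e::euclidean_space) manifold \<Rightarrow> ('q, 'h::euclidean_space) manifold \<Rightarrow>
   ('q, 'h) tensor2 \<Rightarrow> ('p \<Rightarrow> 'q) \<Rightarrow> bool" where
  "lagrangian M N \<omega> F \<longleftrightarrow> 2 * DIM('e) = DIM('h) \<and>
     (\<forall>p\<in>carrier M. \<forall>c\<in>charts_at M p. \<forall>c'\<in>charts_at N (F p). \<forall>X Y.
        \<omega> c' (F p) (differential c c' F p X) (differential c c' F p Y) = 0)"


section \<open>The round sphere and the unit normal bundle\<close>

definition round_sphere :: "(real^'m, 's::euclidean_space) manifold" where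
  "round_sphere = submanifold euclidean_manifold (sphere 0 1)"

definition round_metric :: "(real^'m, 's::euclidean_space) tensor2" where
  "round_metric c x X Y =
     frechet_derivative (param c) (at (snd c x)) X \<bullet> frechet_derivative (param c) (at (snd c x)) Y"

definition unit_normal_bundle ::
  "('p, 'e::euclidean_space) manifold \<Rightarrow> ('p \<Rightarrow> real^'m) \<Rightarrow> ('p \<times> (real^'m), 'u::euclidean_space) manifold" where
  "unit_normal_bundle M f = submanifold (times_euclidean M)
     {(p, v). p \<in> carrier M \<and> norm v = 1 \<and> f p \<bullet> v = 0 \<and>
        (\<forall>c\<in>charts_at M p. \<forall>X. frechet_derivative (f \<circ> param c) (at (snd c p)) X \<bullet> v = 0)}"


section \<open>The unit tangent bundle of the sphere and the space of oriented geodesics\<close>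

definition unit_tangent_sphere :: "((real^'m) \<times> (real^'m)) set" where
  "unit_tangent_sphere = {(x, v). norm x = 1 \<and> norm v = 1 \<and> x \<bullet> v = 0}"

text \<open>An orbit of the geodesic flow consists of the positively oriented orthonormal bases
  of an oriented 2-plane.\<close>

definition geodesic_flow :: "real \<Rightarrow> (real^'m) \<times> (real^'m) \<Rightarrow> (real^'m) \<times> (real^'m)" where
  "geodesic_flow t = (\<lambda>(x, v). (cos t *\<^sub>R x + sin t *\<^sub>R v, cos t *\<^sub>R v - sin t *\<^sub>R x))"

definition proj_geodesics :: "(real^'m) \<times> (real^'m) \<Rightarrow> ((real^'m) \<times> (real^'m)) set" where
  "proj_geodesics p = range (\<lambda>t. geodesic_flow t p)"

definition geodesic_space :: "(((real^'m) \<times> (real^'m)) set, 'h::euclidean_space) manifold" where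
  "geodesic_space = quotient_manifold unit_tangent_sphere proj_geodesics"

definition so_algebra :: "(real^'m^'m) set" where
  "so_algebra = {\<xi>. transpose \<xi> = - \<xi>}"

definition so_inner :: "real^'m^'m \<Rightarrow> real^'m^'m \<Rightarrow> real" where
  "so_inner \<eta> \<zeta> = - (1/2) * trace (\<eta> ** \<zeta>)"

text \<open>The infinitesimal action of \<open>so(n+1)\<close> on \<open>US\<^sup>n\<close>.\<close>

definition inf_action :: "real^'m^'m \<Rightarrow> (real^'m) \<times> (real^'m) \<Rightarrow> (real^'m) \<times> (real^'m)" where
  "inf_action \<xi> = (\<lambda>(x, v). (\<xi> *v x, \<xi> *v v))"

text \<open>The Lie algebra \<open>so(n-1) \<times> so(2)\<close> of the stabiliser of the oriented plane spanned
  by \<open>(x, v)\<close>, and its orthogonal complement.\<close>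

definition isotropy_algebra :: "(real^'m) \<times> (real^'m) \<Rightarrow> (real^'m^'m) set" where
  "isotropy_algebra = (\<lambda>(x, v). {\<xi> \<in> so_algebra. \<xi> *v x \<in> span {x, v} \<and> \<xi> *v v \<in> span {x, v}})"

definition isotropy_complement :: "(real^'m) \<times> (real^'m) \<Rightarrow> (real^'m^'m) set" where
  "isotropy_complement p = {\<eta> \<in> so_algebra. \<forall>\<xi>\<in>isotropy_algebra p. so_inner \<eta> \<xi> = 0}"

text \<open>The normal homogeneous metric: every tangent vector of the space of geodesics at the orbit
  of \<open>p\<close> is generated by exactly one element of the complement of the isotropy algebra.\<close>

definition geodesic_metric ::
  "(((real^'m) \<times> (real^'m)) set, 'h::euclidean_space) tensor2" where
  "geodesic_metric c q X Y = (THE r. \<exists>p\<in>unit_tangent_sphere. proj_geodesics p = q \<and>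
     (\<exists>\<eta>\<in>isotropy_complement p. \<exists>\<zeta>\<in>isotropy_complement p.
        pushes_forward unit_tangent_sphere proj_geodesics c p (inf_action \<eta> p) X \<and>
        pushes_forward unit_tangent_sphere proj_geodesics c p (inf_action \<zeta> p) Y \<and>
        r = so_inner \<eta> \<zeta>))"

text \<open>The canonical contact form: on \<open>US\<^sup>n\<close>, a subset of \<open>\<real>\<^sup>n\<^sup>+\<^sup>1 \<times> \<real>\<^sup>n\<^sup>+\<^sup>1\<close>, the differential of the
  bundle projection is the first component.  The formula defines a 1-form on the ambient space,
  and the exterior derivative commutes with restriction to \<open>US\<^sup>n\<close>.\<close>

definition contact_form :: "(real^'m) \<times> (real^'m) \<Rightarrow> (real^'m) \<times> (real^'m) \<Rightarrow> real" where
  "contact_form = (\<lambda>(x, v) Z. fst Z \<bullet> v)"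

definition exterior_derivative ::
  "('v::real_normed_vector \<Rightarrow> 'v \<Rightarrow> real) \<Rightarrow> 'v \<Rightarrow> 'v \<Rightarrow> 'v \<Rightarrow> real" where
  "exterior_derivative \<omega> p X Y =
     frechet_derivative (\<lambda>z. \<omega> z Y) (at p) X - frechet_derivative (\<lambda>z. \<omega> z X) (at p) Y"

text \<open>The form to which \<open>-d\<theta>\<close> descends.\<close>

definition geodesic_symplectic ::
  "(((real^'m) \<times> (real^'m)) set, 'h::euclidean_space) tensor2" where
  "geodesic_symplectic c q X Y = (THE r. \<exists>p\<in>unit_tangent_sphere. proj_geodesics p = q \<and>
     (\<exists>Z Z'. pushes_forward unit_tangent_sphere proj_geodesics c p Z X \<and>
        pushes_forward unit_tangent_sphere proj_geodesics c p Z' Y \<and>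
        r = - exterior_derivative contact_form p Z Z'))"

definition spherical_gauss_map :: "('p \<Rightarrow> real^'m) \<Rightarrow> 'p \<times> (real^'m) \<Rightarrow> (real^'m) \<times> (real^'m)" where
  "spherical_gauss_map f = (\<lambda>(p, v). (f p, v))"

definition geodesic_gauss_map :: "('p \<Rightarrow> real^'m) \<Rightarrow> 'p \<times> (real^'m) \<Rightarrow> ((real^'m) \<times> (real^'m)) set" where
  "geodesic_gauss_map f = proj_geodesics \<circ> spherical_gauss_map f"

end

theory Submission
  imports Defs
begin

text \<open>The Pluecker map \<open>(x, v) \<mapsto> x \<and> v\<close> embeds the space of oriented geodesics isometrically into
  the skew matrices, so its Christoffel symbols, and those of the sphere, disappear: the mean
  curvature of an immersion is the trace of the ambient second derivative, tested against
  tangent vectors of the target that are normal to the immersion.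

  In a chart of the unit normal bundle the Gauss map is \<open>y \<mapsto> F \<and> \<nu>\<close>, where \<open>F\<close> is the foot point
  and \<open>\<nu>\<close> the unit normal.  Since \<open>\<nu>\<close> is normal to the surface, \<open>dF(X) \<bullet> d\<nu>(Y)\<close> is symmetric; this
  is the Lagrangian condition.  It makes the vectors \<open>-d\<nu>(Y) \<and> \<nu> + F \<and> dF(Y)\<close> span the normal space,
  and the cubic form \<open>C(X, Y, Z) = D\<^sup>2\<nu>(X, Y) \<bullet> dF(Z) - D\<^sup>2F(X, Y) \<bullet> d\<nu>(Z)\<close> totally symmetric, so that
  minimality says that \<open>\<Sum>\<^sub>X C(X, Y, X) = 0\<close> over an orthonormal frame.  Vertical \<open>X\<close> contribute
  nothing.  On the horizontal plane the shape operator \<open>A\<close> of \<open>\<nu>\<close> is symmetric and trace free, hence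
  \<open>A\<^sup>2\<close> is a multiple of the identity and the induced metric is a multiple of that of the surface;
  the remaining two terms then form the derivative in direction \<open>Y\<close> of the identity \<open>tr A = 0\<close>.\<close>

section \<open>Calculus of smooth maps\<close>

text \<open>Dimension two is decisive because of the metric in which the trace is taken. Relative to
  the metric of the surface, the Gauss map induces \<open>1 + A^2\<close> on the horizontal plane,
  so the trace of C carries the weight \<open>(1 + A^2)^-1\<close>, and in general the derivative of
  \<open>tr A = 0\<close> does not control it. A symmetric trace free 2 by 2 matrix satisfies
  \<open>A^2 = - det A\<close> by Cayley-Hamilton; the weight is then a scalar and factors out.
  \<open>mean_curvature\<close> takes its frame by \<open>SOME\<close>, and minimality quantifies
  over all pairs of charts of complete atlases; hence the computation is done for arbitrary charts
  and frames. Smoothness of the Gauss map, on the other hand, asks for some chart at each point, and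
  an atlas defined as the set of all compatible charts could a priori be empty. This is why charts
  of the Grassmannian and of the normal bundle have to be constructed.\<close>

abbreviation D1 :: "('a::real_normed_vector \<Rightarrow> 'b::real_normed_vector) \<Rightarrow> 'a \<Rightarrow> 'a \<Rightarrow> 'b" where
  "D1 f x \<equiv> frechet_derivative f (at x)"

abbreviation D2 :: "('a::real_normed_vector \<Rightarrow> 'b::real_normed_vector) \<Rightarrow> 'a \<Rightarrow> 'a \<Rightarrow> 'a \<Rightarrow> 'b" where
  "D2 f x X Y \<equiv> frechet_derivative (\<lambda>z. frechet_derivative f (at z) X) (at x) Y"

lemma td_cong:
  assumes "open U" "\<And>x. x \<in> U \<Longrightarrow> f x = g x" "times_differentiable_on k U f"
  shows "times_differentiable_on k U g"
  using assms
proof (induction k arbitrary: f g)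
  case 0
  then show ?case by (simp cong: continuous_on_cong)
next
  case (Suc k)
  have fd: "D1 f x = D1 g x" if "x \<in> U" for x
    by (rule frechet_derivative_transform_within_open[where X = U])
      (use Suc.prems that in auto)
  have "g differentiable (at x)" if "x \<in> U" for x
    using Suc.prems that unfolding differentiable_def
    by (metis has_derivative_transform_within_open times_differentiable_on.simps(2) differentiable_def)
  moreover have "times_differentiable_on k U (\<lambda>x. D1 g x X)" for X
    by (rule Suc.IH[of "\<lambda>x. D1 f x X"]) (use Suc.prems fd in auto)
  ultimately show ?case by simp
qed

lemma td_subset:
  "times_differentiable_on k U f \<Longrightarrow> V \<subseteq> U \<Longrightarrow> times_differentiable_on k V f"
proof (induction k arbitrary: f)
  case 0
  then show ?case by (auto intro: continuous_on_subset)
next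
  case (Suc k)
  then show ?case by (simp, blast)
qed

lemma td_imp_continuous_on:
  assumes "times_differentiable_on k U f"
  shows "continuous_on U f"
proof (cases k)
  case 0
  then show ?thesis using assms by simp
next
  case (Suc j)
  then have "\<forall>x\<in>U. f differentiable (at x)" using assms by simp
  then show ?thesis
    by (meson continuous_at_imp_continuous_on differentiable_imp_continuous_within)
qed

lemma td_Suc_imp: "times_differentiable_on (Suc k) U f \<Longrightarrow> times_differentiable_on k U f"
proof (induction k arbitrary: f)
  case 0
  then show ?case by (metis td_imp_continuous_on times_differentiable_on.simps(1))
next
  case (Suc k)
  then show ?case unfolding times_differentiable_on.simps(2)[of "Suc k"] times_differentiable_on.simps(2)[of k] by blast
qed

lemma td_local:
  assumes "\<And>x. x \<in> S \<Longrightarrow> \<exists>U. open U \<and> x \<in> U \<and> times_differentiable_on k U f"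
  shows "times_differentiable_on k S f"
  using assms
proof (induction k arbitrary: f)
  case 0
  then have "isCont f x" if "x \<in> S" for x
    using that by (metis continuous_on_eq_continuous_at times_differentiable_on.simps(1))
  then show ?case by (simp add: continuous_at_imp_continuous_on)
next
  case (Suc k)
  have "times_differentiable_on k S (\<lambda>x. D1 f x X)" for X
  proof (rule Suc.IH)
    fix x assume "x \<in> S"
    from Suc.prems[OF this]
    show "\<exists>U. open U \<and> x \<in> U \<and> times_differentiable_on k U (\<lambda>x. D1 f x X)"
      unfolding times_differentiable_on.simps by blast
  qed
  moreover have "f differentiable (at x)" if "x \<in> S" for x
    using Suc.prems that by auto
  ultimately show ?case by simp
qed

lemma td_const: "times_differentiable_on k U (\<lambda>x. c)"
  by (induction k arbitrary: c) (auto)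

lemma td_linear:
  assumes "bounded_linear f"
  shows "times_differentiable_on k U f"
proof (cases k)
  case 0
  then show ?thesis using assms by (simp add: linear_continuous_on)
next
  case (Suc j)
  have "D1 f x = f" for x
    using assms by (metis bounded_linear_imp_has_derivative frechet_derivative_at)
  then show ?thesis using Suc assms
    by (simp add: td_const bounded_linear_imp_differentiable)
qed

lemma td_add:
  assumes "open U" "times_differentiable_on k U f" "times_differentiable_on k U g"
  shows "times_differentiable_on k U (\<lambda>x. f x + g x)"
  using assms
proof (induction k arbitrary: f g)
  case 0
  then show ?case by (auto intro: continuous_intros)
next
  case (Suc k)
  have fd: "D1 f x X + D1 g x X =
      D1 (\<lambda>x. f x + g x) x X" if "x \<in> U" for x X
  proof -
    have "((\<lambda>x. f x + g x) has_derivative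
        (\<lambda>X. D1 f x X + D1 g x X)) (at x)"
      using Suc.prems that by (intro derivative_intros) (auto simp flip: frechet_derivative_works)
    from frechet_derivative_at[OF this] show ?thesis by metis
  qed
  have "times_differentiable_on k U (\<lambda>x. D1 (\<lambda>x. f x + g x) x X)" for X
    by (rule td_cong[OF \<open>open U\<close> fd[where X = X] Suc.IH]) (use Suc.prems in auto)
  then show ?case using Suc.prems by auto
qed

lemma td_sum:
  assumes "open U" "\<And>i. i \<in> I \<Longrightarrow> times_differentiable_on k U (f i)"
  shows "times_differentiable_on k U (\<lambda>x. \<Sum>i\<in>I. f i x)"
  using assms(2)
  by (induction I rule: infinite_finite_induct) (auto simp: td_const intro: td_add[OF assms(1)])

lemma td_bilinear:
  assumes "bounded_bilinear prd" "open U"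
    and "times_differentiable_on k U f" "times_differentiable_on k U g"
  shows "times_differentiable_on k U (\<lambda>x. prd (f x) (g x))"
  using assms(3,4)
proof (induction k arbitrary: f g)
  case 0
  then show ?case by (auto intro: bounded_bilinear.continuous_on[OF assms(1)])
next
  case (Suc k)
  have hd: "((\<lambda>x. prd (f x) (g x)) has_derivative
        (\<lambda>X. prd (f x) (D1 g x X) + prd (D1 f x X) (g x))) (at x)"
    if "x \<in> U" for x
    using Suc.prems that
    by (intro bounded_bilinear.FDERIV[OF assms(1)]) (auto simp flip: frechet_derivative_works)
  then have fd: "prd (f x) (D1 g x X) + prd (D1 f x X) (g x)
      = D1 (\<lambda>x. prd (f x) (g x)) x X" if "x \<in> U" for x X
    by (simp add: frechet_derivative_at[OF hd[OF that], symmetric])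
  have "times_differentiable_on k U (\<lambda>x. D1 (\<lambda>x. prd (f x) (g x)) x X)" for X
  proof (rule td_cong[OF \<open>open U\<close> fd[where X = X]], assumption)
    show "times_differentiable_on k U
      (\<lambda>x. prd (f x) (D1 g x X) + prd (D1 f x X) (g x))"
      using Suc.prems td_Suc_imp[OF Suc.prems(1)] td_Suc_imp[OF Suc.prems(2)]
      by (intro td_add[OF assms(2)] Suc.IH) simp_all
  qed
  then show ?case using hd by (auto simp: differentiable_def)
qed

text \<open>The definition differentiates in constant directions only, whereas the chain rule gives
  \<open>D1 g (f x) (D1 f x X)\<close>, whose direction depends on x. Expanding the direction in
  \<open>Basis\<close> leaves products of scalars with \<open>D1 g (f x) b\<close> for constant b,
  to which the induction hypothesis applies.\<close>

lemma td_compose: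
  fixes f :: "'a::real_normed_vector \<Rightarrow> 'b::euclidean_space"
  assumes "open U" "open V" "f ` U \<subseteq> V"
    and "times_differentiable_on k U f" "times_differentiable_on k V g"
  shows "times_differentiable_on k U (\<lambda>x. g (f x))"
  using assms(4,5)
proof (induction k arbitrary: g)
  case 0
  then show ?case using assms(3) by (auto intro: continuous_on_compose2)
next
  case (Suc k)
  have hd: "((\<lambda>x. g (f x)) has_derivative
     (\<lambda>X. D1 g (f x) (D1 f x X))) (at x)" if "x \<in> U" for x
    by (rule has_derivative_compose) (use Suc.prems assms(3) that in \<open>auto simp flip: frechet_derivative_works\<close>)
  have fd: "(\<Sum>b\<in>Basis. (D1 f x X \<bullet> b) *\<^sub>R D1 g (f x) b)
      = D1 (\<lambda>x. g (f x)) x X" if "x \<in> U" for x X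
  proof -
    have "linear (D1 g (f x))"
      using Suc.prems(2) assms(3) that by (auto intro: linear_frechet_derivative)
    then have "D1 g (f x) (\<Sum>b\<in>Basis. (D1 f x X \<bullet> b) *\<^sub>R b) =
       (\<Sum>b\<in>Basis. (D1 f x X \<bullet> b) *\<^sub>R D1 g (f x) b)"
      by (simp only: linear_sum linear_scale)
    then show ?thesis by (simp add: euclidean_representation frechet_derivative_at[OF hd[OF that], symmetric])
  qed
  have "times_differentiable_on k U (\<lambda>x. D1 (\<lambda>x. g (f x)) x X)" for X
  proof (rule td_cong[OF \<open>open U\<close> fd[where X = X]], assumption)
    show "times_differentiable_on k U
      (\<lambda>x. \<Sum>b\<in>Basis. (D1 f x X \<bullet> b) *\<^sub>R D1 g (f x) b)"
      using Suc.prems(1) by (intro td_sum[OF assms(1)] td_bilinear[OF bounded_bilinear_scaleR assms(1)]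
          Suc.IH td_bilinear[OF bounded_bilinear_inner assms(1)] td_const)
        (use Suc.prems td_Suc_imp[OF Suc.prems(1)] in simp_all)
  qed
  then show ?case using hd by (auto simp: differentiable_def)
qed

lemma td_Pair:
  assumes "open U" "times_differentiable_on k U f" "times_differentiable_on k U g"
  shows "times_differentiable_on k U (\<lambda>x. (f x, g x))"
  using assms(2,3)
proof (induction k arbitrary: f g)
  case 0
  then show ?case by (auto intro: continuous_intros)
next
  case (Suc k)
  have hd: "((\<lambda>x. (f x, g x)) has_derivative
        (\<lambda>X. (D1 f x X, D1 g x X))) (at x)" if "x \<in> U" for x
    using Suc.prems that by (intro derivative_intros) (auto simp flip: frechet_derivative_works)
  then have fd: "(D1 f x X, D1 g x X) =
      D1 (\<lambda>x. (f x, g x)) x X" if "x \<in> U" for x X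
    by (simp add: frechet_derivative_at[OF hd[OF that], symmetric])
  have "times_differentiable_on k U (\<lambda>x. D1 (\<lambda>x. (f x, g x)) x X)" for X
    by (rule td_cong[OF \<open>open U\<close> fd[where X = X] Suc.IH]) (use Suc.prems in auto)
  then show ?case using hd by (auto simp: differentiable_def)
qed

text \<open>The derivative is written as a product with the factors \<open>inverse x\<close>, so
  that the induction hypothesis applies to the function itself. The next lemma does the same with
  \<open>inverse (sqrt x)\<close>.\<close>

lemma td_inverse: "times_differentiable_on k (- {0}) (inverse :: real \<Rightarrow> real)"
proof (induction k)
  case 0
  then show ?case by (auto intro: continuous_intros)
next
  case (Suc k)
  have hd: "(inverse has_derivative (\<lambda>X. - (inverse x * X * inverse x))) (at x)"
    if "x \<in> - {0}" for x :: real
    using that has_derivative_inverse'[of x UNIV] by simp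
  then have fd: "inverse x * (inverse x * (-1 * X)) = D1 inverse x X" if "x \<in> - {0}" for x X :: real
    by (simp add: frechet_derivative_at[OF hd[OF that], symmetric])
  have "times_differentiable_on k (- {0}) (\<lambda>x. D1 inverse x X)" for X :: real
  proof (rule td_cong[OF _ fd[where X = X]])
    show "times_differentiable_on k (- {0}) (\<lambda>x. inverse x * (inverse x * (-1 * X)))"
      by (intro td_bilinear[OF bounded_bilinear_mult] Suc td_const) auto
  qed auto
  then show ?case using hd by (auto simp: differentiable_def)
qed

lemma td_sqrt: "times_differentiable_on k {0<..} sqrt"
proof (induction k)
  case 0
  then show ?case by (auto intro: continuous_intros)
next
  case (Suc k)
  have hd: "(sqrt has_derivative (\<lambda>X. inverse (sqrt x) * (X / 2))) (at x)"
    if "x \<in> {0<..}" for x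
    using that by (auto intro!: derivative_eq_intros simp: field_simps)
  then have fd: "inverse (sqrt x) * (X / 2) = D1 sqrt x X" if "x \<in> {0<..}" for x X
    by (simp add: frechet_derivative_at[OF hd[OF that], symmetric])
  have "times_differentiable_on k {0<..} (\<lambda>x. D1 sqrt x X)" for X
  proof (rule td_cong[OF _ fd[where X = X]])
    show "times_differentiable_on k {0<..} (\<lambda>x. inverse (sqrt x) * (X / 2))"
      by (rule td_bilinear[OF bounded_bilinear_mult _ td_compose[OF _ _ _ Suc td_inverse] td_const]) auto
  qed auto
  then show ?case using hd by (auto simp: differentiable_def)
qed

section \<open>Smoothness on arbitrary sets by local extension\<close>

lemma smooth_onE:
  assumes "smooth_on S f" "x \<in> S"
  obtains U F where "open U" "x \<in> U" "\<forall>k. times_differentiable_on k U F" "\<And>y. y \<in> S \<Longrightarrow> y \<in> U \<Longrightarrow> F y = f y"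
  using bspec[OF assms(1)[unfolded smooth_on_def] assms(2)] by blast

lemma smooth_on_subset:
  assumes "smooth_on S f" "T \<subseteq> S"
  shows "smooth_on T f"
  unfolding smooth_on_def
proof
  fix x assume "x \<in> T"
  with assms have "x \<in> S" by auto
  from smooth_onE[OF assms(1) this] show "\<exists>U F. open U \<and> x \<in> U \<and> (\<forall>k. times_differentiable_on k U F) \<and> (\<forall>y\<in>T \<inter> U. F y = f y)"
    using assms(2) by (metis IntE subsetD)
qed

lemma smooth_on_open_iff:
  assumes "open S"
  shows "smooth_on S f \<longleftrightarrow> (\<forall>k. times_differentiable_on k S f)"
proof
  assume *: "smooth_on S f"
  show "\<forall>k. times_differentiable_on k S f"
  proof (intro allI td_local)
    fix k x assume "x \<in> S"
    from smooth_onE[OF * this]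
    obtain U F where "open U" "x \<in> U" "\<forall>k. times_differentiable_on k U F" "\<forall>y\<in>S \<inter> U. F y = f y"
      by (metis IntE)
    then show "\<exists>U. open U \<and> x \<in> U \<and> times_differentiable_on k U f"
      using assms \<open>x \<in> S\<close> by (intro exI[of _ "S \<inter> U"]) (auto intro: td_cong[of "S \<inter> U" F] td_subset)
  qed
next
  assume "\<forall>k. times_differentiable_on k S f"
  then show "smooth_on S f" unfolding smooth_on_def using assms by blast
qed

lemma smooth_on_cong:
  "smooth_on S f \<Longrightarrow> (\<And>x. x \<in> S \<Longrightarrow> f x = g x) \<Longrightarrow> smooth_on S g"
  unfolding smooth_on_def by simp

lemma smooth_on_local:
  assumes "\<And>x. x \<in> S \<Longrightarrow> \<exists>U. open U \<and> x \<in> U \<and> smooth_on (S \<inter> U) f"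
  shows "smooth_on S f"
  unfolding smooth_on_def
proof
  fix x assume x: "x \<in> S"
  obtain U where U: "open U" "x \<in> U" "smooth_on (S \<inter> U) f" using assms x by metis
  then obtain V F where V: "open V" "x \<in> V" "\<forall>k. times_differentiable_on k V F" "\<forall>y\<in>S \<inter> U \<inter> V. F y = f y"
    using smooth_onE[OF U(3), of x] x by (metis IntE IntI)
  show "\<exists>U F. open U \<and> x \<in> U \<and> (\<forall>k. times_differentiable_on k U F) \<and> (\<forall>y\<in>S \<inter> U. F y = f y)"
    using U V by (intro exI[of _ "U \<inter> V"] exI[of _ F]) (auto intro: td_subset)
qed

lemma smooth_on_continuous_on:
  assumes "smooth_on S f"
  shows "continuous_on S f"
  unfolding continuous_on_eq_continuous_within
proof
  fix x assume x: "x \<in> S"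
  obtain U F where U: "open U" "x \<in> U" "times_differentiable_on 0 U F" "\<forall>y\<in>S \<inter> U. F y = f y"
    using smooth_onE[OF assms x] by (metis IntE)
  then have "isCont F x" by (auto simp: continuous_on_eq_continuous_at)
  then have "continuous (at x within S) F" by (rule continuous_at_imp_continuous_within)
  then show "continuous (at x within S) f"
    using U x unfolding continuous_within
    by (smt (verit) IntI Lim_transform_within_openin openin_open_Int inf_commute Int_iff)
qed

text \<open>The composite of two local extensions is defined where the inner one lands in the domain
  of the outer one; this set is open because the inner extension is continuous.\<close>

lemma smooth_on_compose:
  fixes f :: "'a::real_normed_vector \<Rightarrow> 'b::euclidean_space"
  assumes "smooth_on S f" "smooth_on T g" "f ` S \<subseteq> T"
  shows "smooth_on S (\<lambda>x. g (f x))"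
  unfolding smooth_on_def
proof
  fix x assume x: "x \<in> S"
  obtain U F where U: "open U" "x \<in> U" "\<forall>k. times_differentiable_on k U F" "\<forall>y\<in>S \<inter> U. F y = f y"
    using smooth_onE[OF assms(1) x] by (metis IntE)
  have "f x \<in> T" using assms x by auto
  then obtain V G where V: "open V" "f x \<in> V" "\<forall>k. times_differentiable_on k V G" "\<forall>y\<in>T \<inter> V. G y = g y"
    using smooth_onE[OF assms(2)] by (metis IntE)
  have "continuous_on U F" using U(3) td_imp_continuous_on by blast
  then have o: "open (U \<inter> F -` V)" using U(1) V(1) by (simp add: continuous_on_open_vimage Int_commute)
  show "\<exists>U F. open U \<and> x \<in> U \<and> (\<forall>k. times_differentiable_on k U F) \<and> (\<forall>y\<in>S \<inter> U. F y = g (f y))"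
  proof (intro exI conjI allI ballI)
    show "open (U \<inter> F -` V)" by (rule o)
    show "x \<in> U \<inter> F -` V" using U V x by auto
    show "times_differentiable_on k (U \<inter> F -` V) (\<lambda>x. G (F x))" for k
      by (rule td_compose[OF o V(1)]) (use U V in \<open>auto intro: td_subset\<close>)
    show "G (F y) = g (f y)" if "y \<in> S \<inter> (U \<inter> F -` V)" for y
      using that U V assms(3) by (auto simp: image_subset_iff)
  qed
qed

lemma smooth_on_UNIV_compose:
  fixes f :: "'a::real_normed_vector \<Rightarrow> 'b::euclidean_space"
  assumes "smooth_on UNIV g" "smooth_on S f"
  shows "smooth_on S (\<lambda>x. g (f x))"
  using smooth_on_compose assms by blast

lemma smooth_on_const: "smooth_on S (\<lambda>x. c)"
  by (rule smooth_on_subset[of UNIV]) (auto simp: smooth_on_open_iff td_const)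

lemma smooth_on_linear: "linear f \<Longrightarrow> smooth_on S (f :: 'a::euclidean_space \<Rightarrow> 'b::real_normed_vector)"
  by (rule smooth_on_subset[of UNIV]) (auto simp: smooth_on_open_iff td_linear linear_conv_bounded_linear)

lemma smooth_on_id: "smooth_on S (\<lambda>x. x)"
  by (rule smooth_on_subset[of UNIV]) (auto simp: smooth_on_open_iff td_linear bounded_linear_ident)

lemma smooth_on_Pair:
  assumes "smooth_on S f" "smooth_on S g"
  shows "smooth_on S (\<lambda>x. (f x, g x))"
  unfolding smooth_on_def
proof
  fix x assume x: "x \<in> S"
  obtain U F where U: "open U" "x \<in> U" "\<forall>k. times_differentiable_on k U F" "\<forall>y\<in>S \<inter> U. F y = f y"
    using smooth_onE[OF assms(1) x] by (metis IntE)
  obtain V G where V: "open V" "x \<in> V" "\<forall>k. times_differentiable_on k V G" "\<forall>y\<in>S \<inter> V. G y = g y"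
    using smooth_onE[OF assms(2) x] by (metis IntE)
  show "\<exists>U F. open U \<and> x \<in> U \<and> (\<forall>k. times_differentiable_on k U F) \<and> (\<forall>y\<in>S \<inter> U. F y = (f y, g y))"
    using U V by (intro exI[of _ "U \<inter> V"] exI[of _ "\<lambda>x. (F x, G x)"]) (auto intro!: td_Pair intro: td_subset)
qed

lemma smooth_on_bilinear:
  fixes f :: "'a::real_normed_vector \<Rightarrow> 'b::euclidean_space" and g :: "'a \<Rightarrow> 'c::euclidean_space"
  assumes "bounded_bilinear prd" "smooth_on S f" "smooth_on S g"
  shows "smooth_on S (\<lambda>x. prd (f x) (g x))"
proof -
  have "times_differentiable_on k UNIV (\<lambda>z. prd (fst z) (snd z))" for k
    by (intro td_bilinear[OF assms(1)] td_linear bounded_linear_fst bounded_linear_snd) simp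
  then have "smooth_on UNIV (\<lambda>z. prd (fst z) (snd z))"
    by (simp add: smooth_on_open_iff)
  from smooth_on_UNIV_compose[OF this smooth_on_Pair[OF assms(2,3)]] show ?thesis by simp
qed

lemmas smooth_on_scaleR = smooth_on_bilinear[OF bounded_bilinear_scaleR]
  and smooth_on_inner = smooth_on_bilinear[OF bounded_bilinear_inner]
  and smooth_on_mult = smooth_on_bilinear[OF bounded_bilinear_mult[where 'a = real]]

lemma smooth_on_fst: "smooth_on S f \<Longrightarrow> smooth_on S (\<lambda>x. fst (f x :: 'b::euclidean_space \<times> 'c::euclidean_space))"
  and smooth_on_snd: "smooth_on S f \<Longrightarrow> smooth_on S (\<lambda>x. snd (f x :: 'b \<times> 'c))"
  by (rule smooth_on_UNIV_compose[OF smooth_on_linear]; simp add: linear_fst linear_snd)+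

lemma smooth_on_add:
  fixes f g :: "'a::real_normed_vector \<Rightarrow> 'b::euclidean_space"
  assumes "smooth_on S f" "smooth_on S g"
  shows "smooth_on S (\<lambda>x. f x + g x)"
proof -
  have "linear (\<lambda>z::'b \<times> 'b. fst z + snd z)" by (rule linearI) (auto simp: algebra_simps)
  from smooth_on_UNIV_compose[OF smooth_on_linear[OF this] smooth_on_Pair[OF assms]] show ?thesis by simp
qed

lemma smooth_on_diff:
  fixes f g :: "'a::real_normed_vector \<Rightarrow> 'b::euclidean_space"
  assumes "smooth_on S f" "smooth_on S g"
  shows "smooth_on S (\<lambda>x. f x - g x)"
proof -
  have "linear (\<lambda>z::'b \<times> 'b. fst z - snd z)" by (rule linearI) (auto simp: algebra_simps)
  from smooth_on_UNIV_compose[OF smooth_on_linear[OF this] smooth_on_Pair[OF assms]] show ?thesis by simp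
qed

lemma smooth_on_sum:
  fixes f :: "'i \<Rightarrow> 'a::real_normed_vector \<Rightarrow> 'b::euclidean_space"
  assumes "\<And>i. i \<in> I \<Longrightarrow> smooth_on S (f i)"
  shows "smooth_on S (\<lambda>x. \<Sum>i\<in>I. f i x)"
  using assms
  by (induction I rule: infinite_finite_induct) (auto simp: smooth_on_const intro: smooth_on_add)

lemma smooth_on_divide:
  fixes f g :: "'a::real_normed_vector \<Rightarrow> real"
  assumes "smooth_on S f" "smooth_on S g" "\<And>x. x \<in> S \<Longrightarrow> g x \<noteq> 0"
  shows "smooth_on S (\<lambda>x. f x / g x)"
proof -
  have "smooth_on (- {0::real}) inverse"
    using td_inverse by (subst smooth_on_open_iff) auto
  from smooth_on_mult[OF assms(1) smooth_on_compose[OF assms(2) this]] show ?thesis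
    using assms(3) by (force simp: divide_inverse)
qed

lemma smooth_on_norm:
  fixes f :: "'a::real_normed_vector \<Rightarrow> 'b::euclidean_space"
  assumes "smooth_on S f" "\<And>x. x \<in> S \<Longrightarrow> f x \<noteq> 0"
  shows "smooth_on S (\<lambda>x. norm (f x))"
proof -
  have "smooth_on {0<..} sqrt"
    by (simp add: smooth_on_open_iff td_sqrt)
  from smooth_on_compose[OF smooth_on_inner[OF assms(1,1)] this] show ?thesis
    using assms(2) by (force simp: norm_eq_sqrt_inner)
qed

lemmas smooth_on_intros = smooth_on_const smooth_on_id smooth_on_Pair smooth_on_scaleR smooth_on_inner
  smooth_on_mult smooth_on_fst smooth_on_snd smooth_on_add smooth_on_diff smooth_on_sum smooth_on_divide
  smooth_on_norm

lemma smooth_on_has_derivative: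
  assumes "smooth_on S f" "open S" "x \<in> S"
  shows "(f has_derivative D1 f x) (at x)"
  using assms by (metis frechet_derivative_works smooth_on_open_iff times_differentiable_on.simps(2))

lemma smooth_on_frechet_derivative:
  assumes "smooth_on S f" "open S"
  shows "smooth_on S (\<lambda>x. D1 f x X)"
  using assms(1) unfolding smooth_on_open_iff[OF assms(2)] by (metis times_differentiable_on.simps(2))

section \<open>Symmetry of second derivatives and the second order chain rule\<close>

text \<open>Schwarz's argument: the mean value theorem is applied to the second difference along X
  and then along Y. The second difference is symmetric in X and Y, the expression on the right is
  not visibly so.\<close>

lemma second_difference_mvt:
  fixes f :: "'a::euclidean_space \<Rightarrow> real"
  assumes sm: "smooth_on S f" "open S" and h: "h > 0"
    and sub: "\<And>s t. 0 \<le> s \<Longrightarrow> s \<le> h \<Longrightarrow> 0 \<le> t \<Longrightarrow> t \<le> h \<Longrightarrow> x + s *\<^sub>R X + t *\<^sub>R Y \<in> S"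
  obtains s t where "0 \<le> s" "s \<le> h" "0 \<le> t" "t \<le> h"
    "f (x + h *\<^sub>R X + h *\<^sub>R Y) - f (x + h *\<^sub>R X) - f (x + h *\<^sub>R Y) + f x =
     h * h * D2 f (x + s *\<^sub>R X + t *\<^sub>R Y) X Y"
proof -
  let ?D = "\<lambda>z. D1 f z"
  let ?D2 = "\<lambda>z. D1 (\<lambda>z. ?D z X) z"
  have line: "((\<lambda>s. f (p + s *\<^sub>R X)) has_derivative (\<lambda>r. r * ?D (p + s *\<^sub>R X) X)) (at s)"
    if "p + s *\<^sub>R X \<in> S" for p s
  proof -
    have "((\<lambda>s. p + s *\<^sub>R X) has_derivative (\<lambda>r. r *\<^sub>R X)) (at s)"
      by (auto intro!: derivative_eq_intros)
    from has_derivative_compose[OF this smooth_on_has_derivative[OF sm that]]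
    show ?thesis
      using linear_scale[OF has_derivative_linear[OF smooth_on_has_derivative[OF sm that]]] by simp
  qed
  define g where "g s = f (x + h *\<^sub>R Y + s *\<^sub>R X) - f (x + s *\<^sub>R X)" for s
  have "\<exists>s. 0 < s \<and> s < h \<and> g h - g 0 = (h - 0) * (?D (x + h *\<^sub>R Y + s *\<^sub>R X) X - ?D (x + s *\<^sub>R X) X)"
  proof (rule MVT2[OF h])
    fix s assume s: "0 \<le> s" "s \<le> h"
    have "x + h *\<^sub>R Y + s *\<^sub>R X \<in> S" "x + s *\<^sub>R X \<in> S"
      using sub[of s h] sub[of s 0] s h by (simp_all add: algebra_simps)
    from line[OF this(1)] line[OF this(2)]
    show "(g has_real_derivative ?D (x + h *\<^sub>R Y + s *\<^sub>R X) X - ?D (x + s *\<^sub>R X) X) (at s)"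
      unfolding g_def has_field_derivative_def by (auto intro!: derivative_eq_intros simp: algebra_simps)
  qed
  then obtain s where s: "0 < s" "s < h"
    "g h - g 0 = h * (?D (x + h *\<^sub>R Y + s *\<^sub>R X) X - ?D (x + s *\<^sub>R X) X)" by auto
  define k where "k t = ?D (x + s *\<^sub>R X + t *\<^sub>R Y) X" for t
  have "\<exists>t. 0 < t \<and> t < h \<and> k h - k 0 = (h - 0) * ?D2 (x + s *\<^sub>R X + t *\<^sub>R Y) Y"
  proof (rule MVT2[OF h])
    fix t assume t: "0 \<le> t" "t \<le> h"
    have inS: "x + s *\<^sub>R X + t *\<^sub>R Y \<in> S" using sub[of s t] s t by simp
    note d2 = smooth_on_has_derivative[OF smooth_on_frechet_derivative[OF sm, of X] sm(2) inS]
    have "((\<lambda>t. x + s *\<^sub>R X + t *\<^sub>R Y) has_derivative (\<lambda>r. r *\<^sub>R Y)) (at t)"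
      by (auto intro!: derivative_eq_intros)
    from has_derivative_compose[OF this d2]
    show "(k has_real_derivative ?D2 (x + s *\<^sub>R X + t *\<^sub>R Y) Y) (at t)"
      unfolding k_def has_field_derivative_def
      using linear_scale[OF has_derivative_linear[OF d2]] by (simp add: mult.commute[of _ "frechet_derivative _ _ _"])
  qed
  then obtain t where t: "0 < t" "t < h" "k h - k 0 = h * ?D2 (x + s *\<^sub>R X + t *\<^sub>R Y) Y" by auto
  have "?D (x + h *\<^sub>R Y + s *\<^sub>R X) X = k h" "?D (x + s *\<^sub>R X) X = k 0"
    unfolding k_def by (simp_all add: algebra_simps)
  with s t have "g h - g 0 = h * h * ?D2 (x + s *\<^sub>R X + t *\<^sub>R Y) Y" by simp
  then show thesis using that[of s t] s t unfolding g_def by (simp add: algebra_simps)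
qed

lemma smooth_on_second_derivative_commute_real:
  fixes f :: "'a::euclidean_space \<Rightarrow> real"
  assumes sm: "smooth_on S f" "open S" and x: "x \<in> S"
  shows "D2 f x X Y = D2 f x Y X"
proof -
  let ?A = "\<lambda>X Y z. D2 f z X Y"
  have cont: "isCont (?A X Y) x" for X Y
    using smooth_on_continuous_on[OF smooth_on_frechet_derivative[OF smooth_on_frechet_derivative[OF sm, of X] sm(2), of Y]]
      sm(2) x continuous_on_eq_continuous_at by blast
  have "\<bar>?A X Y x - ?A Y X x\<bar> \<le> e" if "e > 0" for e :: real
  proof -
    have ev: "\<forall>\<^sub>F z in nhds x. \<bar>?A X Y z - ?A X Y x\<bar> < e / 2" for X Y
      using tendstoD[OF cont[of X Y, unfolded continuous_at], of "e/2"] \<open>e > 0\<close>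
      by (simp add: dist_real_def eventually_nhds_conv_at)
    have "\<forall>\<^sub>F z in nhds x. z \<in> S" using sm(2) x by (simp add: eventually_nhds_in_open)
    with ev[of X Y] ev[of Y X] have "\<forall>\<^sub>F z in nhds x.
       \<bar>?A X Y z - ?A X Y x\<bar> < e / 2 \<and> \<bar>?A Y X z - ?A Y X x\<bar> < e / 2 \<and> z \<in> S"
      by (intro eventually_conj)
    then obtain d where d: "d > 0" "\<And>z. dist z x < d \<Longrightarrow>
       \<bar>?A X Y z - ?A X Y x\<bar> < e / 2 \<and> \<bar>?A Y X z - ?A Y X x\<bar> < e / 2 \<and> z \<in> S"
      unfolding eventually_nhds_metric by meson
    \<comment> \<open>With this c and \<open>h = d / (2 * c)\<close> the whole parallelogram of side
      vectors \<open>h *\<^sub>R X\<close>, \<open>h *\<^sub>R Y\<close> stays within distance d/2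
      of x. The summand 1 keeps c positive when X and Y vanish.\<close>
    define c where "c = norm X + norm Y + 1"
    define h where "h = d / (2 * c)"
    have pos: "c > 0" unfolding c_def by (simp add: add_nonneg_pos)
    then have h: "h > 0" using d by (simp add: h_def)
    have near: "dist (x + s *\<^sub>R X + t *\<^sub>R Y) x < d" if "0 \<le> s" "s \<le> h" "0 \<le> t" "t \<le> h" for s t X' Y'
    proof -
      have "dist (x + s *\<^sub>R X + t *\<^sub>R Y) x \<le> s * norm X + t * norm Y"
        using norm_triangle_ineq[of "s *\<^sub>R X" "t *\<^sub>R Y"] that by (simp add: dist_norm algebra_simps)
      also have "\<dots> \<le> h * norm X + h * norm Y"
        using that by (intro add_mono mult_right_mono) auto
      also have "\<dots> \<le> h * c" using h by (simp add: c_def algebra_simps)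
      also have "\<dots> = d / 2" using pos by (simp add: h_def)
      finally show ?thesis using d by simp
    qed
    obtain s t where st: "0 \<le> s" "s \<le> h" "0 \<le> t" "t \<le> h"
      "f (x + h *\<^sub>R X + h *\<^sub>R Y) - f (x + h *\<^sub>R X) - f (x + h *\<^sub>R Y) + f x = h * h * ?A X Y (x + s *\<^sub>R X + t *\<^sub>R Y)"
      by (rule second_difference_mvt[OF sm h, of x X Y]) (use near d in auto)
    have near': "dist (x + s *\<^sub>R Y + t *\<^sub>R X) x < d" if "0 \<le> s" "s \<le> h" "0 \<le> t" "t \<le> h" for s t
      using near[of t s] that by (simp add: algebra_simps)
    obtain s' t' where st': "0 \<le> s'" "s' \<le> h" "0 \<le> t'" "t' \<le> h"
      "f (x + h *\<^sub>R Y + h *\<^sub>R X) - f (x + h *\<^sub>R Y) - f (x + h *\<^sub>R X) + f x = h * h * ?A Y X (x + s' *\<^sub>R Y + t' *\<^sub>R X)"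
      by (rule second_difference_mvt[OF sm h, of x Y X]) (use near' d in auto)
    have "h * h * ?A X Y (x + s *\<^sub>R X + t *\<^sub>R Y) = h * h * ?A Y X (x + s' *\<^sub>R Y + t' *\<^sub>R X)"
      using st(5) st'(5) by (simp add: algebra_simps)
    then have "?A X Y (x + s *\<^sub>R X + t *\<^sub>R Y) = ?A Y X (x + s' *\<^sub>R Y + t' *\<^sub>R X)" using h by simp
    then show ?thesis using d(2)[OF near[OF st(1-4)]] d(2)[OF near'[OF st'(1-4)]] by linarith
  qed
  then show ?thesis using field_le_epsilon[of "\<bar>?A X Y x - ?A Y X x\<bar>" 0] by auto
qed

lemma smooth_on_second_derivative_commute:
  fixes f :: "'a::euclidean_space \<Rightarrow> 'b::euclidean_space"
  assumes sm: "smooth_on S f" "open S" and x: "x \<in> S"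
  shows "D2 f x X Y = D2 f x Y X"
proof (rule euclidean_eqI)
  fix b :: 'b assume "b \<in> Basis"
  have sb: "smooth_on S (\<lambda>z. f z \<bullet> b)" by (intro smooth_on_intros sm)
  have 1: "D1 (\<lambda>z. f z \<bullet> b) z = (\<lambda>X. D1 f z X \<bullet> b)" if "z \<in> S" for z
    by (rule frechet_derivative_at[symmetric])
      (auto intro!: derivative_eq_intros smooth_on_has_derivative[OF sm that])
  have 2: "D1 (\<lambda>z. D1 (\<lambda>z. f z \<bullet> b) z X) x Y =
     D2 f x X Y \<bullet> b" for X Y
  proof -
    have "((\<lambda>z. D1 f z X \<bullet> b) has_derivative
      (\<lambda>Y. D2 f x X Y \<bullet> b)) (at x)"
      by (auto intro!: derivative_eq_intros smooth_on_has_derivative[OF smooth_on_frechet_derivative[OF sm] sm(2) x])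
    then have "((\<lambda>z. D1 (\<lambda>z. f z \<bullet> b) z X) has_derivative
      (\<lambda>Y. D2 f x X Y \<bullet> b)) (at x)"
      by (rule has_derivative_transform_within_open[OF _ sm(2) x]) (simp add: 1)
    from frechet_derivative_at[OF this] show ?thesis by metis
  qed
  show "D2 f x X Y \<bullet> b = D2 f x Y X \<bullet> b"
    using smooth_on_second_derivative_commute_real[OF sb sm(2) x, of X Y] by (simp add: 2)
qed

lemma D1_linear: "smooth_on S f \<Longrightarrow> open S \<Longrightarrow> x \<in> S \<Longrightarrow> linear (D1 f x)"
  using smooth_on_has_derivative has_derivative_linear by blast

lemma D2_linear: "smooth_on S f \<Longrightarrow> open S \<Longrightarrow> x \<in> S \<Longrightarrow> linear (D2 f x X)"
  by (rule D1_linear[OF smooth_on_frechet_derivative])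

lemma D2_has_derivative:
  "smooth_on S f \<Longrightarrow> open S \<Longrightarrow> x \<in> S \<Longrightarrow> ((\<lambda>z. D1 f z X) has_derivative D2 f x X) (at x)"
  by (rule smooth_on_has_derivative[OF smooth_on_frechet_derivative])

lemma D1_eqI: "(f has_derivative f') (at x) \<Longrightarrow> D1 f x = f'"
  using frechet_derivative_at by metis

lemma D1_cong_open:
  assumes "open S" "x \<in> S" "\<And>z. z \<in> S \<Longrightarrow> f z = g z" "smooth_on S f"
  shows "D1 f x = D1 g x"
  by (rule frechet_derivative_transform_within_open[OF _ assms(1,2,3)])
    (use smooth_on_has_derivative[OF assms(4,1,2)] in \<open>auto simp: differentiable_def\<close>)

lemma D1_compose:
  assumes "smooth_on S f" "open S" "x \<in> S" "smooth_on T g" "open T" "f x \<in> T"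
  shows "D1 (\<lambda>z. g (f z)) x = (\<lambda>X. D1 g (f x) (D1 f x X))"
  by (rule D1_eqI[OF has_derivative_compose[OF smooth_on_has_derivative[OF assms(1-3)]
          smooth_on_has_derivative[OF assms(4-6)]]])

lemma D2_compose:
  fixes f :: "'a::euclidean_space \<Rightarrow> 'b::euclidean_space" and g :: "'b \<Rightarrow> 'c::euclidean_space"
  assumes f: "smooth_on S f" "open S" "x \<in> S" and g: "smooth_on T g" "open T" and sub: "f ` S \<subseteq> T"
  shows "D2 (\<lambda>z. g (f z)) x X Y = D1 g (f x) (D2 f x X Y) + D2 g (f x) (D1 f x X) (D1 f x Y)"
proof -
  have fx: "f x \<in> T" using f sub by auto
  have *: "D1 g (f z) v = (\<Sum>b\<in>Basis. (v \<bullet> b) *\<^sub>R D1 g (f z) b)" if "z \<in> S" for z v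
  proof -
    have "linear (D1 g (f z))" using D1_linear g sub that by blast
    then have "D1 g (f z) (\<Sum>b\<in>Basis. (v \<bullet> b) *\<^sub>R b) = (\<Sum>b\<in>Basis. (v \<bullet> b) *\<^sub>R D1 g (f z) b)"
      by (simp only: linear_sum linear_scale)
    then show ?thesis by (simp add: euclidean_representation)
  qed
  have "((\<lambda>z. \<Sum>b\<in>Basis. (D1 f z X \<bullet> b) *\<^sub>R D1 g (f z) b) has_derivative
     (\<lambda>Y. \<Sum>b\<in>Basis. (D1 f x X \<bullet> b) *\<^sub>R D2 g (f x) b (D1 f x Y) + (D2 f x X Y \<bullet> b) *\<^sub>R D1 g (f x) b)) (at x)"
    by (rule has_derivative_sum, rule has_derivative_scaleR, rule has_derivative_inner_left,
        rule D2_has_derivative[OF f],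
        rule has_derivative_compose[OF smooth_on_has_derivative[OF f] D2_has_derivative[OF g fx]])
  then have "((\<lambda>z. D1 (\<lambda>z. g (f z)) z X) has_derivative
     (\<lambda>Y. \<Sum>b\<in>Basis. (D1 f x X \<bullet> b) *\<^sub>R D2 g (f x) b (D1 f x Y) + (D2 f x X Y \<bullet> b) *\<^sub>R D1 g (f x) b)) (at x)"
  proof (rule has_derivative_transform_within_open[OF _ f(2,3)])
    fix z assume z: "z \<in> S"
    then have "f z \<in> T" using sub by auto
    from D1_compose[OF f(1,2) z g this] *[OF z]
    show "(\<Sum>b\<in>Basis. (D1 f z X \<bullet> b) *\<^sub>R D1 g (f z) b) = D1 (\<lambda>z. g (f z)) z X" by metis
  qed
  \<comment> \<open>\<open>D2_linear\<close> gives linearity in the second slot only, while the sum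
    runs over the first. The slots are exchanged by symmetry, the sum is collected, and the slots
    are exchanged back.\<close>
  from D1_eqI[OF this] have "D2 (\<lambda>z. g (f z)) x X Y =
     (\<Sum>b\<in>Basis. (D1 f x X \<bullet> b) *\<^sub>R D2 g (f x) (D1 f x Y) b) + D1 g (f x) (D2 f x X Y)"
    by (simp add: sum.distrib smooth_on_second_derivative_commute[OF g fx, of _ "D1 f x Y"] flip: *[OF f(3)])
  also have "(\<Sum>b\<in>Basis. (D1 f x X \<bullet> b) *\<^sub>R D2 g (f x) (D1 f x Y) b)
      = D2 g (f x) (D1 f x Y) (\<Sum>b\<in>Basis. (D1 f x X \<bullet> b) *\<^sub>R b)"
    using D2_linear[OF g fx] by (simp only: linear_sum linear_scale)
  also have "\<dots> = D2 g (f x) (D1 f x X) (D1 f x Y)"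
    by (simp add: euclidean_representation smooth_on_second_derivative_commute[OF g fx, of "D1 f x Y"])
  finally show ?thesis by simp
qed

section \<open>Orthonormal bases for a pulled back inner product\<close>

text \<open>\<open>L X\<close> is the orthogonal projection of w to the range of L. This supplies
  existence for the definite descriptions behind Christoffel symbols and normal parts.\<close>

lemma inj_linear_represent:
  fixes L :: "'a::euclidean_space \<Rightarrow> 'b::euclidean_space"
  assumes "linear L"
  obtains X where "\<And>W. L X \<bullet> L W = w \<bullet> L W"
proof -
  obtain y z where yz: "y \<in> span (range L)" "\<And>v. v \<in> span (range L) \<Longrightarrow> orthogonal z v" "w = y + z"
    by (metis orthogonal_subspace_decomp_exists)
  have "span (range L) = range L"
    using assms by (simp add: linear_subspace_image span_eq_iff)
  then obtain X where "y = L X" using yz(1) by (metis imageE)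
  then have "L X \<bullet> L W = w \<bullet> L W" for W
    using yz(2)[of "L W"] yz(3) by (simp add: orthogonal_def inner_add_left span_base)
  then show thesis by (rule that)
qed

text \<open>The form that \<open>orthonormal_frame\<close> takes for a metric pulled back by L.
  Since the dimension is positive, the condition on the cardinality also makes E finite.\<close>

definition orthonormal_for :: "('a::euclidean_space \<Rightarrow> 'b::real_inner) \<Rightarrow> 'a set \<Rightarrow> bool" where
  "orthonormal_for L E \<longleftrightarrow> card E = DIM('a) \<and> (\<forall>X\<in>E. \<forall>Y\<in>E. L X \<bullet> L Y = (if X = Y then 1 else 0))"

lemma orthonormal_for_exists:
  fixes L :: "'a::euclidean_space \<Rightarrow> 'b::euclidean_space"
  assumes "linear L" "inj L"
  obtains E where "orthonormal_for L E"
proof -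
  obtain B where B: "B \<subseteq> range L" "pairwise orthogonal B" "\<And>x. x \<in> B \<Longrightarrow> norm x = 1" "card B = dim (range L)"
    by (metis orthonormal_basis_subspace linear_subspace_image[OF assms(1) subspace_UNIV])
  have "B = L ` (L -` B)" using B(1) by auto
  moreover have "inj_on L (L -` B)" using assms(2) by (meson inj_on_subset subset_UNIV)
  ultimately have "card (L -` B) = dim (range L)" using B(4) by (metis card_image)
  also have "\<dots> = DIM('a)" using dim_image_eq[OF assms(1), of UNIV] assms(2) by (simp add: dim_UNIV)
  finally have "orthonormal_for L (L -` B)"
    unfolding orthonormal_for_def using B(2,3) assms(2)
    by (auto simp: pairwise_def orthogonal_def norm_eq_1 inj_eq)
  then show thesis by (rule that)
qed

lemma orthonormal_for_expansion:
  fixes L :: "'a::euclidean_space \<Rightarrow> 'b::euclidean_space"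
  assumes "linear L" "orthonormal_for L E"
  shows "finite E" and "X = (\<Sum>Z\<in>E. (L X \<bullet> L Z) *\<^sub>R Z)"
proof -
  have card: "card E = DIM('a)" and on: "\<And>X Y. X \<in> E \<Longrightarrow> Y \<in> E \<Longrightarrow> L X \<bullet> L Y = (if X = Y then 1 else 0)"
    using assms(2) unfolding orthonormal_for_def by auto
  show fin: "finite E" using card DIM_positive by (metis card.infinite less_irrefl)
  have coeff: "L (\<Sum>Z\<in>E. c Z *\<^sub>R Z) \<bullet> L Y = c Y" if "Y \<in> E" for c Y
    using that fin by (simp add: linear_sum[OF assms(1)] linear_scale[OF assms(1)] inner_sum_left on
        if_distrib[of "(*) _"] cong: if_cong)
  have "independent E"
    unfolding independent_explicit_finite_subsets
  proof (intro allI impI)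
    fix S c assume S: "S \<subseteq> E" "finite S" "(\<Sum>v\<in>S. c v *\<^sub>R v) = 0"
    have "(\<Sum>v\<in>E. (if v \<in> S then c v else 0) *\<^sub>R v) = (\<Sum>v\<in>S. c v *\<^sub>R v)"
      using S fin by (intro sum.mono_neutral_cong_right) auto
    then have "(if Y \<in> S then c Y else 0) = 0" if "Y \<in> E" for Y
      using coeff[OF that, of "\<lambda>v. if v \<in> S then c v else 0"] S(3) linear_0[OF assms(1)] by simp
    then show "\<forall>v\<in>S. c v = 0" using S(1) by (metis subsetD)
  qed
  then have "X \<in> span E" using card card_ge_dim_independent[of E UNIV] by (auto simp: dim_UNIV)
  then obtain c where c: "X = (\<Sum>Z\<in>E. c Z *\<^sub>R Z)" using fin by (auto simp: span_finite)
  then show "X = (\<Sum>Z\<in>E. (L X \<bullet> L Z) *\<^sub>R Z)"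
    using coeff[of _ c] by (metis (no_types, lifting) sum.cong)
qed

text \<open>Needed because the frame in \<open>mean_curvature\<close> is an unspecified choice. One
  argument of b is expanded in the other frame, and exchanging the sums reassembles the other
  argument.\<close>

lemma orthonormal_for_trace:
  fixes L :: "'a::euclidean_space \<Rightarrow> 'b::euclidean_space" and b :: "'a \<Rightarrow> 'a \<Rightarrow> 'c::real_vector"
  assumes "linear L" "orthonormal_for L E" "orthonormal_for L E'"
    and b: "\<And>X. linear (b X)" "\<And>Y. linear (\<lambda>X. b X Y)"
  shows "(\<Sum>X\<in>E. b X X) = (\<Sum>X\<in>E'. b X X)"
proof -
  note fin = orthonormal_for_expansion(1)[OF assms(1,2)] orthonormal_for_expansion(1)[OF assms(1,3)]
  note ex = orthonormal_for_expansion(2)[OF assms(1,2)] and ex' = orthonormal_for_expansion(2)[OF assms(1,3)]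
  have "(\<Sum>X\<in>E. b X X) = (\<Sum>X\<in>E. \<Sum>Z\<in>E'. (L X \<bullet> L Z) *\<^sub>R b X Z)"
  proof (rule sum.cong[OF refl])
    fix X
    have "b X (\<Sum>Z\<in>E'. (L X \<bullet> L Z) *\<^sub>R Z) = (\<Sum>Z\<in>E'. (L X \<bullet> L Z) *\<^sub>R b X Z)"
      by (simp only: linear_sum[OF b(1)] linear_scale[OF b(1)])
    then show "b X X = (\<Sum>Z\<in>E'. (L X \<bullet> L Z) *\<^sub>R b X Z)" using ex'[of X] by metis
  qed
  also have "\<dots> = (\<Sum>Z\<in>E'. \<Sum>X\<in>E. (L X \<bullet> L Z) *\<^sub>R b X Z)" by (rule sum.swap)
  also have "\<dots> = (\<Sum>Z\<in>E'. b Z Z)"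
  proof (rule sum.cong[OF refl])
    fix Z
    have "b (\<Sum>X\<in>E. (L Z \<bullet> L X) *\<^sub>R X) Z = (\<Sum>X\<in>E. (L X \<bullet> L Z) *\<^sub>R b X Z)"
      by (simp add: linear_sum[OF b(2)] linear_scale[OF b(2)] inner_commute)
    then show "(\<Sum>X\<in>E. (L X \<bullet> L Z) *\<^sub>R b X Z) = b Z Z" using ex[of Z] by metis
  qed
  finally show ?thesis .
qed

section \<open>Mean curvature for a pulled back Euclidean metric\<close>

text \<open>Used twice: for the sphere, with \<open>\<Psi>\<close> the inverse of a chart, and for
  the space of geodesics, with \<open>\<Psi>\<close> the Pluecker map read in a chart.\<close>

locale pullback_metric =
  fixes V :: "'h::euclidean_space set" and \<Psi> :: "'h \<Rightarrow> 'z::euclidean_space"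
    and U :: "'e::euclidean_space set" and \<Phi> :: "'e \<Rightarrow> 'h" and G :: "'h \<Rightarrow> 'h \<Rightarrow> 'h \<Rightarrow> real" and u :: 'e
  assumes \<Psi>: "smooth_on V \<Psi>" "open V" and \<Phi>: "smooth_on U \<Phi>" "open U" and u: "u \<in> U"
    and sub: "\<Phi> ` U \<subseteq> V"
    and inj_\<Psi>: "inj (D1 \<Psi> (\<Phi> u))" and inj_\<Phi>: "inj (D1 \<Phi> u)"
    and G: "\<And>y X Y. y \<in> V \<Longrightarrow> G y X Y = D1 \<Psi> y X \<bullet> D1 \<Psi> y Y"
begin

lemma \<Phi>u: "\<Phi> u \<in> V" using u sub by auto

lemma linears: "linear (D1 \<Psi> (\<Phi> u))" "linear (D1 \<Phi> u)" "linear (D1 (\<lambda>w. \<Psi> (\<Phi> w)) u)"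
  using D1_linear[OF \<Psi> \<Phi>u] D1_linear[OF \<Phi> u] linear_compose[of "D1 \<Phi> u" "D1 \<Psi> (\<Phi> u)"]
  by (auto simp: D1_compose[OF \<Phi> u \<Psi> \<Phi>u] o_def)

lemma D1_comp: "D1 (\<lambda>w. \<Psi> (\<Phi> w)) u X = D1 \<Psi> (\<Phi> u) (D1 \<Phi> u X)"
  by (simp add: D1_compose[OF \<Phi> u \<Psi> \<Phi>u])

lemma inj_comp: "inj (D1 (\<lambda>w. \<Psi> (\<Phi> w)) u)"
  using inj_compose[OF inj_\<Psi> inj_\<Phi>] by (simp add: D1_compose[OF \<Phi> u \<Psi> \<Phi>u] o_def)

lemma G_derivative:
  "D1 (\<lambda>z. G z Y W) (\<Phi> u) X = D1 \<Psi> (\<Phi> u) Y \<bullet> D2 \<Psi> (\<Phi> u) W X + D2 \<Psi> (\<Phi> u) Y X \<bullet> D1 \<Psi> (\<Phi> u) W"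
proof -
  have "((\<lambda>z. D1 \<Psi> z Y \<bullet> D1 \<Psi> z W) has_derivative
    (\<lambda>X. D1 \<Psi> (\<Phi> u) Y \<bullet> D2 \<Psi> (\<Phi> u) W X + D2 \<Psi> (\<Phi> u) Y X \<bullet> D1 \<Psi> (\<Phi> u) W)) (at (\<Phi> u))"
    by (intro has_derivative_inner D2_has_derivative[OF \<Psi> \<Phi>u])
  then have "((\<lambda>z. G z Y W) has_derivative
    (\<lambda>X. D1 \<Psi> (\<Phi> u) Y \<bullet> D2 \<Psi> (\<Phi> u) W X + D2 \<Psi> (\<Phi> u) Y X \<bullet> D1 \<Psi> (\<Phi> u) W)) (at (\<Phi> u))"
    by (rule has_derivative_transform_within_open[OF _ \<Psi>(2) \<Phi>u]) (simp add: G)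
  then show ?thesis by (simp add: D1_eqI)
qed

text \<open>Koszul's formula for a pulled back metric: by the symmetry of \<open>D2 \<Psi>\<close>
  four of the six terms cancel, so the Christoffel symbol represents the part of
  \<open>D2 \<Psi>\<close> tangent to the image of \<open>\<Psi>\<close>.\<close>

lemma christoffel_inner:
  "D1 \<Psi> (\<Phi> u) (christoffel G (\<Phi> u) X Y) \<bullet> D1 \<Psi> (\<Phi> u) W = D2 \<Psi> (\<Phi> u) X Y \<bullet> D1 \<Psi> (\<Phi> u) W"
proof -
  note comm = smooth_on_second_derivative_commute[OF \<Psi> \<Phi>u]
  have rhs: "1/2 * (D1 (\<lambda>z. G z Y W) (\<Phi> u) X + D1 (\<lambda>z. G z X W) (\<Phi> u) Y - D1 (\<lambda>z. G z X Y) (\<Phi> u) W)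
     = D2 \<Psi> (\<Phi> u) X Y \<bullet> D1 \<Psi> (\<Phi> u) W" for W
    unfolding G_derivative using comm[of W X] comm[of W Y] comm[of X Y] by (simp add: inner_commute)
  obtain Z where Z: "\<And>W. D1 \<Psi> (\<Phi> u) Z \<bullet> D1 \<Psi> (\<Phi> u) W = D2 \<Psi> (\<Phi> u) X Y \<bullet> D1 \<Psi> (\<Phi> u) W"
    by (rule inj_linear_represent[OF linears(1), where w = "D2 \<Psi> (\<Phi> u) X Y"]) blast
  have "christoffel G (\<Phi> u) X Y = Z"
    unfolding christoffel_def rhs G[OF \<Phi>u]
  proof (rule the_equality)
    fix Z' assume "\<forall>W. D1 \<Psi> (\<Phi> u) Z' \<bullet> D1 \<Psi> (\<Phi> u) W = D2 \<Psi> (\<Phi> u) X Y \<bullet> D1 \<Psi> (\<Phi> u) W"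
    then have "D1 \<Psi> (\<Phi> u) (Z' - Z) \<bullet> D1 \<Psi> (\<Phi> u) (Z' - Z) = 0"
      using Z by (simp add: linear_diff[OF linears(1)] inner_diff_left inner_diff_right)
    then show "Z' = Z"
      using inj_\<Psi> by (simp add: linear_diff[OF linears(1)] inj_eq)
  qed (use Z in simp)
  with Z show ?thesis by simp
qed

text \<open>Two candidates for the normal part differ by a tangent vector that is orthogonal to all
  tangent vectors, in particular to itself; this makes the definite description unique.\<close>

lemma normal_part:
  shows "D1 \<Psi> (\<Phi> u) (normal_part G \<Phi> u Z) \<bullet> D1 (\<lambda>w. \<Psi> (\<Phi> w)) u X = 0"
    and "Z - normal_part G \<Phi> u Z \<in> range (D1 \<Phi> u)"
proof -
  obtain X0 where X0: "\<And>W. D1 (\<lambda>w. \<Psi> (\<Phi> w)) u X0 \<bullet> D1 (\<lambda>w. \<Psi> (\<Phi> w)) u W = D1 \<Psi> (\<Phi> u) Z \<bullet> D1 (\<lambda>w. \<Psi> (\<Phi> w)) u W"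
    by (rule inj_linear_represent[OF linears(3), where w = "D1 \<Psi> (\<Phi> u) Z"]) blast
  define N where "N = Z - D1 \<Phi> u X0"
  have N: "D1 \<Psi> (\<Phi> u) N \<bullet> D1 (\<lambda>w. \<Psi> (\<Phi> w)) u X = 0" for X
    using X0[of X] by (simp add: N_def linear_diff[OF linears(1)] inner_diff_left D1_comp)
  have "normal_part G \<Phi> u Z = N"
    unfolding normal_part_def G[OF \<Phi>u] D1_comp[symmetric]
  proof (rule the_equality)
    fix N' assume N': "(\<forall>X. D1 \<Psi> (\<Phi> u) N' \<bullet> D1 (\<lambda>w. \<Psi> (\<Phi> w)) u X = 0) \<and> Z - N' \<in> range (D1 \<Phi> u)"
    then obtain X1 where "Z - N' = D1 \<Phi> u X1" by auto
    then have "N' - N = D1 \<Phi> u (X0 - X1)" by (simp add: N_def linear_diff[OF linears(2)] algebra_simps)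
    then have "D1 \<Psi> (\<Phi> u) (N' - N) \<bullet> D1 \<Psi> (\<Phi> u) (N' - N) =
        D1 \<Psi> (\<Phi> u) (N' - N) \<bullet> D1 (\<lambda>w. \<Psi> (\<Phi> w)) u (X0 - X1)"
      by (simp add: D1_comp)
    also have "\<dots> = 0" using N N' by (simp add: linear_diff[OF linears(1)] inner_diff_left)
    finally show "N' = N" using inj_\<Psi> by (simp add: linear_diff[OF linears(1)] inj_eq)
  qed (use N in \<open>auto simp: N_def\<close>)
  then show "D1 \<Psi> (\<Phi> u) (normal_part G \<Phi> u Z) \<bullet> D1 (\<lambda>w. \<Psi> (\<Phi> w)) u X = 0"
    and "Z - normal_part G \<Phi> u Z \<in> range (D1 \<Phi> u)"
    using N by (auto simp: N_def)
qed

text \<open>The Christoffel term is exactly what the chain rule for \<open>\<Psi> (\<Phi> w)\<close>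
  contributes through \<open>D2 \<Psi>\<close>, as far as vectors
  \<open>D1 \<Psi> (\<Phi> u) N\<close> can see it. Passing to the normal part subtracts a vector
  tangent to the immersion, to which N is orthogonal.\<close>

lemma second_fundamental_form_inner:
  assumes "\<And>X. D1 \<Psi> (\<Phi> u) N \<bullet> D1 (\<lambda>w. \<Psi> (\<Phi> w)) u X = 0"
  shows "D1 \<Psi> (\<Phi> u) (second_fundamental_form G \<Phi> u X X) \<bullet> D1 \<Psi> (\<Phi> u) N
    = D2 (\<lambda>w. \<Psi> (\<Phi> w)) u X X \<bullet> D1 \<Psi> (\<Phi> u) N"
proof -
  define Z where "Z = D2 \<Phi> u X X + christoffel G (\<Phi> u) (D1 \<Phi> u X) (D1 \<Phi> u X)"
  obtain W where "Z - normal_part G \<Phi> u Z = D1 \<Phi> u W" using normal_part(2)[of Z] by auto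
  then have "normal_part G \<Phi> u Z = Z - D1 \<Phi> u W" by (simp add: algebra_simps)
  then have "D1 \<Psi> (\<Phi> u) (normal_part G \<Phi> u Z) = D1 \<Psi> (\<Phi> u) Z - D1 (\<lambda>w. \<Psi> (\<Phi> w)) u W"
    by (simp add: D1_comp linear_diff[OF linears(1)])
  then have "D1 \<Psi> (\<Phi> u) (normal_part G \<Phi> u Z) \<bullet> D1 \<Psi> (\<Phi> u) N = D1 \<Psi> (\<Phi> u) Z \<bullet> D1 \<Psi> (\<Phi> u) N"
    using assms[of W] by (simp add: inner_diff_left inner_diff_right inner_commute)
  also have "\<dots> = D2 (\<lambda>w. \<Psi> (\<Phi> w)) u X X \<bullet> D1 \<Psi> (\<Phi> u) N"
    by (simp add: Z_def linear_add[OF linears(1)] inner_add_left christoffel_inner D2_compose[OF \<Phi> u \<Psi> sub])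
  finally show ?thesis unfolding second_fundamental_form_def Z_def .
qed

lemma mean_curvature_inner:
  obtains E where "orthonormal_for (D1 (\<lambda>w. \<Psi> (\<Phi> w)) u) E"
    and "\<And>X. D1 \<Psi> (\<Phi> u) (mean_curvature G \<Phi> u) \<bullet> D1 (\<lambda>w. \<Psi> (\<Phi> w)) u X = 0"
    and "\<And>N. (\<And>X. D1 \<Psi> (\<Phi> u) N \<bullet> D1 (\<lambda>w. \<Psi> (\<Phi> w)) u X = 0) \<Longrightarrow>
       D1 \<Psi> (\<Phi> u) (mean_curvature G \<Phi> u) \<bullet> D1 \<Psi> (\<Phi> u) N =
       (\<Sum>X\<in>E. D2 (\<lambda>w. \<Psi> (\<Phi> w)) u X X) \<bullet> D1 \<Psi> (\<Phi> u) N"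
proof -
  have eq: "orthonormal_frame G \<Phi> u E \<longleftrightarrow> orthonormal_for (D1 (\<lambda>w. \<Psi> (\<Phi> w)) u) E" for E
    by (simp add: orthonormal_frame_def orthonormal_for_def G[OF \<Phi>u] D1_comp)
  define E where "E = (SOME E. orthonormal_frame G \<Phi> u E)"
  have E: "orthonormal_for (D1 (\<lambda>w. \<Psi> (\<Phi> w)) u) E"
    unfolding E_def eq using orthonormal_for_exists[OF linears(3) inj_comp] someI_ex by metis
  have H: "D1 \<Psi> (\<Phi> u) (mean_curvature G \<Phi> u) \<bullet> w = (\<Sum>X\<in>E. D1 \<Psi> (\<Phi> u) (second_fundamental_form G \<Phi> u X X) \<bullet> w)" for w
    by (simp add: mean_curvature_def linear_sum[OF linears(1)] inner_sum_left flip: E_def)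
  show thesis
    by (rule that[OF E]) (simp_all add: H second_fundamental_form_inner inner_sum_left,
        simp add: second_fundamental_form_def normal_part(1))
qed

text \<open>From left to right this turns the minimality of f into a Euclidean trace condition, from
  right to left it yields the minimality of the Gauss map. In the latter direction the mean
  curvature vector itself serves as N.\<close>

lemma mean_curvature_eq_0_iff:
  assumes "orthonormal_for (D1 (\<lambda>w. \<Psi> (\<Phi> w)) u) E"
  shows "mean_curvature G \<Phi> u = 0 \<longleftrightarrow>
    (\<forall>N. (\<forall>X. D1 \<Psi> (\<Phi> u) N \<bullet> D1 (\<lambda>w. \<Psi> (\<Phi> w)) u X = 0) \<longrightarrow>
      (\<Sum>X\<in>E. D2 (\<lambda>w. \<Psi> (\<Phi> w)) u X X) \<bullet> D1 \<Psi> (\<Phi> u) N = 0)"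
proof -
  have sm: "smooth_on U (\<lambda>w. \<Psi> (\<Phi> w))" by (rule smooth_on_compose[OF \<Phi>(1) \<Psi>(1) sub])
  have lin: "linear (D2 (\<lambda>w. \<Psi> (\<Phi> w)) u X)" "linear (\<lambda>X. D2 (\<lambda>w. \<Psi> (\<Phi> w)) u X Y)" for X Y
    using D2_linear[OF sm \<Phi>(2) u, of X] D2_linear[OF sm \<Phi>(2) u, of Y]
    by (simp_all add: smooth_on_second_derivative_commute[OF sm \<Phi>(2) u, of _ Y])
  obtain E' where E': "orthonormal_for (D1 (\<lambda>w. \<Psi> (\<Phi> w)) u) E'"
    and 1: "\<And>X. D1 \<Psi> (\<Phi> u) (mean_curvature G \<Phi> u) \<bullet> D1 (\<lambda>w. \<Psi> (\<Phi> w)) u X = 0"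
    and 2: "\<And>N. (\<And>X. D1 \<Psi> (\<Phi> u) N \<bullet> D1 (\<lambda>w. \<Psi> (\<Phi> w)) u X = 0) \<Longrightarrow>
       D1 \<Psi> (\<Phi> u) (mean_curvature G \<Phi> u) \<bullet> D1 \<Psi> (\<Phi> u) N =
       (\<Sum>X\<in>E'. D2 (\<lambda>w. \<Psi> (\<Phi> w)) u X X) \<bullet> D1 \<Psi> (\<Phi> u) N"
    by (rule mean_curvature_inner) blast
  note tr = orthonormal_for_trace[OF linears(3) E' assms lin]
  show ?thesis
  proof
    assume 0: "mean_curvature G \<Phi> u = 0"
    show "\<forall>N. (\<forall>X. D1 \<Psi> (\<Phi> u) N \<bullet> D1 (\<lambda>w. \<Psi> (\<Phi> w)) u X = 0) \<longrightarrow>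
      (\<Sum>X\<in>E. D2 (\<lambda>w. \<Psi> (\<Phi> w)) u X X) \<bullet> D1 \<Psi> (\<Phi> u) N = 0"
    proof (intro allI impI)
      fix N assume N: "\<forall>X. D1 \<Psi> (\<Phi> u) N \<bullet> D1 (\<lambda>w. \<Psi> (\<Phi> w)) u X = 0"
      then have "(\<Sum>X\<in>E'. D2 (\<lambda>w. \<Psi> (\<Phi> w)) u X X) \<bullet> D1 \<Psi> (\<Phi> u) N = D1 \<Psi> (\<Phi> u) (mean_curvature G \<Phi> u) \<bullet> D1 \<Psi> (\<Phi> u) N"
        by (intro 2[symmetric]) simp
      then show "(\<Sum>X\<in>E. D2 (\<lambda>w. \<Psi> (\<Phi> w)) u X X) \<bullet> D1 \<Psi> (\<Phi> u) N = 0"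
        using 0 linear_0[OF linears(1)] by (simp add: tr)
    qed
  next
    assume r: "\<forall>N. (\<forall>X. D1 \<Psi> (\<Phi> u) N \<bullet> D1 (\<lambda>w. \<Psi> (\<Phi> w)) u X = 0) \<longrightarrow>
      (\<Sum>X\<in>E. D2 (\<lambda>w. \<Psi> (\<Phi> w)) u X X) \<bullet> D1 \<Psi> (\<Phi> u) N = 0"
    have "D1 \<Psi> (\<Phi> u) (mean_curvature G \<Phi> u) \<bullet> D1 \<Psi> (\<Phi> u) (mean_curvature G \<Phi> u) = 0"
      unfolding 2[OF 1] tr using r 1 by blast
    then show "mean_curvature G \<Phi> u = 0"
      using linear_injective_0[OF linears(1)] inj_\<Psi> by simp
  qed
qed

end

section \<open>Unit normals of a minimal surface in the sphere\<close>

text \<open>The orthogonal complement of the kernel is mapped injectively and has the same image as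
  the whole space.\<close>

lemma linear_rank_nullity:
  fixes f :: "'a::euclidean_space \<Rightarrow> 'b::euclidean_space"
  assumes "linear f"
  shows "dim (range f) + dim {x. f x = 0} = DIM('a)"
proof -
  let ?K = "{x. f x = 0}" and ?C = "{y \<in> UNIV. \<forall>x \<in> {x. f x = 0}. orthogonal x y}"
  have K: "subspace ?K" using assms by (rule linear_subspace_kernel)
  have C: "subspace ?C" using subspace_orthogonal_to_vectors[of ?K] by simp
  have "inj_on f (span ?C)"
  proof -
    have "x = 0" if "x \<in> ?C" "f x = 0" for x
      using that by (auto simp: orthogonal_def)
    then show ?thesis
      unfolding span_eq_iff[THEN iffD2, OF C] using linear_inj_on_iff_eq_0[OF assms C] by blast
  qed
  then have "dim (f ` ?C) = dim ?C" by (rule dim_image_eq[OF assms])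
  moreover have "f ` ?C = range f"
  proof -
    have "f x \<in> f ` ?C" for x
    proof -
      obtain y z where yz: "y \<in> span ?K" "\<And>v. v \<in> span ?K \<Longrightarrow> orthogonal z v" "x = y + z"
        by (metis orthogonal_subspace_decomp_exists)
      have "f y = 0" using yz(1) K by (metis mem_Collect_eq span_eq_iff)
      then have "f x = f z" by (simp add: yz(3) linear_add[OF assms])
      moreover have "z \<in> ?C" using yz(2) by (auto simp: orthogonal_commute span_base)
      ultimately show ?thesis by blast
    qed
    then show ?thesis by blast
  qed
  moreover have "dim ?C + dim ?K = DIM('a)"
    using dim_subspace_orthogonal_to_vectors[OF K subspace_UNIV] by (simp add: dim_UNIV)
  ultimately show ?thesis by simp
qed

lemma smooth_on_inner_const_derivative:
  assumes "smooth_on W f" "smooth_on W g" "open W" "y \<in> W" "\<And>z. z \<in> W \<Longrightarrow> f z \<bullet> g z = c"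
  shows "D1 f y X \<bullet> g y + f y \<bullet> D1 g y X = 0"
proof -
  have "((\<lambda>z. f z \<bullet> g z) has_derivative (\<lambda>X. f y \<bullet> D1 g y X + D1 f y X \<bullet> g y)) (at y)"
    by (intro has_derivative_inner smooth_on_has_derivative[OF _ assms(3,4)] assms)
  moreover have "((\<lambda>z. f z \<bullet> g z) has_derivative (\<lambda>X. 0)) (at y)"
    by (rule has_derivative_transform_within_open[OF has_derivative_const[of c] assms(3,4)]) (simp add: assms(5))
  ultimately have "(\<lambda>X. f y \<bullet> D1 g y X + D1 f y X \<bullet> g y) = (\<lambda>X. 0)"
    by (rule has_derivative_unique)
  then show ?thesis by (metis add.commute)
qed

text \<open>The left side is \<open>(a1*b2 - a2*b1)^2 * (p + r)\<close>: the Gram determinant of two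
  vectors with coordinates \<open>(a1, b1)\<close>, \<open>(a2, b2)\<close> in an orthonormal frame,
  times the trace of the symmetric form with entries p, q, r.\<close>

lemma minimal_quadratic_identity:
  fixes a1 a2 b1 b2 p q r :: real
  assumes "p + r = 0"
  shows "(a2*a2 + b2*b2) * (a1*a1*p + 2*(a1*b1)*q + b1*b1*r)
     - 2 * (a1*a2 + b1*b2) * (a1*a2*p + (a1*b2 + a2*b1)*q + b1*b2*r)
     + (a1*a1 + b1*b1) * (a2*a2*p + 2*(a2*b2)*q + b2*b2*r) = 0"
proof -
  have "r = - p" using assms by simp
  then show ?thesis by (simp add: algebra_simps)
qed

lemma orthogonal_span_iff: "(\<forall>x\<in>span S. orthogonal x \<eta>) \<longleftrightarrow> (\<forall>x\<in>S. orthogonal x \<eta>)"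
proof (intro iffI ballI)
  fix x assume "\<forall>x\<in>S. orthogonal x \<eta>" "x \<in> span S"
  then have "orthogonal \<eta> x" by (intro orthogonal_to_span[of x S \<eta>]) (auto simp: orthogonal_commute)
  then show "orthogonal x \<eta>" by (simp add: orthogonal_commute)
qed (simp add: span_base)

section \<open>Unit normals in coordinates: Lagrangian condition and cubic form\<close>

text \<open>All that is used about a chart of the unit normal bundle: \<open>\<phi>\<close>
  parametrises the surface, \<open>\<upsilon> y\<close> gives the surface coordinates of the foot
  point and \<open>\<nu> y\<close> the normal. The assumption \<open>inj\<close> says that
  \<open>(\<upsilon>, \<nu>)\<close> is an immersion, and \<open>dim_z\<close> that y has as many
  parameters as the bundle has dimensions.\<close>

locale unit_normal_graph =
  fixes U :: "'a::euclidean_space set" and \<phi> :: "'a \<Rightarrow> 'z::euclidean_space"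
    and W :: "'e::euclidean_space set" and \<upsilon> :: "'e \<Rightarrow> 'a" and \<nu> :: "'e \<Rightarrow> 'z"
  assumes \<phi>: "smooth_on U \<phi>" "open U" and \<phi>_unit: "\<And>w. w \<in> U \<Longrightarrow> \<phi> w \<bullet> \<phi> w = 1"
    and \<phi>_inj: "\<And>w. w \<in> U \<Longrightarrow> inj (D1 \<phi> w)"
    and \<phi>_minimal: "\<And>w v E. w \<in> U \<Longrightarrow> \<phi> w \<bullet> v = 0 \<Longrightarrow> (\<And>X. D1 \<phi> w X \<bullet> v = 0) \<Longrightarrow>
        orthonormal_for (D1 \<phi> w) E \<Longrightarrow> (\<Sum>X\<in>E. D2 \<phi> w X X) \<bullet> v = 0"
    and W: "open W" and \<upsilon>: "smooth_on W \<upsilon>" and \<nu>: "smooth_on W \<nu>" and sub: "\<upsilon> ` W \<subseteq> U"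
    and \<nu>_unit: "\<And>y. y \<in> W \<Longrightarrow> \<nu> y \<bullet> \<nu> y = 1"
    and \<phi>_\<nu>: "\<And>y. y \<in> W \<Longrightarrow> \<phi> (\<upsilon> y) \<bullet> \<nu> y = 0"
    and D\<phi>_\<nu>: "\<And>y X. y \<in> W \<Longrightarrow> D1 \<phi> (\<upsilon> y) X \<bullet> \<nu> y = 0"
    and inj: "\<And>y X. y \<in> W \<Longrightarrow> D1 \<upsilon> y X = 0 \<Longrightarrow> D1 \<nu> y X = 0 \<Longrightarrow> X = 0"
    and dim_a: "DIM('a) = 2" and dim_z: "DIM('z) = DIM('e) + 2"
begin

definition F :: "'e \<Rightarrow> 'z" where "F y = \<phi> (\<upsilon> y)"

text \<open>The differential of the spherical Gauss map \<open>(F, \<nu>)\<close>. Its inner product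
  turns out in \<open>inner_D1_\<Psi>_\<Phi>\<close> to be the metric induced by the geodesic Gauss
  map.\<close>

definition L :: "'e \<Rightarrow> 'e \<Rightarrow> 'z \<times> 'z" where "L y X = (D1 F y X, D1 \<nu> y X)"

lemma F: "smooth_on W F"
  unfolding F_def by (rule smooth_on_compose[OF \<upsilon> \<phi>(1) sub])

lemma \<upsilon>_in: "y \<in> W \<Longrightarrow> \<upsilon> y \<in> U" using sub by auto

lemma D1_F: "y \<in> W \<Longrightarrow> D1 F y X = D1 \<phi> (\<upsilon> y) (D1 \<upsilon> y X)"
  unfolding F_def by (simp add: D1_compose[OF \<upsilon> W _ \<phi> \<upsilon>_in])

lemma D2_F: "y \<in> W \<Longrightarrow> D2 F y X Y = D1 \<phi> (\<upsilon> y) (D2 \<upsilon> y X Y) + D2 \<phi> (\<upsilon> y) (D1 \<upsilon> y X) (D1 \<upsilon> y Y)"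
  unfolding F_def by (rule D2_compose[OF \<upsilon> W _ \<phi> sub])

lemma D2_sym: "y \<in> W \<Longrightarrow> D2 F y X Y = D2 F y Y X" "y \<in> W \<Longrightarrow> D2 \<nu> y X Y = D2 \<nu> y Y X"
  by (rule smooth_on_second_derivative_commute[OF _ W]; simp add: F \<nu>)+

lemma linears:
  assumes "y \<in> W"
  shows "linear (D1 F y)" "linear (D1 \<nu> y)" "linear (D1 \<upsilon> y)" "linear (D1 \<phi> (\<upsilon> y))" "linear (L y)"
    "linear (D2 F y X)" "linear (D2 \<nu> y X)"
    "linear (\<lambda>Z. D2 F y Z X)" "linear (\<lambda>Z. D2 \<nu> y Z X)" "linear (D2 \<phi> (\<upsilon> y) u)" "linear (\<lambda>v. D2 \<phi> (\<upsilon> y) v u)"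
proof -
  show 1: "linear (D1 F y)" "linear (D1 \<nu> y)" "linear (D1 \<upsilon> y)" "linear (D1 \<phi> (\<upsilon> y))"
    using D1_linear[OF F W assms] D1_linear[OF \<nu> W assms] D1_linear[OF \<upsilon> W assms] D1_linear[OF \<phi> \<upsilon>_in[OF assms]] by auto
  show "linear (L y)"
    unfolding L_def[abs_def] by (rule linearI) (simp_all add: linear_add[OF 1(1)] linear_add[OF 1(2)] linear_scale[OF 1(1)] linear_scale[OF 1(2)])
  show 2: "linear (D2 F y X)" "linear (D2 \<nu> y X)"  "linear (D2 \<phi> (\<upsilon> y) u)" for X u
    using D2_linear[OF F W assms] D2_linear[OF \<nu> W assms] D2_linear[OF \<phi> \<upsilon>_in[OF assms]] by auto
  show "linear (\<lambda>Z. D2 F y Z X)" "linear (\<lambda>Z. D2 \<nu> y Z X)" "linear (\<lambda>v. D2 \<phi> (\<upsilon> y) v u)"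
    using 2 by (simp_all add: D2_sym(1)[OF assms, of _ X] D2_sym(2)[OF assms, of _ X]
       smooth_on_second_derivative_commute[OF \<phi> \<upsilon>_in[OF assms], of _ u])
qed

lemma orthogonality:
  assumes y: "y \<in> W"
  shows "F y \<bullet> F y = 1" "F y \<bullet> \<nu> y = 0" "D1 F y X \<bullet> F y = 0" "D1 F y X \<bullet> \<nu> y = 0" "D1 \<nu> y X \<bullet> \<nu> y = 0" "D1 \<nu> y X \<bullet> F y = 0"
    "D1 \<phi> (\<upsilon> y) v \<bullet> F y = 0" "D1 \<phi> (\<upsilon> y) v \<bullet> \<nu> y = 0"
proof -
  show "F y \<bullet> F y = 1" "F y \<bullet> \<nu> y = 0" "D1 \<phi> (\<upsilon> y) v \<bullet> \<nu> y = 0"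
    using \<phi>_unit[OF \<upsilon>_in[OF y]] \<phi>_\<nu>[OF y] D\<phi>_\<nu>[OF y] by (auto simp: F_def)
  show 0: "D1 \<phi> (\<upsilon> y) v \<bullet> F y = 0" for v
    using smooth_on_inner_const_derivative[OF \<phi>(1) \<phi>(1) \<phi>(2) \<upsilon>_in[OF y], of 1 v] \<phi>_unit
    by (simp add: F_def inner_commute)
  show "D1 F y X \<bullet> F y = 0" using 0 by (simp add: D1_F[OF y])
  show 1: "D1 F y X \<bullet> \<nu> y = 0" using D\<phi>_\<nu>[OF y] by (simp add: D1_F[OF y])
  show "D1 \<nu> y X \<bullet> \<nu> y = 0"
    using smooth_on_inner_const_derivative[OF \<nu> \<nu> W y, of 1 X] \<nu>_unit by (simp add: inner_commute)
  show "D1 \<nu> y X \<bullet> F y = 0"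
    using smooth_on_inner_const_derivative[OF \<nu> F W y, of 0 X] \<phi>_\<nu> 1 by (simp add: F_def inner_commute)
qed

lemma inj_L: "y \<in> W \<Longrightarrow> L y X = 0 \<Longrightarrow> X = 0"
  using inj[of y X] linear_injective_0[OF linears(4)] \<phi>_inj[OF \<upsilon>_in]
  by (auto simp: L_def D1_F zero_prod_def)

text \<open>Derivative of \<open>D1 F y X \<bullet> \<nu> y = 0\<close> in direction Y. The right
  side is symmetric in X and Y, which is the next lemma, the Lagrangian condition.\<close>

lemma shape: "y \<in> W \<Longrightarrow> D1 \<nu> y Y \<bullet> D1 F y X = - (\<nu> y \<bullet> D2 F y X Y)"
  using smooth_on_inner_const_derivative[OF \<nu> smooth_on_frechet_derivative[OF F W, of X] W, of y 0 Y] orthogonality(4)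
  by (simp add: inner_commute)

lemma isotropic: "y \<in> W \<Longrightarrow> D1 \<nu> y Y \<bullet> D1 F y X = D1 \<nu> y X \<bullet> D1 F y Y"
  by (simp add: shape D2_sym(1)[of y X Y])

text \<open>The second fundamental form of the Gauss map on X, Y, paired with the normal vector that
  the complex structure makes out of the image of Z; see \<open>lagrangian_normal\<close> and
  \<open>mean_curvature_0\<close>.\<close>

definition C :: "'e \<Rightarrow> 'e \<Rightarrow> 'e \<Rightarrow> 'e \<Rightarrow> real" where
  "C y X Y Z = D2 \<nu> y X Y \<bullet> D1 F y Z - D2 F y X Y \<bullet> D1 \<nu> y Z"

lemma C_sym: "y \<in> W \<Longrightarrow> C y X Y Z = C y Y X Z"
  by (simp add: C_def D2_sym[of y X Y])

text \<open>The two sides differ by the derivative in direction Y of the identity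
  \<open>isotropic\<close> for constant X and Z. Together with \<open>C_sym\<close> it makes C
  totally symmetric.\<close>

lemma C_sym': 
  assumes y: "y \<in> W"
  shows "C y X Y Z = C y Z Y X"
proof -
  have "((\<lambda>z. D1 \<nu> z X \<bullet> D1 F z Z - D1 \<nu> z Z \<bullet> D1 F z X) has_derivative
     (\<lambda>Y. (D1 \<nu> y X \<bullet> D2 F y Z Y + D2 \<nu> y X Y \<bullet> D1 F y Z) - (D1 \<nu> y Z \<bullet> D2 F y X Y + D2 \<nu> y Z Y \<bullet> D1 F y X))) (at y)"
    by (intro has_derivative_diff has_derivative_inner D2_has_derivative[OF F W y] D2_has_derivative[OF \<nu> W y])
  moreover have "((\<lambda>z. D1 \<nu> z X \<bullet> D1 F z Z - D1 \<nu> z Z \<bullet> D1 F z X) has_derivative (\<lambda>Y. 0)) (at y)"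
    by (rule has_derivative_transform_within_open[OF has_derivative_const[of 0] W y]) (simp add: isotropic)
  ultimately have "(\<lambda>Y. (D1 \<nu> y X \<bullet> D2 F y Z Y + D2 \<nu> y X Y \<bullet> D1 F y Z) - (D1 \<nu> y Z \<bullet> D2 F y X Y + D2 \<nu> y Z Y \<bullet> D1 F y X)) = (\<lambda>Y. 0)"
    by (rule has_derivative_unique)
  then have "(D1 \<nu> y X \<bullet> D2 F y Z Y + D2 \<nu> y X Y \<bullet> D1 F y Z) - (D1 \<nu> y Z \<bullet> D2 F y X Y + D2 \<nu> y Z Y \<bullet> D1 F y X) = 0"
    by metis
  then show ?thesis by (simp add: C_def inner_commute)
qed

lemma tangent_frame:
  assumes y: "y \<in> W"
  obtains E1 E2 where "D1 \<phi> (\<upsilon> y) E1 \<bullet> D1 \<phi> (\<upsilon> y) E1 = 1" "D1 \<phi> (\<upsilon> y) E2 \<bullet> D1 \<phi> (\<upsilon> y) E2 = 1"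
    "D1 \<phi> (\<upsilon> y) E1 \<bullet> D1 \<phi> (\<upsilon> y) E2 = 0" "\<And>v. \<exists>a b. v = a *\<^sub>R E1 + b *\<^sub>R E2"
    "(D2 \<phi> (\<upsilon> y) E1 E1 + D2 \<phi> (\<upsilon> y) E2 E2) \<bullet> \<nu> y = 0"
proof -
  let ?P = "D1 \<phi> (\<upsilon> y)"
  obtain E where E: "orthonormal_for ?P E"
    by (rule orthonormal_for_exists[OF linears(4)[OF y] \<phi>_inj[OF \<upsilon>_in[OF y]]])
  then have "card E = 2" by (simp add: orthonormal_for_def dim_a)
  then obtain E1 E2 where E12: "E = {E1, E2}" "E1 \<noteq> E2" by (auto simp: card_2_iff)
  show thesis
  proof (rule that[of E1 E2])
    show "?P E1 \<bullet> ?P E1 = 1" "?P E2 \<bullet> ?P E2 = 1" "?P E1 \<bullet> ?P E2 = 0"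
      using E E12 by (auto simp: orthonormal_for_def)
    show "\<exists>a b. v = a *\<^sub>R E1 + b *\<^sub>R E2" for v
      using orthonormal_for_expansion(2)[OF linears(4)[OF y] E, of v] E12 by auto
    show "(D2 \<phi> (\<upsilon> y) E1 E1 + D2 \<phi> (\<upsilon> y) E2 E2) \<bullet> \<nu> y = 0"
      using \<phi>_minimal[OF \<upsilon>_in[OF y] _ _ E, of "\<nu> y"] orthogonality[OF y] E12 by (simp add: F_def)
  qed
qed

text \<open>This is \<open>det g \<cdot> tr\<^sub>g h = 0\<close> for the first and second fundamental forms \<open>g\<close>, \<open>h\<close>; in this polynomial
  form it holds for arbitrary \<open>X1\<close>, \<open>X2\<close> and can be differentiated.\<close>

lemma minimal_quadratic:
  assumes y: "y \<in> W"
  shows "(D1 F y X2 \<bullet> D1 F y X2) * (D1 \<nu> y X1 \<bullet> D1 F y X1) - 2 * (D1 F y X1 \<bullet> D1 F y X2) * (D1 \<nu> y X1 \<bullet> D1 F y X2)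
    + (D1 F y X1 \<bullet> D1 F y X1) * (D1 \<nu> y X2 \<bullet> D1 F y X2) = 0"
proof -
  let ?P = "D1 \<phi> (\<upsilon> y)" and ?Q = "D2 \<phi> (\<upsilon> y)"
  obtain E1 E2 where E: "?P E1 \<bullet> ?P E1 = 1" "?P E2 \<bullet> ?P E2 = 1" "?P E1 \<bullet> ?P E2 = 0"
    "\<And>v. \<exists>a b. v = a *\<^sub>R E1 + b *\<^sub>R E2" and tr: "(?Q E1 E1 + ?Q E2 E2) \<bullet> \<nu> y = 0"
    using tangent_frame[OF y] by blast
  obtain a1 b1 where 1: "D1 \<upsilon> y X1 = a1 *\<^sub>R E1 + b1 *\<^sub>R E2" using E(4) by blast
  obtain a2 b2 where 2: "D1 \<upsilon> y X2 = a2 *\<^sub>R E1 + b2 *\<^sub>R E2" using E(4) by blast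
  have E3: "?P E2 \<bullet> ?P E1 = 0" using E(3) by (simp add: inner_commute)
  define p q r where pqr: "p = ?Q E1 E1 \<bullet> \<nu> y" "q = ?Q E1 E2 \<bullet> \<nu> y" "r = ?Q E2 E2 \<bullet> \<nu> y"
  have q': "?Q E2 E1 \<bullet> \<nu> y = q"
    using smooth_on_second_derivative_commute[OF \<phi> \<upsilon>_in[OF y], of E1 E2] by (simp add: pqr)
  have g: "D1 F y X \<bullet> D1 F y X' = a * a' + b * b'"
    if "D1 \<upsilon> y X = a *\<^sub>R E1 + b *\<^sub>R E2" "D1 \<upsilon> y X' = a' *\<^sub>R E1 + b' *\<^sub>R E2" for X X' a a' b b'
    by (simp add: D1_F[OF y] that linear_add[OF linears(4)[OF y]] linear_scale[OF linears(4)[OF y]]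
       inner_add_left inner_add_right E E3)
  have h: "D1 \<nu> y X \<bullet> D1 F y X' = - (a * a' * p + (a * b' + a' * b) * q + b * b' * r)"
    if "D1 \<upsilon> y X = a *\<^sub>R E1 + b *\<^sub>R E2" "D1 \<upsilon> y X' = a' *\<^sub>R E1 + b' *\<^sub>R E2" for X X' a a' b b'
  proof -
    \<comment> \<open>The remaining term
      \<open>D1 \<phi> (\<upsilon> y) (D2 \<upsilon> y X' X)\<close> is tangent to the surface and
      dies against \<open>\<nu>\<close>.\<close>
    have "D2 F y X' X \<bullet> \<nu> y = ?Q (D1 \<upsilon> y X') (D1 \<upsilon> y X) \<bullet> \<nu> y"
      by (simp add: D2_F[OF y] inner_add_left orthogonality[OF y])
    also have "\<dots> = a * a' * p + (a * b' + a' * b) * q + b * b' * r"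
      unfolding that
      by (simp add: linear_add[OF linears(10)[OF y]] linear_scale[OF linears(10)[OF y]]
         linear_add[OF linears(11)[OF y]] linear_scale[OF linears(11)[OF y]] inner_add_left q' flip: pqr)
        (simp add: algebra_simps)
    finally show ?thesis by (simp add: shape[OF y] inner_commute)
  qed
  have "p + r = 0" using tr by (simp add: pqr inner_add_left)
  from minimal_quadratic_identity[OF this, of a2 b2 a1 b1 q]
  show ?thesis unfolding g[OF 1 1] g[OF 1 2] g[OF 2 2] h[OF 1 1] h[OF 1 2] h[OF 2 2]
    by (simp add: algebra_simps)
qed

text \<open>X1 and X2 are constant vectors, orthonormal at the point y only, so orthonormality is
  inserted after differentiating \<open>minimal_quadratic\<close>. Because the matrix with rows
  \<open>(p, q)\<close>, \<open>(q, -p)\<close> is symmetric and trace free, the derivatives of the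
  metric coefficients contribute minus twice the sum of
  \<open>D1 \<nu> y X \<bullet> D2 F y X Y\<close> over X1 and X2. This turns the plus sign of the
  product rule into the minus sign in C.\<close>

lemma minimal_derivative:
  assumes y: "y \<in> W"
    and on: "D1 F y X1 \<bullet> D1 F y X1 = 1" "D1 F y X2 \<bullet> D1 F y X2 = 1" "D1 F y X1 \<bullet> D1 F y X2 = 0"
    and \<nu>1: "D1 \<nu> y X1 = p *\<^sub>R D1 F y X1 + q *\<^sub>R D1 F y X2"
    and \<nu>2: "D1 \<nu> y X2 = q *\<^sub>R D1 F y X1 - p *\<^sub>R D1 F y X2"
  shows "C y X1 Y X1 + C y X2 Y X2 = 0"
proof -
  let ?F = "D1 F" and ?N = "D1 \<nu>"
  have "((\<lambda>y. (?F y X2 \<bullet> ?F y X2) * (?N y X1 \<bullet> ?F y X1) - 2 * (?F y X1 \<bullet> ?F y X2) * (?N y X1 \<bullet> ?F y X2)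
    + (?F y X1 \<bullet> ?F y X1) * (?N y X2 \<bullet> ?F y X2)) has_derivative
    (\<lambda>Y. (?F y X2 \<bullet> ?F y X2) * (?N y X1 \<bullet> D2 F y X1 Y + D2 \<nu> y X1 Y \<bullet> ?F y X1)
      + (?F y X2 \<bullet> D2 F y X2 Y + D2 F y X2 Y \<bullet> ?F y X2) * (?N y X1 \<bullet> ?F y X1)
      - 2 * ((?F y X1 \<bullet> ?F y X2) * (?N y X1 \<bullet> D2 F y X2 Y + D2 \<nu> y X1 Y \<bullet> ?F y X2)
      + (?F y X1 \<bullet> D2 F y X2 Y + D2 F y X1 Y \<bullet> ?F y X2) * (?N y X1 \<bullet> ?F y X2))
      + ((?F y X1 \<bullet> ?F y X1) * (?N y X2 \<bullet> D2 F y X2 Y + D2 \<nu> y X2 Y \<bullet> ?F y X2)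
      + (?F y X1 \<bullet> D2 F y X1 Y + D2 F y X1 Y \<bullet> ?F y X1) * (?N y X2 \<bullet> ?F y X2)))) (at y)"
    unfolding mult.assoc[of 2]
    by (intro has_derivative_add has_derivative_diff has_derivative_mult has_derivative_mult_right has_derivative_inner
      D2_has_derivative[OF F W y] D2_has_derivative[OF \<nu> W y])
  from has_derivative_unique[OF this has_derivative_transform_within_open[OF has_derivative_const[of 0] W y]]
  have "(?F y X2 \<bullet> ?F y X2) * (?N y X1 \<bullet> D2 F y X1 Y + D2 \<nu> y X1 Y \<bullet> ?F y X1)
      + (?F y X2 \<bullet> D2 F y X2 Y + D2 F y X2 Y \<bullet> ?F y X2) * (?N y X1 \<bullet> ?F y X1)
      - 2 * ((?F y X1 \<bullet> ?F y X2) * (?N y X1 \<bullet> D2 F y X2 Y + D2 \<nu> y X1 Y \<bullet> ?F y X2)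
      + (?F y X1 \<bullet> D2 F y X2 Y + D2 F y X1 Y \<bullet> ?F y X2) * (?N y X1 \<bullet> ?F y X2))
      + ((?F y X1 \<bullet> ?F y X1) * (?N y X2 \<bullet> D2 F y X2 Y + D2 \<nu> y X2 Y \<bullet> ?F y X2)
      + (?F y X1 \<bullet> D2 F y X1 Y + D2 F y X1 Y \<bullet> ?F y X1) * (?N y X2 \<bullet> ?F y X2)) = 0"
    by (metis (no_types, lifting) minimal_quadratic)
  then show ?thesis
    unfolding C_def using on on(3)[unfolded inner_commute[of "?F y X1"]]
    by (simp add: \<nu>1 \<nu>2 inner_add_left inner_add_right inner_diff_left inner_diff_right
        inner_commute[of "D1 F y _" "D2 _ _ _ _"] algebra_simps)
qed

section \<open>Vertical and horizontal directions, and the trace of the cubic form\<close>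

text \<open>The vertical space, tangent to the fibre over a fixed foot point.\<close>

definition K :: "'e \<Rightarrow> 'e set" where "K y = {X. D1 \<upsilon> y X = 0}"

text \<open>The directions in which a unit normal can move while its foot point stays fixed: the
  tangent space at \<open>\<nu> y\<close> of the unit sphere in the normal space.\<close>

definition conormal :: "'e \<Rightarrow> 'z set" where
  "conormal y = {\<eta>. F y \<bullet> \<eta> = 0 \<and> \<nu> y \<bullet> \<eta> = 0 \<and> (\<forall>v. D1 \<phi> (\<upsilon> y) v \<bullet> \<eta> = 0)}"

text \<open>The position, the normal and the tangent plane span four of the
  \<open>DIM('e) + 2\<close> dimensions.\<close>

lemma dim_conormal:
  assumes y: "y \<in> W"
  shows "dim (conormal y) + 2 = DIM('e)" "subspace (conormal y)"
proof -
  let ?R = "range (D1 \<phi> (\<upsilon> y))" and ?T = "span (insert (\<nu> y) (insert (F y) (range (D1 \<phi> (\<upsilon> y)))))"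
  have R: "span ?R = ?R" using linear_subspace_image[OF linears(4)[OF y] subspace_UNIV] by (simp add: span_eq_iff)
  have "dim ?R = 2"
    using dim_image_eq[OF linears(4)[OF y], of UNIV] \<phi>_inj[OF \<upsilon>_in[OF y]] by (simp add: dim_UNIV dim_a)
  moreover have "F y \<notin> span ?R"
    unfolding R using orthogonality(1,7)[OF y] by auto
  moreover have "\<nu> y \<notin> span (insert (F y) ?R)"
  proof
    assume "\<nu> y \<in> span (insert (F y) ?R)"
    then obtain k where "\<nu> y - k *\<^sub>R F y \<in> span ?R" by (auto simp: span_insert)
    then obtain v where "\<nu> y - k *\<^sub>R F y = D1 \<phi> (\<upsilon> y) v" unfolding R by blast
    then have "(\<nu> y - k *\<^sub>R F y) \<bullet> \<nu> y = 0" using orthogonality(8)[OF y] by simp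
    then show False using \<nu>_unit[OF y] orthogonality(2)[OF y] by (simp add: inner_diff_left)
  qed
  ultimately have T: "dim ?T = 4" by (simp add: dim_insert)
  have eq: "conormal y = {\<eta> \<in> UNIV. \<forall>x\<in>?T. orthogonal x \<eta>}"
    unfolding orthogonal_span_iff by (auto simp: conormal_def orthogonal_def)
  show "dim (conormal y) + 2 = DIM('e)"
    using dim_subspace_orthogonal_to_vectors[OF subspace_span subspace_UNIV, of "insert (\<nu> y) (insert (F y) ?R)"] T
    unfolding eq by (simp add: dim_UNIV dim_z)
  show "subspace (conormal y)" unfolding eq using subspace_orthogonal_to_vectors[of ?T] by simp
qed

text \<open>Two bounds meet. \<open>D1 \<nu> y\<close> embeds K into \<open>conormal\<close>, which
  bounds the dimension of K from above by \<open>DIM('e) - 2\<close>; rank and nullity of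
  \<open>D1 \<upsilon> y\<close>, whose target is a plane, bound it from below by the same number.
  Equality forces both surjectivity statements.\<close>

lemma vertical:
  assumes y: "y \<in> W"
  shows "surj (D1 \<upsilon> y)" "dim (K y) + 2 = DIM('e)" "D1 \<nu> y ` K y = conormal y" "subspace (K y)"
proof -
  show subK: "subspace (K y)" unfolding K_def by (rule linear_subspace_kernel[OF linears(3)[OF y]])
  have inj: "inj_on (D1 \<nu> y) (K y)"
    using linear_inj_on_iff_eq_0[OF linears(2)[OF y] subK] inj[OF y] by (simp add: K_def)
  have sub: "D1 \<nu> y ` K y \<subseteq> conormal y"
  proof
    fix \<eta> assume "\<eta> \<in> D1 \<nu> y ` K y"
    then obtain V where V: "D1 \<upsilon> y V = 0" "\<eta> = D1 \<nu> y V" by (auto simp: K_def)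
    have "D1 \<phi> (\<upsilon> y) v \<bullet> \<eta> = 0" for v
    proof -
      \<comment> \<open>The relation \<open>D\<phi>_\<nu>\<close> is differentiated along V; the
        term in which the foot point moves vanishes because V is vertical.\<close>
      have "((\<lambda>z. D1 \<phi> (\<upsilon> z) v) has_derivative (\<lambda>X. D2 \<phi> (\<upsilon> y) v (D1 \<upsilon> y X))) (at y)"
        by (rule has_derivative_compose[OF smooth_on_has_derivative[OF \<upsilon> W y] D2_has_derivative[OF \<phi> \<upsilon>_in[OF y]]])
      from has_derivative_inner[OF this smooth_on_has_derivative[OF \<nu> W y]]
      have "((\<lambda>z. D1 \<phi> (\<upsilon> z) v \<bullet> \<nu> z) has_derivative
         (\<lambda>X. D1 \<phi> (\<upsilon> y) v \<bullet> D1 \<nu> y X + D2 \<phi> (\<upsilon> y) v (D1 \<upsilon> y X) \<bullet> \<nu> y)) (at y)" .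
      moreover have "((\<lambda>z. D1 \<phi> (\<upsilon> z) v \<bullet> \<nu> z) has_derivative (\<lambda>X. 0)) (at y)"
        by (rule has_derivative_transform_within_open[OF has_derivative_const[of 0] W y]) (simp add: D\<phi>_\<nu>)
      ultimately have "(\<lambda>X. D1 \<phi> (\<upsilon> y) v \<bullet> D1 \<nu> y X + D2 \<phi> (\<upsilon> y) v (D1 \<upsilon> y X) \<bullet> \<nu> y) = (\<lambda>X. 0)"
        by (rule has_derivative_unique)
      then have "D1 \<phi> (\<upsilon> y) v \<bullet> D1 \<nu> y V + D2 \<phi> (\<upsilon> y) v (D1 \<upsilon> y V) \<bullet> \<nu> y = 0" by metis
      then show ?thesis by (simp add: V linear_0[OF linears(10)[OF y]])
    qed
    then show "\<eta> \<in> conormal y" using orthogonality[OF y] by (simp add: conormal_def V inner_commute)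
  qed
  have dimK: "dim (D1 \<nu> y ` K y) = dim (K y)"
    by (rule dim_image_eq[OF linears(2)[OF y]]) (use inj subK in \<open>simp add: span_eq_iff[THEN iffD2]\<close>)
  then have le: "dim (K y) + 2 \<le> DIM('e)"
    using dim_subset[OF sub] dim_conormal(1)[OF y] by simp
  have rn: "dim (range (D1 \<upsilon> y)) + dim (K y) = DIM('e)"
    using linear_rank_nullity[OF linears(3)[OF y]] by (simp add: K_def)
  have "dim (range (D1 \<upsilon> y)) \<le> 2" using dim_subset_UNIV[of "range (D1 \<upsilon> y)"] dim_a by simp
  with le rn have r: "dim (range (D1 \<upsilon> y)) = DIM('a)" and k: "dim (K y) + 2 = DIM('e)" using dim_a by auto
  then show "surj (D1 \<upsilon> y)" "dim (K y) + 2 = DIM('e)"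
    using linear_subspace_image[OF linears(3)[OF y] subspace_UNIV] dim_eq_full by (metis span_eq_iff, simp)
  show "D1 \<nu> y ` K y = conormal y"
    by (rule subspace_dim_equal[OF linear_subspace_image[OF linears(2)[OF y] subK] dim_conormal(2)[OF y] sub])
      (use dim_conormal(1)[OF y] k dimK in simp)
qed

text \<open>\<open>D1 F y V\<close> vanishes, and \<open>D2 F y V Y\<close> is tangent to the
  surface while \<open>D1 \<nu> y V\<close> is normal to it. Hence both terms of C vanish.\<close>

lemma vertical_normal:
  assumes y: "y \<in> W" and V: "V \<in> K y"
  shows "D1 F y V = 0" "D1 \<phi> (\<upsilon> y) v \<bullet> D1 \<nu> y V = 0" "D2 F y V Y = D1 \<phi> (\<upsilon> y) (D2 \<upsilon> y V Y)" "C y V Y V = 0"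
proof -
  show 1: "D1 F y V = 0" using V by (simp add: D1_F[OF y] K_def linear_0[OF linears(4)[OF y]])
  have "D1 \<nu> y V \<in> conormal y" using vertical(3)[OF y] V by blast
  then show 2: "D1 \<phi> (\<upsilon> y) v \<bullet> D1 \<nu> y V = 0" for v by (simp add: conormal_def)
  show 3: "D2 F y V Y = D1 \<phi> (\<upsilon> y) (D2 \<upsilon> y V Y)"
    using V by (simp add: D2_F[OF y] K_def linear_0[OF linears(11)[OF y]])
  show "C y V Y V = 0" by (simp add: C_def 1 3 2)
qed

lemma horizontal_lift:
  assumes y: "y \<in> W"
  obtains X where "D1 \<upsilon> y X = v" "\<And>V. V \<in> K y \<Longrightarrow> L y X \<bullet> L y V = 0"
proof -
  obtain Z where Z: "D1 \<upsilon> y Z = v" using vertical(1)[OF y] by (metis surjD)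
  have LK: "span (L y ` K y) = L y ` K y"
    using linear_subspace_image[OF linears(5)[OF y] vertical(4)[OF y]] by (simp add: span_eq_iff)
  obtain s t where st: "s \<in> span (L y ` K y)" "\<And>w. w \<in> span (L y ` K y) \<Longrightarrow> orthogonal t w" "L y Z = s + t"
    by (rule orthogonal_subspace_decomp_exists[of "L y ` K y" "L y Z"]) blast
  then obtain V0 where V0: "V0 \<in> K y" "s = L y V0" unfolding LK by blast
  show thesis
  proof (rule that[of "Z - V0"])
    show "D1 \<upsilon> y (Z - V0) = v"
      using V0 Z by (simp add: linear_diff[OF linears(3)[OF y]] K_def)
    show "L y (Z - V0) \<bullet> L y V = 0" if "V \<in> K y" for V
    proof -
      have "L y (Z - V0) = t" using st(3) V0 by (simp add: linear_diff[OF linears(5)[OF y]])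
      then show ?thesis using st(2)[of "L y V"] that by (simp add: orthogonal_def span_base)
    qed
  qed
qed

text \<open>Horizontality means that the normal turns within the tangent plane, so
  \<open>D1 \<nu> y\<close> becomes a matrix, minus the shape operator. It is symmetric by
  \<open>isotropic\<close>, and \<open>minimal_quadratic\<close> in an orthonormal basis says that
  its trace is zero; hence the entries p, q, q, -p.\<close>

lemma adapted_basis:
  assumes y: "y \<in> W"
  obtains X1 X2 p q where "D1 F y X1 \<bullet> D1 F y X1 = 1" "D1 F y X2 \<bullet> D1 F y X2 = 1" "D1 F y X1 \<bullet> D1 F y X2 = 0"
    "D1 \<nu> y X1 = p *\<^sub>R D1 F y X1 + q *\<^sub>R D1 F y X2" "D1 \<nu> y X2 = q *\<^sub>R D1 F y X1 - p *\<^sub>R D1 F y X2"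
    "\<And>V. V \<in> K y \<Longrightarrow> L y X1 \<bullet> L y V = 0" "\<And>V. V \<in> K y \<Longrightarrow> L y X2 \<bullet> L y V = 0"
proof -
  let ?P = "D1 \<phi> (\<upsilon> y)"
  obtain E1 E2 where E: "?P E1 \<bullet> ?P E1 = 1" "?P E2 \<bullet> ?P E2 = 1" "?P E1 \<bullet> ?P E2 = 0"
    "\<And>v. \<exists>a b. v = a *\<^sub>R E1 + b *\<^sub>R E2"
    using tangent_frame[OF y] by blast
  obtain X1 where X1: "D1 \<upsilon> y X1 = E1" "\<And>V. V \<in> K y \<Longrightarrow> L y X1 \<bullet> L y V = 0"
    by (rule horizontal_lift[OF y, of E1]) blast
  obtain X2 where X2: "D1 \<upsilon> y X2 = E2" "\<And>V. V \<in> K y \<Longrightarrow> L y X2 \<bullet> L y V = 0"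
    by (rule horizontal_lift[OF y, of E2]) blast
  have FX: "D1 F y X1 = ?P E1" "D1 F y X2 = ?P E2" by (simp_all add: D1_F[OF y] X1 X2)
  have expand: "D1 \<nu> y X = (D1 \<nu> y X \<bullet> ?P E1) *\<^sub>R ?P E1 + (D1 \<nu> y X \<bullet> ?P E2) *\<^sub>R ?P E2"
    if X: "\<And>V. V \<in> K y \<Longrightarrow> L y X \<bullet> L y V = 0" for X
  proof -
    define \<eta> where "\<eta> = D1 \<nu> y X - ((D1 \<nu> y X \<bullet> ?P E1) *\<^sub>R ?P E1 + (D1 \<nu> y X \<bullet> ?P E2) *\<^sub>R ?P E2)"
    have e: "?P E1 \<bullet> \<eta> = 0" "?P E2 \<bullet> \<eta> = 0"
      using E(1-3) E(3)[unfolded inner_commute[of "?P E1"]]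
      by (simp_all add: \<eta>_def inner_diff_right inner_add_right inner_commute[of _ "D1 \<nu> y X"])
    have "?P v \<bullet> \<eta> = 0" for v
    proof -
      obtain a b where "v = a *\<^sub>R E1 + b *\<^sub>R E2" using E(4) by blast
      then show ?thesis using e
        by (simp add: linear_add[OF linears(4)[OF y]] linear_scale[OF linears(4)[OF y]] inner_add_left)
    qed
    moreover have "\<eta> \<bullet> F y = 0" "\<eta> \<bullet> \<nu> y = 0"
      using orthogonality[OF y] by (simp_all add: \<eta>_def inner_diff_left inner_add_left)
    ultimately have "\<eta> \<in> conormal y" by (simp add: conormal_def inner_commute)
    \<comment> \<open>The component \<open>\<eta>\<close> of \<open>D1 \<nu> y X\<close> off the
      tangent plane is itself the image of a vertical vector, and X is L-orthogonal to that vector.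
      So \<open>\<eta>\<close> is orthogonal to \<open>D1 \<nu> y X\<close>, hence to
      itself.\<close>
    then obtain V where V: "V \<in> K y" "\<eta> = D1 \<nu> y V" using vertical(3)[OF y] by blast
    have "\<eta> \<bullet> w = D1 \<nu> y X \<bullet> w - ((D1 \<nu> y X \<bullet> ?P E1) * (?P E1 \<bullet> w) + (D1 \<nu> y X \<bullet> ?P E2) * (?P E2 \<bullet> w))" for w
      by (simp add: \<eta>_def inner_diff_left inner_add_left)
    from this[of \<eta>] have "\<eta> \<bullet> \<eta> = D1 \<nu> y X \<bullet> \<eta>" using e by simp
    also have "\<dots> = 0" using X[OF V(1)] vertical_normal(1)[OF y V(1)] by (simp add: L_def V)
    finally show ?thesis by (simp add: \<eta>_def)
  qed
  define p q where "p = D1 \<nu> y X1 \<bullet> ?P E1" "q = D1 \<nu> y X1 \<bullet> ?P E2"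
  have q': "D1 \<nu> y X2 \<bullet> ?P E1 = q" using isotropic[OF y, of X1 X2] by (simp add: FX p_q_def)
  have p': "D1 \<nu> y X2 \<bullet> ?P E2 = - p"
    using minimal_quadratic[OF y, of X2 X1] by (simp add: FX E p_q_def)
  show thesis
  proof (rule that[of X1 X2 p q])
    show "D1 \<nu> y X1 = p *\<^sub>R D1 F y X1 + q *\<^sub>R D1 F y X2" using expand[OF X1(2)] by (simp add: FX p_q_def)
    show "D1 \<nu> y X2 = q *\<^sub>R D1 F y X1 - p *\<^sub>R D1 F y X2" using expand[OF X2(2)] by (simp add: FX p' q')
  qed (use E X1 X2 FX in auto)
qed

lemma linear_C: "y \<in> W \<Longrightarrow> linear (\<lambda>X. C y X Y Z)" "y \<in> W \<Longrightarrow> linear (C y X Y)"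
  unfolding C_def
  by (rule linearI; simp add: linear_add[OF linears(8)] linear_add[OF linears(9)] linear_scale[OF linears(8)] linear_scale[OF linears(9)]
      linear_add[OF linears(1)] linear_add[OF linears(2)] linear_scale[OF linears(1)] linear_scale[OF linears(2)]
      inner_add_left inner_add_right algebra_simps)+

lemma vertical_frame:
  assumes y: "y \<in> W"
  obtains B where "B \<subseteq> K y" "card B + 2 = DIM('e)" "finite B"
    "\<And>X Y. X \<in> B \<Longrightarrow> Y \<in> B \<Longrightarrow> L y X \<bullet> L y Y = (if X = Y then 1 else 0)"
proof -
  have inj: "inj (L y)" using linear_injective_0[OF linears(5)[OF y]] inj_L[OF y] by blast
  obtain B where B: "B \<subseteq> L y ` K y" "pairwise orthogonal B" "\<And>x. x \<in> B \<Longrightarrow> norm x = 1" "card B = dim (L y ` K y)" "independent B"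
    by (rule orthonormal_basis_subspace[OF linear_subspace_image[OF linears(5)[OF y] vertical(4)[OF y]]]) blast
  have dimL: "dim (L y ` K y) = dim (K y)"
    by (rule dim_image_eq[OF linears(5)[OF y]]) (use inj in \<open>auto simp: inj_on_def\<close>)
  have B': "L y ` (L y -` B) = B" using B(1) by auto
  have io: "inj_on (L y) (L y -` B)" using inj by (auto simp: inj_on_def)
  show thesis
  proof (rule that[of "L y -` B"])
    show "L y -` B \<subseteq> K y" using B(1) inj by (auto dest!: subsetD simp: inj_eq)
    show "card (L y -` B) + 2 = DIM('e)"
      using card_image[OF io] B' B(4) dimL vertical(2)[OF y] by simp
    show "finite (L y -` B)" using B' io B(5) by (metis finite_imageD independent_imp_finite)
    show "L y X \<bullet> L y Y = (if X = Y then 1 else 0)" if "X \<in> L y -` B" "Y \<in> L y -` B" for X Y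
      using that B(2,3) inj by (auto simp: pairwise_def orthogonal_def norm_eq_1 inj_eq)
  qed
qed

text \<open>By \<open>orthonormal_for_trace\<close> the given frame may be replaced by an adapted
  one: the rescaled horizontal vectors X1, X2 and an orthonormal basis of the vertical
  space.\<close>

theorem trace_C:
  assumes y: "y \<in> W" and E: "orthonormal_for (L y) E"
  shows "(\<Sum>X\<in>E. C y X X Y) = 0"
proof -
  obtain X1 X2 p q where on: "D1 F y X1 \<bullet> D1 F y X1 = 1" "D1 F y X2 \<bullet> D1 F y X2 = 1" "D1 F y X1 \<bullet> D1 F y X2 = 0"
    and \<nu>12: "D1 \<nu> y X1 = p *\<^sub>R D1 F y X1 + q *\<^sub>R D1 F y X2" "D1 \<nu> y X2 = q *\<^sub>R D1 F y X1 - p *\<^sub>R D1 F y X2"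
    and hor: "\<And>V. V \<in> K y \<Longrightarrow> L y X1 \<bullet> L y V = 0" "\<And>V. V \<in> K y \<Longrightarrow> L y X2 \<bullet> L y V = 0"
    by (rule adapted_basis[OF y]) blast
  obtain B where B: "B \<subseteq> K y" "card B + 2 = DIM('e)" "finite B"
    and onB: "\<And>X Y. X \<in> B \<Longrightarrow> Y \<in> B \<Longrightarrow> L y X \<bullet> L y Y = (if X = Y then 1 else 0)"
    by (rule vertical_frame[OF y]) blast
  \<comment> \<open>X1 and X2 are L-orthogonal with the same squared length
    \<open>1 + p * p + q * q\<close>, because the square of the shape operator is scalar. One factor
    c normalises both, and \<open>c * c\<close> comes out of the sum of the two terms of C.\<close>
  define c where "c = inverse (sqrt (1 + p * p + q * q))"
  have pos: "1 + p * p + q * q > 0" by (simp add: add_pos_nonneg)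
  have c: "c * c * (1 + p * p + q * q) = 1" "c \<noteq> 0"
    using pos by (simp_all add: c_def flip: inverse_mult_distrib)
  define Y1 Y2 where "Y1 = c *\<^sub>R X1" "Y2 = c *\<^sub>R X2"
  have LX: "L y X1 \<bullet> L y X1 = 1 + p * p + q * q" "L y X2 \<bullet> L y X2 = 1 + p * p + q * q" "L y X1 \<bullet> L y X2 = 0"
    using on on(3)[unfolded inner_commute[of "D1 F y X1"]]
    by (simp_all add: L_def \<nu>12 inner_add_left inner_add_right inner_diff_left inner_diff_right)
  have LY: "L y Y1 = c *\<^sub>R L y X1" "L y Y2 = c *\<^sub>R L y X2"
    by (simp_all add: Y1_Y2_def linear_scale[OF linears(5)[OF y]])
  have onY: "L y Y1 \<bullet> L y Y1 = 1" "L y Y2 \<bullet> L y Y2 = 1" "L y Y1 \<bullet> L y Y2 = 0" "L y Y2 \<bullet> L y Y1 = 0"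
    using c LX LX(3)[unfolded inner_commute[of "L y X1"]] by (simp_all add: LY mult.assoc)
  have YB: "L y Y1 \<bullet> L y V = 0" "L y Y2 \<bullet> L y V = 0" "L y V \<bullet> L y Y1 = 0" "L y V \<bullet> L y Y2 = 0" if "V \<in> B" for V
    using hor[of V] hor[of V, unfolded inner_commute[of _ "L y V"]] that B(1) by (auto simp: LY)
  have notB: "Y1 \<notin> B" "Y2 \<notin> B" "Y1 \<noteq> Y2" using YB onY by force+
  have E': "orthonormal_for (L y) (insert Y1 (insert Y2 B))"
    unfolding orthonormal_for_def using B(2,3) notB onY YB onB by auto
  have CY: "C y Y1 Y Y1 + C y Y2 Y Y2 = 0"
  proof -
    have "C y (c *\<^sub>R X) Y (c *\<^sub>R X) = c * c * C y X Y X" for X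
      using linear_scale[OF linear_C(1)[OF y, of Y "c *\<^sub>R X"], of c X] linear_scale[OF linear_C(2)[OF y, of X Y], of c X] by simp
    then show ?thesis
      using minimal_derivative[OF y on \<nu>12, of Y] by (simp add: Y1_Y2_def flip: distrib_left)
  qed
  \<comment> \<open>Total symmetry moves Y to the middle slot, where
    \<open>minimal_derivative\<close> and \<open>vertical_normal\<close> apply.\<close>
  have "(\<Sum>X\<in>E. C y X X Y) = (\<Sum>X\<in>E. C y X Y X)"
    by (simp add: C_sym'[OF y, of _ _ Y] C_sym[OF y, of Y])
  also have "\<dots> = (\<Sum>X\<in>insert Y1 (insert Y2 B). C y X Y X)"
    by (rule orthonormal_for_trace[OF linears(5)[OF y] E E' linear_C(2)[OF y] linear_C(1)[OF y]])
  also have "\<dots> = (\<Sum>X\<in>B. C y X Y X)" using notB B(3) CY by simp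
  also have "\<dots> = 0" by (rule sum.neutral) (use vertical_normal(4)[OF y] B(1) in blast)
  finally show ?thesis .
qed

text \<open>J below is L followed by the complex structure \<open>(a, b) \<mapsto> (- b, a)\<close>.
  By \<open>isotropic\<close> its range is orthogonal to that of L. Both lie in
  \<open>P \<times> P\<close>, of dimension \<open>2 * DIM('e)\<close>, and both have dimension
  \<open>DIM('e)\<close>, so the range of J is the whole normal space.\<close>

lemma lagrangian_normal:
  assumes y: "y \<in> W" and ab: "a \<bullet> F y = 0" "a \<bullet> \<nu> y = 0" "b \<bullet> F y = 0" "b \<bullet> \<nu> y = 0"
    and orth: "\<And>X. (a, b) \<bullet> L y X = 0"
  obtains Y where "a = - D1 \<nu> y Y" "b = D1 F y Y"
proof -
  let ?T = "span {F y, \<nu> y}"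
  define P where "P = {\<eta> \<in> UNIV. \<forall>x\<in>?T. orthogonal x \<eta>}"
  have P: "\<eta> \<in> P \<longleftrightarrow> \<eta> \<bullet> F y = 0 \<and> \<eta> \<bullet> \<nu> y = 0" for \<eta>
    unfolding P_def orthogonal_span_iff by (auto simp: orthogonal_def inner_commute)
  have subP: "subspace P" unfolding P_def using subspace_orthogonal_to_vectors[of ?T] by simp
  have "\<nu> y \<noteq> 0" using \<nu>_unit[OF y] by auto
  moreover have "F y \<notin> span {\<nu> y}"
    using orthogonality(1,2)[OF y] \<nu>_unit[OF y] by (auto simp: span_singleton)
  ultimately have "dim {F y, \<nu> y} = 2" by (simp add: dim_insert)
  then have dimP: "dim P = DIM('e)"
    using dim_subspace_orthogonal_to_vectors[OF subspace_span subspace_UNIV, of "{F y, \<nu> y}"]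
    unfolding P_def by (simp add: dim_UNIV dim_z)
  define N where "N = {z \<in> P \<times> P. \<forall>x\<in>range (L y). orthogonal x z}"
  have inj: "inj (L y)" using linear_injective_0[OF linears(5)[OF y]] inj_L[OF y] by blast
  have subL: "subspace (range (L y))" by (rule linear_subspace_image[OF linears(5)[OF y] subspace_UNIV])
  have "dim N + dim (range (L y)) = dim (P \<times> P)"
    unfolding N_def
  proof (rule dim_subspace_orthogonal_to_vectors[OF subL subspace_Times[OF subP subP]])
    show "range (L y) \<subseteq> P \<times> P" using orthogonality[OF y] by (auto simp: L_def P)
  qed
  then have dimN: "dim N = DIM('e)"
    using dim_image_eq[OF linears(5)[OF y], of UNIV] inj dimP by (simp add: dim_Times[OF subP subP] dim_UNIV)
  define J where "J Y = (- D1 \<nu> y Y, D1 F y Y)" for Y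
  have linJ: "linear J"
    unfolding J_def[abs_def] by (rule linearI) (simp_all add: linear_add[OF linears(1)[OF y]] linear_add[OF linears(2)[OF y]]
      linear_scale[OF linears(1)[OF y]] linear_scale[OF linears(2)[OF y]])
  have "inj J"
    using linear_injective_0[OF linJ] inj_L[OF y] by (auto simp: J_def L_def zero_prod_def)
  have "range J = N"
  proof (rule subspace_dim_equal)
    show "subspace (range J)" by (rule linear_subspace_image[OF linJ subspace_UNIV])
    have "N = (P \<times> P) \<inter> {z. \<forall>x\<in>range (L y). orthogonal x z}" by (auto simp: N_def)
    then show "subspace N"
      using subspace_inter[OF subspace_Times[OF subP subP] subspace_orthogonal_to_vectors[of "range (L y)"]] by metis
    show "range J \<subseteq> N"
      using orthogonality[OF y] isotropic[OF y] by (auto simp: N_def J_def L_def P orthogonal_def inner_commute)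
    show "dim N \<le> dim (range J)"
      using dim_image_eq[OF linJ, of UNIV] \<open>inj J\<close> dimN by (simp add: dim_UNIV)
  qed
  moreover have "(a, b) \<in> N" using ab orth by (auto simp: N_def P orthogonal_def inner_commute)
  ultimately have "(a, b) \<in> range J" by simp
  then show thesis using that by (auto simp: J_def)
qed

end

section \<open>The Pluecker embedding of the space of oriented geodesics\<close>

text \<open>The factor makes \<open>wedge x v\<close> a unit vector for orthonormal \<open>x\<close>, \<open>v\<close>.\<close>

definition wedge :: "real^'m \<Rightarrow> real^'m \<Rightarrow> real^'m^'m" where
  "wedge a b = (1 / sqrt 2) *\<^sub>R (\<chi> i j. a $ i * b $ j - b $ i * a $ j)"

text \<open>A Gram determinant. The factor 1/2 from the two normalisations compensates for every
  product occurring twice in the double sum.\<close>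

lemma wedge_inner: "wedge a b \<bullet> wedge c d = (a \<bullet> c) * (b \<bullet> d) - (a \<bullet> d) * (b \<bullet> c)"
proof -
  have pr: "(\<Sum>i\<in>UNIV. \<Sum>j\<in>UNIV. (p $ i * q $ j) * (r $ i * s $ j)) = (p \<bullet> r) * (q \<bullet> s)" for p q r s :: "real^'m"
    by (simp add: inner_vec_def sum_product mult.assoc mult.left_commute)
  have mat: "(\<chi> i j. f i j) \<bullet> (\<chi> i j. g i j) = (\<Sum>i\<in>UNIV. \<Sum>j\<in>UNIV. f i j * g i j)" for f g :: "'m::finite \<Rightarrow> 'm \<Rightarrow> real"
    by (simp add: inner_vec_def)
  have "wedge a b \<bullet> wedge c d = 1/2 * (\<Sum>i\<in>UNIV. \<Sum>j\<in>UNIV. (a $ i * b $ j - b $ i * a $ j) * (c $ i * d $ j - d $ i * c $ j))"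
    by (simp add: wedge_def mat)
  also have "(\<Sum>i\<in>UNIV. \<Sum>j\<in>UNIV. (a $ i * b $ j - b $ i * a $ j) * (c $ i * d $ j - d $ i * c $ j))
     = (\<Sum>i\<in>UNIV. \<Sum>j\<in>UNIV. (a $ i * b $ j) * (c $ i * d $ j) - (a $ i * b $ j) * (d $ i * c $ j)
        - (b $ i * a $ j) * (c $ i * d $ j) + (b $ i * a $ j) * (d $ i * c $ j))"
    by (intro sum.cong refl) (simp add: algebra_simps)
  also have "\<dots> = (a \<bullet> c) * (b \<bullet> d) - (a \<bullet> d) * (b \<bullet> c) - (b \<bullet> c) * (a \<bullet> d) + (b \<bullet> d) * (a \<bullet> c)"
    by (simp only: sum.distrib sum_subtractf pr)
  finally show ?thesis by simp
qed

lemma bounded_bilinear_wedge: "bounded_bilinear (wedge :: real^'m \<Rightarrow> _)"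
  unfolding bilinear_conv_bounded_bilinear[symmetric] bilinear_def
  by (auto intro!: linearI simp: wedge_def vec_eq_iff algebra_simps)

interpretation wedge: bounded_bilinear wedge by (rule bounded_bilinear_wedge)

lemma wedge_mult_vector: "wedge a b *v c = (1 / sqrt 2) *\<^sub>R ((b \<bullet> c) *\<^sub>R a - (a \<bullet> c) *\<^sub>R b)"
proof -
  have "(\<Sum>j\<in>UNIV. (a $ i * b $ j - b $ i * a $ j) * c $ j) = (b \<bullet> c) * a $ i - (a \<bullet> c) * b $ i" for i
    by (simp add: inner_vec_def sum_subtractf sum_distrib_left sum_distrib_right algebra_simps)
  then show ?thesis
    by (simp add: vec_eq_iff wedge_def matrix_vector_mult_def mult.assoc flip: sum_divide_distrib)
qed

lemma wedge_swap: "wedge b a = - wedge a b"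
  by (simp add: wedge_def vec_eq_iff minus_divide_left)

lemma wedge_self: "wedge a a = 0"
  by (simp add: wedge_def vec_eq_iff)

section \<open>Orbits of the geodesic flow and vectors pushed forward to the quotient\<close>

lemma geodesic_flow_0: "geodesic_flow 0 p = p"
  by (cases p) (simp add: geodesic_flow_def)

lemma geodesic_flow_add: "geodesic_flow s (geodesic_flow t p) = geodesic_flow (s + t) p"
  by (cases p) (simp add: geodesic_flow_def cos_add sin_add algebra_simps)

lemma proj_geodesics_flow: "proj_geodesics (geodesic_flow t p) = proj_geodesics p"
proof -
  have "geodesic_flow s p \<in> range (\<lambda>s. geodesic_flow (s + t) p)" for s
    by (rule range_eqI[of _ _ "s - t"]) simp
  then show ?thesis unfolding proj_geodesics_def geodesic_flow_add by blast
qed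

lemma proj_geodesics_eqD:
  assumes "proj_geodesics p = proj_geodesics p'"
  obtains t where "p' = geodesic_flow t p"
proof -
  have "p' \<in> proj_geodesics p'"
    unfolding proj_geodesics_def using geodesic_flow_0 by (metis rangeI)
  then show thesis using assms that by (auto simp: proj_geodesics_def)
qed

text \<open>The flow rotates the basis \<open>(x, v)\<close> within its plane, and a rotation has
  determinant 1. Thus the wedge depends on the orbit only.\<close>

lemma wedge_flow: "wedge (fst (geodesic_flow t p)) (snd (geodesic_flow t p)) = wedge (fst p) (snd p)"
proof (cases p)
  case (Pair x v)
  have "wedge (c *\<^sub>R x + s *\<^sub>R v) (c *\<^sub>R v - s *\<^sub>R x) = (c * c + s * s) *\<^sub>R wedge x v" for c s
    by (simp add: wedge.add_left wedge.diff_right wedge.scaleR_left wedge.scaleR_right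
        wedge_self wedge_swap[of v x] algebra_simps)
  from this[of "cos t" "sin t"] show ?thesis
    using sin_cos_squared_add[of t] by (simp add: Pair geodesic_flow_def power2_eq_square)
qed

lemma geodesic_flow_unit_tangent: "p \<in> unit_tangent_sphere \<Longrightarrow> geodesic_flow t p \<in> unit_tangent_sphere"
proof (cases p)
  case (Pair x v)
  assume "p \<in> unit_tangent_sphere"
  then have o: "x \<bullet> x = 1" "v \<bullet> v = 1" "x \<bullet> v = 0" "v \<bullet> x = 0"
    by (auto simp: Pair unit_tangent_sphere_def norm_eq_1 inner_commute)
  have "cos t * cos t + sin t * sin t = 1" "sin t * sin t + cos t * cos t = 1"
    using sin_cos_squared_add[of t] by (simp_all add: power2_eq_square)
  then show ?thesis
    by (simp add: Pair unit_tangent_sphere_def geodesic_flow_def norm_eq_1 inner_add_left inner_add_right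
       inner_diff_left inner_diff_right o)
qed

definition pluecker :: "((real^'m) \<times> (real^'m)) set \<Rightarrow> real^'m^'m" where
  "pluecker q = (let p = SOME p. proj_geodesics p = q in wedge (fst p) (snd p))"

lemma pluecker_proj: "pluecker (proj_geodesics p) = wedge (fst p) (snd p)"
proof -
  have "proj_geodesics (SOME p'. proj_geodesics p' = proj_geodesics p) = proj_geodesics p"
    by (rule someI[of "\<lambda>p'. proj_geodesics p' = proj_geodesics p"]) simp
  from proj_geodesics_eqD[OF this[symmetric]] wedge_flow show ?thesis
    unfolding pluecker_def Let_def by metis
qed

abbreviation tangent_to_UT :: "(real^'m) \<times> (real^'m) \<Rightarrow> (real^'m) \<times> (real^'m) \<Rightarrow> bool" where
  "tangent_to_UT p Z \<equiv> fst Z \<bullet> fst p = 0 \<and> snd Z \<bullet> snd p = 0 \<and> fst Z \<bullet> snd p + snd Z \<bullet> fst p = 0"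

lemma unit_tangentD:
  "p \<in> unit_tangent_sphere \<Longrightarrow> fst p \<bullet> fst p = 1 \<and> snd p \<bullet> snd p = 1 \<and> fst p \<bullet> snd p = 0 \<and> snd p \<bullet> fst p = 0"
  by (auto simp: unit_tangent_sphere_def norm_eq_1 inner_commute)

lemma curve_tangent_to_UT:
  assumes "range \<alpha> \<subseteq> unit_tangent_sphere" "(\<alpha> has_vector_derivative Z) (at 0)"
  shows "tangent_to_UT (\<alpha> 0) Z"
proof -
  have d: "((\<lambda>t. fst (\<alpha> t)) has_derivative (\<lambda>t. t *\<^sub>R fst Z)) (at 0)" "((\<lambda>t. snd (\<alpha> t)) has_derivative (\<lambda>t. t *\<^sub>R snd Z)) (at 0)"
    using has_derivative_fst[OF assms(2)[unfolded has_vector_derivative_def]]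
      has_derivative_snd[OF assms(2)[unfolded has_vector_derivative_def]] by simp_all
  have ut: "\<alpha> t \<in> unit_tangent_sphere" for t using assms(1) by auto
  have 1: "((\<lambda>t. fst (\<alpha> t) \<bullet> fst (\<alpha> t)) has_derivative (\<lambda>t. 0)) (at 0)" "((\<lambda>t. snd (\<alpha> t) \<bullet> snd (\<alpha> t)) has_derivative (\<lambda>t. 0)) (at 0)"
    "((\<lambda>t. fst (\<alpha> t) \<bullet> snd (\<alpha> t)) has_derivative (\<lambda>t. 0)) (at 0)"
    using unit_tangentD[OF ut] by simp_all
  show ?thesis
    using fun_cong[OF has_derivative_unique[OF has_derivative_inner[OF d(1) d(1)] 1(1)], of 1]
      fun_cong[OF has_derivative_unique[OF has_derivative_inner[OF d(2) d(2)] 1(2)], of 1]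
      fun_cong[OF has_derivative_unique[OF has_derivative_inner[OF d(1) d(2)] 1(3)], of 1]
    by (simp add: inner_commute)
qed

lemma pushes_forward_tangent:
  "pushes_forward unit_tangent_sphere \<pi> c p Z X \<Longrightarrow> tangent_to_UT p Z"
  unfolding pushes_forward_def using curve_tangent_to_UT by blast

lemma pushes_forwardI:
  fixes h :: "'e::euclidean_space \<Rightarrow> 'v::euclidean_space" and \<pi> :: "'v \<Rightarrow> 'q" and c :: "('q, 'h::euclidean_space) chart"
  assumes W: "open W" "y \<in> W" and h: "h ` W \<subseteq> S" "smooth_on W h"
    and k: "smooth_on W (\<lambda>w. snd c (\<pi> (h w)))"
  shows "pushes_forward S \<pi> c (h y) (D1 h y X) (D1 (\<lambda>w. snd c (\<pi> (h w))) y X)"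
proof -
  define T where "T = {t::real. y + t *\<^sub>R X \<in> W}"
  have "continuous_on UNIV (\<lambda>t. y + t *\<^sub>R X)" by (intro continuous_intros)
  from open_vimage[OF W(1) this] have T: "open T" "0 \<in> T"
    using W(2) by (simp_all add: T_def vimage_def)
  \<comment> \<open>\<open>pushes_forward\<close> wants a curve that stays in S for all times, while
    h is controlled on W only; off T the curve is frozen at its initial point.\<close>
  define \<alpha> where "\<alpha> t = (if t \<in> T then h (y + t *\<^sub>R X) else h y)" for t
  have line: "((\<lambda>t. y + t *\<^sub>R X) has_derivative (\<lambda>t. t *\<^sub>R X)) (at 0)" by (auto intro!: derivative_eq_intros)
  have comp: "((\<lambda>t. g (y + t *\<^sub>R X)) has_vector_derivative D1 g y X) (at 0)" if "smooth_on W g" for g :: "'e \<Rightarrow> 'b::euclidean_space"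
    using has_derivative_compose[OF line, of g "D1 g y"] smooth_on_has_derivative[OF that W] linear_scale[OF D1_linear[OF that W]]
    by (simp add: has_vector_derivative_def)
  show ?thesis unfolding pushes_forward_def
  proof (intro exI conjI)
    show "range \<alpha> \<subseteq> S" using h(1) W(2) by (auto simp: \<alpha>_def T_def)
    show "\<alpha> 0 = h y" by (simp add: \<alpha>_def)
    show "(\<alpha> has_vector_derivative D1 h y X) (at 0)"
      by (rule has_vector_derivative_transform_within_open[OF comp[OF h(2)] T]) (simp add: \<alpha>_def)
    show "(snd c \<circ> \<pi> \<circ> \<alpha> has_vector_derivative D1 (\<lambda>w. snd c (\<pi> (h w))) y X) (at 0)"
      by (rule has_vector_derivative_transform_within_open[OF comp[OF k] T]) (simp add: \<alpha>_def)
  qed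
qed

abbreviation pushes_geodesics where
  "pushes_geodesics \<equiv> pushes_forward unit_tangent_sphere proj_geodesics"

text \<open>\<open>(snd p, - fst p)\<close> generates the geodesic flow and spans the kernel of the
  projection. The representing curve is dragged along the flow with speed \<open>\<tau>\<close>,
  which does not change its orbits.\<close>

lemma pushes_forward_flow:
  assumes "pushes_geodesics c p Z X"
  shows "pushes_geodesics c p (fst Z + \<tau> *\<^sub>R snd p, snd Z - \<tau> *\<^sub>R fst p) X"
proof -
  obtain \<alpha> where \<alpha>: "range \<alpha> \<subseteq> unit_tangent_sphere" "\<alpha> 0 = p" "(\<alpha> has_vector_derivative Z) (at 0)"
    "((snd c \<circ> proj_geodesics \<circ> \<alpha>) has_vector_derivative X) (at 0)"
    using assms unfolding pushes_forward_def by blast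
  have d: "((\<lambda>t. fst (\<alpha> t)) has_derivative (\<lambda>t. t *\<^sub>R fst Z)) (at 0)" "((\<lambda>t. snd (\<alpha> t)) has_derivative (\<lambda>t. t *\<^sub>R snd Z)) (at 0)"
    using has_derivative_fst[OF \<alpha>(3)[unfolded has_vector_derivative_def]]
      has_derivative_snd[OF \<alpha>(3)[unfolded has_vector_derivative_def]] by simp_all
  define \<beta> where "\<beta> t = geodesic_flow (\<tau> * t) (\<alpha> t)" for t
  have \<beta>: "\<beta> = (\<lambda>t. (cos (\<tau> * t) *\<^sub>R fst (\<alpha> t) + sin (\<tau> * t) *\<^sub>R snd (\<alpha> t), cos (\<tau> * t) *\<^sub>R snd (\<alpha> t) - sin (\<tau> * t) *\<^sub>R fst (\<alpha> t)))"
    by (auto simp: \<beta>_def geodesic_flow_def case_prod_beta)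
  have "(\<beta> has_derivative (\<lambda>t. t *\<^sub>R (fst Z + \<tau> *\<^sub>R snd p, snd Z - \<tau> *\<^sub>R fst p))) (at 0)"
    unfolding \<beta> by (rule derivative_eq_intros d refl)+ (simp add: fun_eq_iff \<alpha>(2) algebra_simps)
  moreover have "snd c \<circ> proj_geodesics \<circ> \<beta> = snd c \<circ> proj_geodesics \<circ> \<alpha>"
    by (auto simp: \<beta>_def proj_geodesics_flow)
  moreover have "range \<beta> \<subseteq> unit_tangent_sphere"
  proof (intro image_subsetI)
    fix t :: real
    have "\<alpha> t \<in> unit_tangent_sphere" using \<alpha>(1) by blast
    then show "\<beta> t \<in> unit_tangent_sphere" unfolding \<beta>_def by (rule geodesic_flow_unit_tangent)
  qed
  moreover have "\<beta> 0 = p" by (simp add: \<beta>_def \<alpha>(2) geodesic_flow_0)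
  ultimately show ?thesis
    unfolding pushes_forward_def using \<alpha>(4) by (intro exI[of _ \<beta>]) (simp add: has_vector_derivative_def[of \<beta>])
qed

section \<open>Skew matrices and the complement of the isotropy algebra\<close>

lemma so_algebra_skew:
  assumes "\<xi> \<in> so_algebra"
  shows "a \<bullet> (\<xi> *v b) = - (b \<bullet> (\<xi> *v a))" "a \<bullet> (\<xi> *v a) = 0"
proof -
  have *: "a \<bullet> (\<xi> *v b) = - (b \<bullet> (\<xi> *v a))" for a b
  proof -
    have "transpose \<xi> = - \<xi>" using assms by (simp add: so_algebra_def)
    have "a \<bullet> (\<xi> *v b) = (transpose \<xi> *v a) \<bullet> b" by (metis dot_lmul_matrix inner_commute transpose_matrix_vector)
    also have "\<dots> = - (b \<bullet> (\<xi> *v a))"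
      unfolding \<open>transpose \<xi> = - \<xi>\<close> by (simp add: matrix_vector_mult_def inner_vec_def sum_negf mult.commute)
    finally show ?thesis .
  qed
  show "a \<bullet> (\<xi> *v b) = - (b \<bullet> (\<xi> *v a))" "a \<bullet> (\<xi> *v a) = 0"
    using *[of a b] *[of a a] by simp_all
qed

text \<open>The factor undoes the normalisation of \<open>wedge\<close>: for orthonormal a, b this
  generates the rotation of their plane that moves b towards a.\<close>

definition rotation_generator :: "real^'m \<Rightarrow> real^'m \<Rightarrow> real^'m^'m" where
  "rotation_generator a b = sqrt 2 *\<^sub>R wedge a b"

lemma rotation_generator_mult: "rotation_generator a b *v c = (b \<bullet> c) *\<^sub>R a - (a \<bullet> c) *\<^sub>R b"
  by (simp add: rotation_generator_def scaleR_matrix_vector_assoc[symmetric] wedge_mult_vector)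

lemma rotation_generator_so: "rotation_generator a b \<in> so_algebra"
  by (simp add: so_algebra_def rotation_generator_def wedge_def transpose_def vec_eq_iff)

lemma so_algebra_add:
  assumes "\<xi> \<in> so_algebra" "\<eta> \<in> so_algebra"
  shows "\<xi> + \<eta> \<in> so_algebra"
proof -
  have "transpose (\<xi> + \<eta>) = transpose \<xi> + transpose \<eta>" by (simp add: transpose_def vec_eq_iff)
  then show ?thesis using assms by (simp add: so_algebra_def)
qed

lemma so_inner_add_left: "so_inner (\<xi> + \<eta>) \<zeta> = so_inner \<xi> \<zeta> + so_inner \<eta> \<zeta>"
  by (simp add: so_inner_def trace_def matrix_matrix_mult_def sum.distrib algebra_simps)

lemma so_inner_commute: "so_inner \<xi> \<eta> = so_inner \<eta> \<xi>"
  unfolding so_inner_def by (subst trace_mul_sym) (rule refl)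

text \<open>Pairing with rotation generators reads off matrix entries of \<open>\<xi>\<close>. This
  both tests orthogonality to the isotropy algebra and evaluates the metric on its
  complement.\<close>

lemma so_inner_rotation_generator:
  assumes "\<xi> \<in> so_algebra"
  shows "so_inner (rotation_generator a b) \<xi> = a \<bullet> (\<xi> *v b)"
proof -
  have "trace (rotation_generator a b ** \<xi>) = (\<Sum>i\<in>UNIV. \<Sum>j\<in>UNIV. (a $ i * b $ j - b $ i * a $ j) * \<xi> $ j $ i)"
    by (simp add: trace_def matrix_matrix_mult_def rotation_generator_def wedge_def)
  also have "\<dots> = (\<Sum>i\<in>UNIV. \<Sum>j\<in>UNIV. b $ j * (\<xi> $ j $ i * a $ i)) - (\<Sum>i\<in>UNIV. \<Sum>j\<in>UNIV. a $ j * (\<xi> $ j $ i * b $ i))"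
    by (simp add: sum_subtractf algebra_simps)
  also have "(\<Sum>i\<in>UNIV. \<Sum>j\<in>UNIV. b $ j * (\<xi> $ j $ i * a $ i)) = b \<bullet> (\<xi> *v a)"
    by (subst sum.swap) (simp add: inner_vec_def matrix_vector_mult_def sum_distrib_left)
  also have "(\<Sum>i\<in>UNIV. \<Sum>j\<in>UNIV. a $ j * (\<xi> $ j $ i * b $ i)) = a \<bullet> (\<xi> *v b)"
    by (subst sum.swap) (simp add: inner_vec_def matrix_vector_mult_def sum_distrib_left)
  finally show ?thesis by (simp add: so_inner_def so_algebra_skew(1)[OF assms, of b a])
qed

text \<open>Orthogonality to the rotation of the plane of x and v kills the entry
  \<open>x \<bullet> (\<eta> *v v)\<close>, and orthogonality to the rotations among vectors
  perpendicular to that plane kills the block there. What is left of \<open>\<eta>\<close> is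
  determined by its values at x and v.\<close>

lemma isotropy_complement_mult:
  assumes p: "(x, v) \<in> unit_tangent_sphere" and \<eta>: "\<eta> \<in> isotropy_complement (x, v)"
  shows "(\<eta> *v x) \<bullet> x = 0" "(\<eta> *v x) \<bullet> v = 0" "(\<eta> *v v) \<bullet> x = 0" "(\<eta> *v v) \<bullet> v = 0"
    and "\<eta> = rotation_generator (\<eta> *v x) x + rotation_generator (\<eta> *v v) v"
proof -
  have o: "x \<bullet> x = 1" "v \<bullet> v = 1" "x \<bullet> v = 0" "v \<bullet> x = 0" using unit_tangentD[OF p] by auto
  have so: "\<eta> \<in> so_algebra" and orth: "\<And>\<xi>. \<xi> \<in> isotropy_algebra (x, v) \<Longrightarrow> so_inner \<eta> \<xi> = 0"
    using \<eta> by (auto simp: isotropy_complement_def)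
  have rot: "rotation_generator z w \<in> isotropy_algebra (x, v) \<Longrightarrow> z \<bullet> (\<eta> *v w) = 0" for z w
    using orth[of "rotation_generator z w"] so_inner_rotation_generator[OF so, of z w] so_inner_commute[of \<eta>] by simp
  have "rotation_generator x v \<in> isotropy_algebra (x, v)"
    by (simp add: isotropy_algebra_def rotation_generator_so rotation_generator_mult o span_base span_neg)
  from rot[OF this] have xv: "x \<bullet> (\<eta> *v v) = 0" by simp
  then have vx: "v \<bullet> (\<eta> *v x) = 0" using so_algebra_skew(1)[OF so, of v x] by simp
  show "(\<eta> *v x) \<bullet> x = 0" "(\<eta> *v x) \<bullet> v = 0" "(\<eta> *v v) \<bullet> x = 0" "(\<eta> *v v) \<bullet> v = 0"
    using xv vx so_algebra_skew(2)[OF so] by (simp_all add: inner_commute)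
  have "u' \<bullet> (\<eta> *v u) = u' \<bullet> ((rotation_generator (\<eta> *v x) x + rotation_generator (\<eta> *v v) v) *v u)" for u u'
  proof -
    \<comment> \<open>The components of u and u' perpendicular to the plane of x and v.\<close>
    define z z' where "z = u - (x \<bullet> u) *\<^sub>R x - (v \<bullet> u) *\<^sub>R v" "z' = u' - (x \<bullet> u') *\<^sub>R x - (v \<bullet> u') *\<^sub>R v"
    have "x \<bullet> z = 0" "v \<bullet> z = 0" "x \<bullet> z' = 0" "v \<bullet> z' = 0"
      by (simp_all add: z_z'_def inner_diff_right o)
    then have "rotation_generator z' z \<in> isotropy_algebra (x, v)"
      by (simp add: isotropy_algebra_def rotation_generator_so rotation_generator_mult inner_commute span_zero)
    from rot[OF this] have "z' \<bullet> (\<eta> *v z) = 0" .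
    then show ?thesis
      using xv vx so_algebra_skew(2)[OF so] so_algebra_skew(1)[OF so, of x u] so_algebra_skew(1)[OF so, of v u]
      by (simp add: z_z'_def inner_diff_right inner_diff_left matrix_vector_mult_diff_distrib matrix_vector_mult_scaleR
          matrix_vector_mult_add_rdistrib rotation_generator_mult inner_add_right inner_commute[of u' x] inner_commute[of u' v]
          inner_commute[of "\<eta> *v _" u] algebra_simps)
  qed
  then show "\<eta> = rotation_generator (\<eta> *v x) x + rotation_generator (\<eta> *v v) v"
    unfolding matrix_eq using vector_eq_ldot by blast
qed

lemma so_inner_isotropy_complement:
  assumes p: "(x, v) \<in> unit_tangent_sphere" and \<eta>: "\<eta> \<in> isotropy_complement (x, v)" and \<zeta>: "\<zeta> \<in> isotropy_complement (x, v)"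
  shows "so_inner \<eta> \<zeta> = (\<eta> *v x) \<bullet> (\<zeta> *v x) + (\<eta> *v v) \<bullet> (\<zeta> *v v)"
proof -
  have "\<zeta> \<in> so_algebra" using \<zeta> by (simp add: isotropy_complement_def)
  then show ?thesis
    by (subst isotropy_complement_mult(5)[OF p \<eta>])
      (simp add: so_inner_add_left so_inner_rotation_generator)
qed

lemma isotropy_complement_exists:
  assumes p: "(x, v) \<in> unit_tangent_sphere" and ab: "a \<bullet> x = 0" "a \<bullet> v = 0" "b \<bullet> x = 0" "b \<bullet> v = 0"
  obtains \<eta> where "\<eta> \<in> isotropy_complement (x, v)" "\<eta> *v x = a" "\<eta> *v v = b"
proof -
  have o: "x \<bullet> x = 1" "v \<bullet> v = 1" "x \<bullet> v = 0" "v \<bullet> x = 0" using unit_tangentD[OF p] by auto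
  let ?\<eta> = "rotation_generator a x + rotation_generator b v"
  have "?\<eta> \<in> isotropy_complement (x, v)"
    unfolding isotropy_complement_def
  proof (intro CollectI conjI ballI so_algebra_add rotation_generator_so)
    fix \<xi> assume "\<xi> \<in> isotropy_algebra (x, v)"
    then have \<xi>: "\<xi> \<in> so_algebra" "\<xi> *v x \<in> span {x, v}" "\<xi> *v v \<in> span {x, v}" by (auto simp: isotropy_algebra_def)
    have "orthogonal a w" "orthogonal b w" if "w \<in> span {x, v}" for w
      using that ab orthogonal_span_iff[of "{x, v}" a] orthogonal_span_iff[of "{x, v}" b]
      by (auto simp: orthogonal_def inner_commute)
    then show "so_inner ?\<eta> \<xi> = 0"
      using \<xi> by (simp add: so_inner_add_left so_inner_rotation_generator orthogonal_def)
  qed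
  then show thesis
    by (rule that) (simp_all add: matrix_vector_mult_add_rdistrib rotation_generator_mult o ab)
qed

section \<open>Metric and symplectic form of the space of geodesics through the Pluecker map\<close>

locale geodesic_chart =
  fixes c :: "(((real^'m) \<times> (real^'m)) set, 'h::euclidean_space) chart"
  assumes c: "c \<in> atlas geodesic_space"
begin

abbreviation "img \<equiv> snd c ` fst c"

definition \<Psi> :: "'h \<Rightarrow> real^'m^'m" where "\<Psi> w = pluecker (param c w)"

lemma chart:
  shows dom: "fst c \<subseteq> proj_geodesics ` unit_tangent_sphere" and inj_snd: "inj_on (snd c) (fst c)" and open_img: "open img"
    and open_dom: "openin (top_of_set unit_tangent_sphere) (unit_tangent_sphere \<inter> proj_geodesics -` fst c)"
    and smooth_proj: "smooth_on (unit_tangent_sphere \<inter> proj_geodesics -` fst c) (\<lambda>p. snd c (proj_geodesics p))"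
    and local_section: "\<And>y. y \<in> img \<Longrightarrow> \<exists>V s. open V \<and> y \<in> V \<and> V \<subseteq> img \<and> smooth_on V s \<and> s ` V \<subseteq> unit_tangent_sphere \<and>
      (\<forall>w\<in>V. proj_geodesics (s w) = param c w)"
  using c unfolding geodesic_space_def quotient_manifold_def by (auto simp: o_def)

lemma param_snd: "q \<in> fst c \<Longrightarrow> param c (snd c q) = q"
  by (rule inv_into_f_f[OF inj_snd])

lemma snd_param: "y \<in> img \<Longrightarrow> snd c (param c y) = y" "y \<in> img \<Longrightarrow> param c y \<in> fst c"
  by (rule f_inv_into_f inv_into_into; assumption)+

lemma representative:
  assumes "y \<in> img"
  obtains p where "p \<in> unit_tangent_sphere" "proj_geodesics p = param c y" "proj_geodesics p \<in> fst c"
proof -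
  have "param c y \<in> proj_geodesics ` unit_tangent_sphere" using dom snd_param(2)[OF assms] by blast
  then show thesis
  proof (rule imageE)
    fix p assume p: "param c y = proj_geodesics p" "p \<in> unit_tangent_sphere"
    show thesis using that[OF p(2) p(1)[symmetric]] p(1) snd_param(2)[OF assms] by simp
  qed
qed

text \<open>The section provided by the atlas meets the orbit of p somewhere; applying the flow for
  a constant time moves it through p itself.\<close>

lemma local_section_through:
  assumes p: "p \<in> unit_tangent_sphere" "proj_geodesics p \<in> fst c"
  obtains V s where "open V" "snd c (proj_geodesics p) \<in> V" "V \<subseteq> img" "smooth_on V s" "s ` V \<subseteq> unit_tangent_sphere"
    "\<And>w. w \<in> V \<Longrightarrow> proj_geodesics (s w) = param c w" "s (snd c (proj_geodesics p)) = p"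
proof -
  let ?y = "snd c (proj_geodesics p)"
  have y: "?y \<in> img" using p by auto
  obtain V s where V: "open V" "?y \<in> V" "V \<subseteq> img" "smooth_on V s" "s ` V \<subseteq> unit_tangent_sphere"
    "\<forall>w\<in>V. proj_geodesics (s w) = param c w" using local_section[OF y] by blast
  have "proj_geodesics (s ?y) = proj_geodesics p" using V(2,6) param_snd[OF p(2)] by simp
  then obtain t where t: "p = geodesic_flow t (s ?y)" by (rule proj_geodesics_eqD)
  have lin: "linear (geodesic_flow t :: (real^'m) \<times> (real^'m) \<Rightarrow> _)"
    by (rule linearI) (auto simp: geodesic_flow_def algebra_simps)
  show thesis
  proof (rule that[of V "\<lambda>w. geodesic_flow t (s w)"])
    show "smooth_on V (\<lambda>w. geodesic_flow t (s w))"
      by (rule smooth_on_UNIV_compose[OF smooth_on_linear[OF lin] V(4)])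
    show "(\<lambda>w. geodesic_flow t (s w)) ` V \<subseteq> unit_tangent_sphere"
    proof (intro image_subsetI)
      fix w assume "w \<in> V"
      then have "s w \<in> unit_tangent_sphere" using V(5) by blast
      then show "geodesic_flow t (s w) \<in> unit_tangent_sphere" by (rule geodesic_flow_unit_tangent)
    qed
  qed (use V t in \<open>auto simp: proj_geodesics_flow\<close>)
qed

lemma smooth_\<Psi>: "smooth_on img \<Psi>"
proof (rule smooth_on_local)
  fix y assume "y \<in> img"
  from local_section[OF this] obtain V s where V: "open V" "y \<in> V" "V \<subseteq> img" "smooth_on V s"
    "\<forall>w\<in>V. proj_geodesics (s w) = param c w" by blast
  have "smooth_on V (\<lambda>w. wedge (fst (s w)) (snd (s w)))"
    by (intro smooth_on_bilinear[OF bounded_bilinear_wedge] smooth_on_intros V)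
  then have "smooth_on V \<Psi>"
    by (rule smooth_on_cong) (use V(5) in \<open>simp add: \<Psi>_def flip: pluecker_proj\<close>)
  then show "\<exists>V. open V \<and> y \<in> V \<and> smooth_on (img \<inter> V) \<Psi>"
    using V by (meson smooth_on_subset inf_le2)
qed

text \<open>For the first claim the product rule is applied to the wedge along the representing
  curve. For the second, coordinates composed with the projection extend to a smooth K near p, so
  \<open>X = D1 K p Z\<close> is determined by Z.\<close>

lemma pushes_forward_\<Psi>:
  assumes p: "p \<in> unit_tangent_sphere" "proj_geodesics p \<in> fst c"
    and pf: "pushes_geodesics c p Z X"
  shows "D1 \<Psi> (snd c (proj_geodesics p)) X = wedge (fst Z) (snd p) + wedge (fst p) (snd Z)"
    and "Z = 0 \<Longrightarrow> X = 0"
proof -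
  let ?y = "snd c (proj_geodesics p)"
  have y: "?y \<in> img" using p by auto
  obtain \<alpha> where \<alpha>: "range \<alpha> \<subseteq> unit_tangent_sphere" "\<alpha> 0 = p" "(\<alpha> has_vector_derivative Z) (at 0)"
    "((snd c \<circ> proj_geodesics \<circ> \<alpha>) has_vector_derivative X) (at 0)"
    using pf unfolding pushes_forward_def by blast
  have d: "((\<lambda>t. fst (\<alpha> t)) has_derivative (\<lambda>t. t *\<^sub>R fst Z)) (at 0)" "((\<lambda>t. snd (\<alpha> t)) has_derivative (\<lambda>t. t *\<^sub>R snd Z)) (at 0)"
    using has_derivative_fst[OF \<alpha>(3)[unfolded has_vector_derivative_def]]
      has_derivative_snd[OF \<alpha>(3)[unfolded has_vector_derivative_def]] by simp_all
  have pin: "p \<in> unit_tangent_sphere \<inter> proj_geodesics -` fst c" using p by auto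
  obtain A where A: "open A" "unit_tangent_sphere \<inter> proj_geodesics -` fst c = unit_tangent_sphere \<inter> A"
    using open_dom by (auto simp: openin_open)
  obtain B K where K: "open B" "p \<in> B" "\<forall>k. times_differentiable_on k B K"
    "\<And>z. z \<in> unit_tangent_sphere \<inter> proj_geodesics -` fst c \<Longrightarrow> z \<in> B \<Longrightarrow> K z = snd c (proj_geodesics z)"
    using smooth_onE[OF smooth_proj pin] by blast
  have "isCont \<alpha> 0" using \<alpha>(3) has_vector_derivative_continuous by blast
  then have "(\<alpha> \<longlongrightarrow> \<alpha> 0) (nhds 0)" by (simp add: continuous_at tendsto_at_iff_tendsto_nhds)
  then have "\<forall>\<^sub>F t in nhds 0. \<alpha> t \<in> A \<inter> B"
    by (rule topological_tendstoD) (use A K pin \<alpha>(2) in auto)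
  then obtain T where T: "open T" "0 \<in> T" "\<And>t. t \<in> T \<Longrightarrow> \<alpha> t \<in> A \<inter> B" by (auto simp: eventually_nhds)
  have in': "\<alpha> t \<in> unit_tangent_sphere \<inter> proj_geodesics -` fst c" if "t \<in> T" for t
    using A(2) T(3)[OF that] \<alpha>(1) by blast
  have "((\<lambda>t. \<Psi> ((snd c \<circ> proj_geodesics \<circ> \<alpha>) t)) has_derivative (\<lambda>t. D1 \<Psi> ?y (t *\<^sub>R X))) (at 0)"
    by (rule has_derivative_compose[OF \<alpha>(4)[unfolded has_vector_derivative_def]])
      (use smooth_on_has_derivative[OF smooth_\<Psi> open_img y] in \<open>simp add: \<alpha>(2)\<close>)
  then have "((\<lambda>t. wedge (fst (\<alpha> t)) (snd (\<alpha> t))) has_derivative (\<lambda>t. D1 \<Psi> ?y (t *\<^sub>R X))) (at 0)"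
    by (rule has_derivative_transform_within_open[OF _ T(1,2)])
      (use in' in \<open>simp add: \<Psi>_def param_snd pluecker_proj\<close>)
  from fun_cong[OF has_derivative_unique[OF this wedge.FDERIV[OF d]], of 1]
  show "D1 \<Psi> ?y X = wedge (fst Z) (snd p) + wedge (fst p) (snd Z)"
    by (simp add: \<alpha>(2) add.commute)
  have "smooth_on B K" using K(1,3) by (simp add: smooth_on_open_iff)
  from smooth_on_has_derivative[OF this K(1,2)]
  have "((\<lambda>t. K (\<alpha> t)) has_derivative (\<lambda>t. D1 K p (t *\<^sub>R Z))) (at 0)"
    by (intro has_derivative_compose[OF \<alpha>(3)[unfolded has_vector_derivative_def]]) (simp add: \<alpha>(2))
  then have "((\<lambda>t. snd c (proj_geodesics (\<alpha> t))) has_derivative (\<lambda>t. D1 K p (t *\<^sub>R Z))) (at 0)"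
    by (rule has_derivative_transform_within_open[OF _ T(1,2)]) (use in' T(3) K(4) in auto)
  from fun_cong[OF has_derivative_unique[OF this \<alpha>(4)[unfolded has_vector_derivative_def o_def]], of 1]
  have "X = D1 K p Z" by simp
  moreover have "D1 K p 0 = 0"
    using linear_0[OF D1_linear[OF \<open>smooth_on B K\<close> K(1,2)]] .
  ultimately show "Z = 0 \<Longrightarrow> X = 0" by simp
qed

lemma horizontal_representative:
  assumes p: "p \<in> unit_tangent_sphere" "proj_geodesics p \<in> fst c"
  obtains a b where "a \<bullet> fst p = 0" "a \<bullet> snd p = 0" "b \<bullet> fst p = 0" "b \<bullet> snd p = 0"
    "pushes_geodesics c p (a, b) X"
    "D1 \<Psi> (snd c (proj_geodesics p)) X = wedge a (snd p) + wedge (fst p) b"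
proof -
  let ?y = "snd c (proj_geodesics p)"
  obtain V s where V: "open V" "?y \<in> V" "V \<subseteq> img" "smooth_on V s" "s ` V \<subseteq> unit_tangent_sphere"
    "\<And>w. w \<in> V \<Longrightarrow> proj_geodesics (s w) = param c w" and sy: "s ?y = p"
    by (rule local_section_through[OF p]) blast
  have id: "snd c (proj_geodesics (s w)) = w" if "w \<in> V" for w
    using V(3,6) that snd_param(1) by auto
  have sm: "smooth_on V (\<lambda>w. snd c (proj_geodesics (s w)))"
    by (rule smooth_on_cong[OF smooth_on_id]) (simp add: id)
  have "D1 (\<lambda>w. snd c (proj_geodesics (s w))) ?y = D1 (\<lambda>w. w) ?y"
    by (rule D1_cong_open[OF V(1,2) id sm])
  then have pf: "pushes_geodesics c p (D1 s ?y X) X"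
    using pushes_forwardI[OF V(1,2,5,4) sm, of X] by (simp add: sy)
  define Z where "Z = D1 s ?y X"
  \<comment> \<open>Chosen to cancel the component of \<open>fst Z\<close> along
    \<open>snd p\<close>. Tangency to the unit tangent bundle then cancels the component of
    \<open>snd Z\<close> along \<open>fst p\<close> as well.\<close>
  define \<tau> where "\<tau> = - (fst Z \<bullet> snd p)"
  note pf' = pushes_forward_flow[OF pf[folded Z_def], of \<tau>]
  have tan: "tangent_to_UT p Z" by (rule pushes_forward_tangent[OF pf[folded Z_def]])
  show thesis
  proof (rule that[OF _ _ _ _ pf'])
    show "(fst Z + \<tau> *\<^sub>R snd p) \<bullet> fst p = 0" "(fst Z + \<tau> *\<^sub>R snd p) \<bullet> snd p = 0"
      "(snd Z - \<tau> *\<^sub>R fst p) \<bullet> fst p = 0" "(snd Z - \<tau> *\<^sub>R fst p) \<bullet> snd p = 0"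
      using tan unit_tangentD[OF p(1)] by (simp_all add: \<tau>_def inner_add_left inner_diff_left)
  qed (use pushes_forward_\<Psi>(1)[OF p pf'] in simp)
qed

text \<open>On vectors orthogonal to the flow the Pluecker map is isometric. Horizontality of one
  factor suffices for the mixed terms to vanish.\<close>

lemma wedge_horizontal_inner:
  assumes "p \<in> unit_tangent_sphere" "a \<bullet> fst p = 0" "a \<bullet> snd p = 0" "b \<bullet> fst p = 0" "b \<bullet> snd p = 0"
  shows "(wedge a (snd p) + wedge (fst p) b) \<bullet> (wedge a' (snd p) + wedge (fst p) b') = a \<bullet> a' + b \<bullet> b'"
  using unit_tangentD[OF assms(1)] assms(2-5)
  by (simp add: inner_add_left inner_add_right wedge_inner inner_commute[of "fst p" "a'"] inner_commute[of "fst p" a]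
     inner_commute[of "snd p" a] inner_commute[of "snd p" b] inner_commute[of "fst p" b])

lemma inj_\<Psi>:
  assumes "y \<in> img"
  shows "inj (D1 \<Psi> y)"
proof -
  have "X = 0" if X: "D1 \<Psi> y X = 0" for X
  proof -
    have q: "param c y \<in> fst c" "snd c (param c y) = y" using snd_param[OF assms] by auto
    obtain p where p: "p \<in> unit_tangent_sphere" "proj_geodesics p = param c y" and pc: "proj_geodesics p \<in> fst c"
      by (rule representative[OF assms])
    obtain a b where ab: "a \<bullet> fst p = 0" "a \<bullet> snd p = 0" "b \<bullet> fst p = 0" "b \<bullet> snd p = 0"
      and pf: "pushes_geodesics c p (a, b) X"
      and eq: "D1 \<Psi> (snd c (proj_geodesics p)) X = wedge a (snd p) + wedge (fst p) b"
      by (rule horizontal_representative[OF p(1) pc, of X]) blast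
    have "a \<bullet> a + b \<bullet> b = 0"
      using wedge_horizontal_inner[OF p(1) ab, of a b] eq X by (simp add: p q)
    then have "a = 0" "b = 0" using inner_ge_zero[of a] inner_ge_zero[of b] by (smt (verit) inner_eq_zero_iff)+
    then show "X = 0" using pushes_forward_\<Psi>(2)[OF p(1) pc pf] by (simp add: zero_prod_def)
  qed
  then show ?thesis using linear_injective_0[OF D1_linear[OF smooth_\<Psi> open_img assms]] by blast
qed

text \<open>The right side mentions neither the base point on the orbit nor the generators, so every
  admissible choice in the definition gives the same number;
  \<open>horizontal_representative\<close> and \<open>isotropy_complement_exists\<close> provide one
  such choice.\<close>

lemma geodesic_metric:
  assumes y: "y \<in> img"
  shows "geodesic_metric c (param c y) X Y = D1 \<Psi> y X \<bullet> D1 \<Psi> y Y"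
proof -
  have q: "param c y \<in> fst c" "snd c (param c y) = y" using snd_param[OF y] by auto
  obtain p where p: "p \<in> unit_tangent_sphere" "proj_geodesics p = param c y" and pc: "proj_geodesics p \<in> fst c"
    by (rule representative[OF y])
  obtain x v where xv: "p = (x, v)" by (cases p)
  have unique: "so_inner \<eta> \<zeta> = D1 \<Psi> y X \<bullet> D1 \<Psi> y Y"
    if "p' \<in> unit_tangent_sphere" "proj_geodesics p' = param c y"
      "\<eta> \<in> isotropy_complement p'" "\<zeta> \<in> isotropy_complement p'"
      "pushes_geodesics c p' (inf_action \<eta> p') X"
      "pushes_geodesics c p' (inf_action \<zeta> p') Y" for p' \<eta> \<zeta>
  proof -
    obtain x v where p': "p' = (x, v)" by (cases p')
    have p'c: "proj_geodesics p' \<in> fst c" using that q by simp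
    note comp = isotropy_complement_mult[OF that(1,3)[unfolded p']]
    show ?thesis
      using pushes_forward_\<Psi>(1)[OF that(1) p'c that(5)] pushes_forward_\<Psi>(1)[OF that(1) p'c that(6)]
        wedge_horizontal_inner[OF that(1), of "\<eta> *v x" "\<eta> *v v" "\<zeta> *v x" "\<zeta> *v v"] comp(1-4)
        so_inner_isotropy_complement[OF that(1,3,4)[unfolded p']]
      using that(2) q by (simp add: p' inf_action_def)
  qed
  have "\<exists>\<eta>\<in>isotropy_complement p. pushes_geodesics c p (inf_action \<eta> p) X" for X
  proof -
    obtain a b where ab: "a \<bullet> fst p = 0" "a \<bullet> snd p = 0" "b \<bullet> fst p = 0" "b \<bullet> snd p = 0"
      and pf: "pushes_geodesics c p (a, b) X"
      by (rule horizontal_representative[OF p(1) pc, of X]) blast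
    obtain \<eta> where "\<eta> \<in> isotropy_complement (x, v)" "\<eta> *v x = a" "\<eta> *v v = b"
      by (rule isotropy_complement_exists[OF p(1)[unfolded xv], of a b]) (use ab in \<open>auto simp: xv\<close>)
    then show ?thesis using pf by (auto simp: xv inf_action_def)
  qed
  from this[of X] this[of Y] obtain \<eta> \<zeta> where ex: "\<eta> \<in> isotropy_complement p" "\<zeta> \<in> isotropy_complement p"
    "pushes_geodesics c p (inf_action \<eta> p) X"
    "pushes_geodesics c p (inf_action \<zeta> p) Y" by blast
  show ?thesis unfolding geodesic_metric_def
  proof (rule the_equality)
    show "\<exists>p\<in>unit_tangent_sphere. proj_geodesics p = param c y \<and>
     (\<exists>\<eta>\<in>isotropy_complement p. \<exists>\<zeta>\<in>isotropy_complement p.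
        pushes_geodesics c p (inf_action \<eta> p) X \<and>
        pushes_geodesics c p (inf_action \<zeta> p) Y \<and>
        D1 \<Psi> y X \<bullet> D1 \<Psi> y Y = so_inner \<eta> \<zeta>)"
      using p ex unique[OF p ex] by metis
  qed (use unique in blast)
qed

lemma exterior_derivative_contact_form:
  fixes p Z Z' :: "(real^'m) \<times> (real^'m)"
  shows "exterior_derivative contact_form p Z Z' = fst Z' \<bullet> snd Z - fst Z \<bullet> snd Z'"
proof -
  have "((\<lambda>z. contact_form z Y) has_derivative (\<lambda>X. fst Y \<bullet> snd X)) (at p)" for Y :: "(real^'m) \<times> (real^'m)"
    unfolding contact_form_def case_prod_beta by (auto intro!: derivative_eq_intros)
  then have "D1 (\<lambda>z. contact_form z Y) p = (\<lambda>X. fst Y \<bullet> snd X)" for Y :: "(real^'m) \<times> (real^'m)"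
    by (rule D1_eqI)
  then show ?thesis by (simp add: exterior_derivative_def)
qed

text \<open>Expresses the form through the Pluecker images P, P' alone, so that it depends on the
  pushed forward vectors and not on their lifts Z, Z'. The factor 2 compensates for two factors
  \<open>1 / sqrt 2\<close> from \<open>wedge_mult_vector\<close>.\<close>

lemma wedge_symplectic:
  assumes "p \<in> unit_tangent_sphere" "tangent_to_UT p Z" "tangent_to_UT p Z'"
    and "P = wedge (fst Z) (snd p) + wedge (fst p) (snd Z)" "P' = wedge (fst Z') (snd p) + wedge (fst p) (snd Z')"
  shows "fst Z \<bullet> snd Z' - fst Z' \<bullet> snd Z = 2 * ((P *v fst p) \<bullet> (P' *v snd p) - (P *v snd p) \<bullet> (P' *v fst p))"
proof -
  obtain x v a b a' b' where eq: "p = (x, v)" "Z = (a, b)" "Z' = (a', b')" by (metis surj_pair)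
  have o: "x \<bullet> x = 1" "v \<bullet> v = 1" "x \<bullet> v = 0" "v \<bullet> x = 0" using unit_tangentD[OF assms(1)] by (auto simp: eq)
  have t: "a \<bullet> x = 0" "b \<bullet> v = 0" "x \<bullet> a = 0" "v \<bullet> b = 0"  "a' \<bullet> x = 0" "b' \<bullet> v = 0" "x \<bullet> a' = 0" "v \<bullet> b' = 0"
    using assms(2,3) by (auto simp: eq inner_commute)
  have "P *v x = (1 / sqrt 2) *\<^sub>R ((b \<bullet> x) *\<^sub>R x - b)" "P *v v = (1 / sqrt 2) *\<^sub>R (a - (a \<bullet> v) *\<^sub>R v)"
    "P' *v x = (1 / sqrt 2) *\<^sub>R ((b' \<bullet> x) *\<^sub>R x - b')" "P' *v v = (1 / sqrt 2) *\<^sub>R (a' - (a' \<bullet> v) *\<^sub>R v)"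
    by (simp_all add: assms(4,5) eq matrix_vector_mult_add_rdistrib wedge_mult_vector o t)
  then show ?thesis
    by (simp add: eq inner_diff_left inner_diff_right o t inner_commute[of b] inner_commute[of b'])
qed

lemma geodesic_symplectic:
  assumes p: "p \<in> unit_tangent_sphere" "proj_geodesics p \<in> fst c"
    and pf: "pushes_geodesics c p Z X"
      "pushes_geodesics c p Z' Y"
  shows "geodesic_symplectic c (proj_geodesics p) X Y = fst Z \<bullet> snd Z' - fst Z' \<bullet> snd Z"
proof -
  let ?y = "snd c (proj_geodesics p)"
  let ?P = "D1 \<Psi> ?y X" and ?P' = "D1 \<Psi> ?y Y"
  have form: "fst Z \<bullet> snd Z' - fst Z' \<bullet> snd Z = 2 * ((?P *v fst p) \<bullet> (?P' *v snd p) - (?P *v snd p) \<bullet> (?P' *v fst p))"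
    if "p \<in> unit_tangent_sphere" "proj_geodesics p \<in> fst c" "snd c (proj_geodesics p) = ?y"
      "pushes_geodesics c p Z X"
      "pushes_geodesics c p Z' Y" for p Z Z'
    using wedge_symplectic[OF that(1) pushes_forward_tangent[OF that(4)] pushes_forward_tangent[OF that(5)] refl refl]
      pushes_forward_\<Psi>(1)[OF that(1,2,4)] pushes_forward_\<Psi>(1)[OF that(1,2,5)] by (simp only: that(3))
  have unique: "fst W \<bullet> snd W' - fst W' \<bullet> snd W = fst Z \<bullet> snd Z' - fst Z' \<bullet> snd Z"
    if "p' \<in> unit_tangent_sphere" "proj_geodesics p' = proj_geodesics p"
      "pushes_geodesics c p' W X"
      "pushes_geodesics c p' W' Y" for p' W W'
  proof -
    from proj_geodesics_eqD[OF that(2)[symmetric]] obtain t where t: "p' = geodesic_flow t p" .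
    \<comment> \<open>Another base point on the orbit rotates \<open>(fst p, snd p)\<close>; the
      right side of \<open>form\<close> is alternating in this pair and hence invariant under
      rotations.\<close>
    have alg: "(cs *\<^sub>R a + sn *\<^sub>R b) \<bullet> (cs *\<^sub>R b' - sn *\<^sub>R a') - (cs *\<^sub>R b - sn *\<^sub>R a) \<bullet> (cs *\<^sub>R a' + sn *\<^sub>R b')
      = (cs * cs + sn * sn) * (a \<bullet> b' - b \<bullet> a')" for cs sn and a b a' b' :: "real^'m"
      by (simp add: inner_add_left inner_add_right inner_diff_left inner_diff_right algebra_simps)
    have "cos t * cos t + sin t * sin t = 1"
      using sin_cos_squared_add[of t] by (simp add: power2_eq_square)
    then have "(?P *v fst p') \<bullet> (?P' *v snd p') - (?P *v snd p') \<bullet> (?P' *v fst p') =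
        (?P *v fst p) \<bullet> (?P' *v snd p) - (?P *v snd p) \<bullet> (?P' *v fst p)"
      using alg[of "cos t" "?P *v fst p" "sin t" "?P *v snd p" "?P' *v snd p" "?P' *v fst p"]
      by (simp add: t geodesic_flow_def case_prod_beta matrix_vector_right_distrib matrix_vector_mult_diff_distrib matrix_vector_mult_scaleR)
    then show ?thesis
      using form[OF that(1) _ _ that(3,4)] form[OF p refl pf] p that(2) by simp
  qed
  show ?thesis unfolding geodesic_symplectic_def exterior_derivative_contact_form
  proof (rule the_equality)
    show "\<exists>p'\<in>unit_tangent_sphere. proj_geodesics p' = proj_geodesics p \<and>
      (\<exists>W W'. pushes_geodesics c p' W X \<and>
         pushes_geodesics c p' W' Y \<and>
         fst Z \<bullet> snd Z' - fst Z' \<bullet> snd Z = - (fst W' \<bullet> snd W - fst W \<bullet> snd W'))"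
      using p pf by (intro bexI[of _ p] conjI exI[of _ Z] exI[of _ Z']) auto
  qed (use unique in force)
qed

end

section \<open>The geodesic Gauss map in charts\<close>

lemma D2_cong_open:
  assumes "open S" "x \<in> S" "\<And>z. z \<in> S \<Longrightarrow> f z = g z" "smooth_on S f"
  shows "D2 f x X = D2 g x X"
  by (rule D1_cong_open[OF assms(1,2) _ smooth_on_frechet_derivative[OF assms(4,1)]])
    (simp add: D1_cong_open[OF assms(1) _ assms(3,4)])

text \<open>T need not be open. A local extension K of k still satisfies
  \<open>K (\<sigma> z) = z\<close> for z near y, and the chain rule makes
  \<open>D1 K (\<sigma> y)\<close> a left inverse of \<open>D1 \<sigma> y\<close>.\<close>

lemma smooth_left_inverse_inj:
  fixes \<sigma> :: "'a::euclidean_space \<Rightarrow> 'b::euclidean_space"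
  assumes W: "open W" "y \<in> W" and \<sigma>: "smooth_on W \<sigma>" and k: "smooth_on T k" "\<sigma> ` W \<subseteq> T"
    and id: "\<And>z. z \<in> W \<Longrightarrow> k (\<sigma> z) = z"
  shows "inj (D1 \<sigma> y)"
proof -
  have "\<sigma> y \<in> T" using W k by auto
  then obtain B K where K: "open B" "\<sigma> y \<in> B" "\<forall>k. times_differentiable_on k B K" "\<And>z. z \<in> T \<Longrightarrow> z \<in> B \<Longrightarrow> K z = k z"
    using smooth_onE[OF k(1)] by metis
  have smK: "smooth_on B K" using K(1,3) by (simp add: smooth_on_open_iff)
  define W' where "W' = W \<inter> \<sigma> -` B"
  have W': "open W'" "y \<in> W'"
    using smooth_on_continuous_on[OF \<sigma>] W K by (auto simp: W'_def continuous_on_open_vimage Int_commute)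
  have "K (\<sigma> z) = z" if "z \<in> W'" for z
    using that K(4) id k(2) by (auto simp: W'_def image_subset_iff)
  then have "D1 (\<lambda>z. K (\<sigma> z)) y = D1 (\<lambda>z. z) y"
    by (intro D1_cong_open[OF W'(1,2)] smooth_on_compose[OF smooth_on_subset[OF \<sigma>] smK]) (auto simp: W'_def)
  then have "D1 K (\<sigma> y) (D1 \<sigma> y X) = X" for X
    by (simp add: D1_compose[OF \<sigma> W smK K(1,2)] fun_eq_iff)
  then show ?thesis by (metis injI)
qed

section \<open>Charts of the sphere and the minimality of f in coordinates\<close>

lemma round_sphere_chart:
  assumes "c \<in> atlas (round_sphere :: (real^'m, 's::euclidean_space) manifold)"
  shows "fst c \<subseteq> sphere 0 1" "inj_on (snd c) (fst c)" "open (snd c ` fst c)"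
    "smooth_on (fst c) (snd c)" "smooth_on (snd c ` fst c) (param c)"
  using assms unfolding round_sphere_def submanifold_def euclidean_manifold_def
  by (auto simp: local_rep_def)

text \<open>Tangent vectors are orthogonal to the position, and the dimensions agree. The second
  claim lets every vector orthogonal to the position serve as a test vector in
  \<open>mean_curvature_eq_0_iff\<close>.\<close>

lemma round_sphere_param:
  assumes c: "c \<in> atlas (round_sphere :: (real^'m, 's::euclidean_space) manifold)" and y: "y \<in> snd c ` fst c"
  shows "inj (D1 (param c) y)"
    and "CARD('m) = DIM('s) + 1 \<Longrightarrow> param c y \<bullet> v = 0 \<Longrightarrow> v \<in> range (D1 (param c) y)"
proof -
  note c = round_sphere_chart[OF c]
  show inj: "inj (D1 (param c) y)"
    by (rule smooth_left_inverse_inj[OF c(3) y c(5,4)]) (auto intro: inv_into_into f_inv_into_f)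
  have unit: "param c z \<bullet> param c z = 1" if "z \<in> snd c ` fst c" for z
    using inv_into_into[OF that] c(1) by (auto simp flip: norm_eq_1)
  have lin: "linear (D1 (param c) y)" by (rule D1_linear[OF c(5,3) y])
  assume dim: "CARD('m) = DIM('s) + 1" and v: "param c y \<bullet> v = 0"
  have "range (D1 (param c) y) = {v. param c y \<bullet> v = 0}"
  proof (rule subspace_dim_equal)
    show "range (D1 (param c) y) \<subseteq> {v. param c y \<bullet> v = 0}"
      using smooth_on_inner_const_derivative[OF c(5,5,3) y unit] by (auto simp: inner_commute)
    have "param c y \<noteq> 0" using unit[OF y] by auto
    then have "dim {v. param c y \<bullet> v = 0} = DIM('s)" using dim by (simp add: dim_hyperplane)
    also have "\<dots> = dim (range (D1 (param c) y))"
      using dim_image_eq[OF lin, of UNIV] inj by (simp add: dim_UNIV)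
    finally show "dim {v. param c y \<bullet> v = 0} \<le> dim (range (D1 (param c) y))" by simp
  qed (use lin linear_subspace_image[OF lin subspace_UNIV] subspace_hyperplane in auto)
  then show "v \<in> range (D1 (param c) y)" using v by simp
qed

lemma smooth_manifold_chart:
  assumes "smooth_manifold M" "c \<in> atlas M"
  shows "fst c \<subseteq> carrier M" "inj_on (snd c) (fst c)" "open (snd c ` fst c)"
    and "c' \<in> atlas M \<Longrightarrow> open (snd c ` (fst c \<inter> fst c'))"
    and "c' \<in> atlas M \<Longrightarrow> smooth_on (snd c ` (fst c \<inter> fst c')) (\<lambda>w. snd c' (param c w))"
  using assms unfolding smooth_manifold_def local_rep_def by (auto simp: o_def)

text \<open>\<open>smooth_map\<close> speaks of one suitable chart c0 at each point; the transition
  from c to c0 carries the statement over to the prescribed chart c.\<close>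

lemma sphere_map_chart:
  fixes f :: "'p \<Rightarrow> real^'m" and M :: "('p, 'a::euclidean_space) manifold"
  assumes M: "smooth_manifold M" and f: "smooth_map M (round_sphere :: (real^'m, 's::euclidean_space) manifold) f"
    and c: "c \<in> atlas M" and w: "w \<in> snd c ` fst c"
  obtains c' A where "c' \<in> charts_at (round_sphere :: (real^'m, 's) manifold) (f (param c w))"
    "open A" "w \<in> A" "A \<subseteq> snd c ` fst c" "\<And>z. z \<in> A \<Longrightarrow> f (param c z) \<in> fst c'" "smooth_on A (\<lambda>z. f (param c z))"
    "smooth_on A (\<lambda>z. snd c' (f (param c z)))"
proof -
  note cM = smooth_manifold_chart[OF M c]
  define p where "p = param c w"
  have p: "p \<in> fst c" "snd c p = w" using w by (auto simp: p_def intro: inv_into_into f_inv_into_f)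
  then have "p \<in> carrier M" using cM by auto
  then obtain c0 c' W where *: "c0 \<in> charts_at M p" "c' \<in> charts_at (round_sphere :: (real^'m, 's) manifold) (f p)"
    "open W" "snd c0 p \<in> W" "W \<subseteq> snd c0 ` fst c0" "f ` param c0 ` W \<subseteq> fst c'" "smooth_on W (local_rep c0 c' f)"
    using f unfolding smooth_map_def by blast
  have c0: "c0 \<in> atlas M" "p \<in> fst c0" and c': "c' \<in> atlas (round_sphere :: (real^'m, 's) manifold)" "f p \<in> fst c'" using * by auto
  note c0M = smooth_manifold_chart[OF M c0(1)] and c'S = round_sphere_chart[OF c'(1)]
  let ?\<tau> = "\<lambda>z. snd c0 (param c z)"
  define A where "A = snd c ` (fst c \<inter> fst c0) \<inter> ?\<tau> -` W"
  have A: "open A"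
    using smooth_on_continuous_on[OF cM(5)[OF c0(1)]] cM(4)[OF c0(1)] *(3) by (simp add: A_def continuous_on_open_vimage Int_commute)
  have wA: "w \<in> A" using imageI[of p "fst c \<inter> fst c0" "snd c", unfolded p(2)] p c0 *(4) by (simp add: A_def p_def)
  have recover: "param c0 (?\<tau> z) = param c z" if "z \<in> A" for z
    using that c0M(2) cM(2) by (auto simp: A_def)
  have in': "f (param c z) \<in> fst c'" if "z \<in> A" for z
  proof -
    have "?\<tau> z \<in> W" using that by (simp add: A_def)
    then have "f (param c0 (?\<tau> z)) \<in> fst c'" using *(6) by blast
    then show ?thesis using recover[OF that] by simp
  qed
  have sm: "smooth_on A (\<lambda>z. local_rep c0 c' f (?\<tau> z))"
    by (rule smooth_on_compose[OF smooth_on_subset[OF cM(5)[OF c0(1)]] *(7)]) (auto simp: A_def)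
  have sm': "smooth_on A (\<lambda>z. snd c' (f (param c z)))"
    by (rule smooth_on_cong[OF sm]) (simp add: local_rep_def recover)
  have "smooth_on A (\<lambda>z. param c' (snd c' (f (param c z))))"
    by (rule smooth_on_compose[OF sm' c'S(5)]) (use in' in auto)
  then have "smooth_on A (\<lambda>z. f (param c z))"
    by (rule smooth_on_cong) (use in' c'S(2) in simp)
  then show thesis
    using that[of c' A] *(2) A wA in' sm' by (auto simp: p_def A_def)
qed

text \<open>Translates the hypotheses on f into the Euclidean assumptions of
  \<open>unit_normal_graph\<close>. A vector v orthogonal to the position is tangent to the sphere,
  so it has coordinates N to which the minimality criterion applies.\<close>

lemma minimal_sphere_immersion_chart:
  fixes f :: "'p \<Rightarrow> real^'m" and M :: "('p, 'a::euclidean_space) manifold"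
  assumes M: "smooth_manifold M"
    and f: "minimal_immersion M (round_sphere :: (real^'m, 's::euclidean_space) manifold) round_metric f"
    and dim: "CARD('m) = DIM('s) + 1" and c: "c \<in> atlas M"
  shows "smooth_on (snd c ` fst c) (\<lambda>w. f (param c w))"
    and "\<And>w. w \<in> snd c ` fst c \<Longrightarrow> f (param c w) \<bullet> f (param c w) = 1"
    and "\<And>w. w \<in> snd c ` fst c \<Longrightarrow> inj (D1 (\<lambda>w. f (param c w)) w)"
    and "\<And>w v E. w \<in> snd c ` fst c \<Longrightarrow> f (param c w) \<bullet> v = 0 \<Longrightarrow> (\<And>X. D1 (\<lambda>w. f (param c w)) w X \<bullet> v = 0) \<Longrightarrow>
        orthonormal_for (D1 (\<lambda>w. f (param c w)) w) E \<Longrightarrow> (\<Sum>X\<in>E. D2 (\<lambda>w. f (param c w)) w X X) \<bullet> v = 0"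
proof -
  let ?U = "snd c ` fst c" and ?\<phi> = "\<lambda>w. f (param c w)"
  note cM = smooth_manifold_chart[OF M c]
  have imm: "immersion M (round_sphere :: (real^'m, 's) manifold) f" and sm: "smooth_map M (round_sphere :: (real^'m, 's) manifold) f"
    using f by (auto simp: minimal_immersion_def immersion_def)
  show smooth: "smooth_on ?U ?\<phi>"
  proof (rule smooth_on_local)
    fix w assume "w \<in> ?U"
    then obtain A where "open A" "w \<in> A" "smooth_on A ?\<phi>" by (rule sphere_map_chart[OF M sm c]) blast
    then show "\<exists>A. open A \<and> w \<in> A \<and> smooth_on (?U \<inter> A) ?\<phi>" by (meson smooth_on_subset inf_le2)
  qed
  show "?\<phi> w \<bullet> ?\<phi> w = 1" if w: "w \<in> ?U" for w
  proof -
    obtain c' where c': "c' \<in> charts_at (round_sphere :: (real^'m, 's) manifold) (f (param c w))"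
      by (rule sphere_map_chart[OF M sm c w]) blast
    then have "?\<phi> w \<in> sphere 0 1" using round_sphere_chart(1)[of c'] by auto
    then show ?thesis by (simp add: norm_eq_1)
  qed
  fix w assume w: "w \<in> ?U"
  have p: "param c w \<in> fst c" "snd c (param c w) = w" using w by (auto intro: inv_into_into f_inv_into_f)
  then have pM: "param c w \<in> carrier M" and pc: "c \<in> charts_at M (param c w)" using cM c by auto
  obtain c' A where c': "c' \<in> charts_at (round_sphere :: (real^'m, 's) manifold) (f (param c w))"
    and A: "open A" "w \<in> A" "A \<subseteq> ?U" and in': "\<And>z. z \<in> A \<Longrightarrow> ?\<phi> z \<in> fst c'" and smA: "smooth_on A ?\<phi>"
    and smA': "smooth_on A (\<lambda>z. snd c' (?\<phi> z))"
    by (rule sphere_map_chart[OF M sm c w]) blast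
  have c'S: "c' \<in> atlas (round_sphere :: (real^'m, 's) manifold)" using c' by simp
  note cS = round_sphere_chart[OF c'S]
  have rep: "local_rep c c' f = (\<lambda>z. snd c' (?\<phi> z))" by (auto simp: local_rep_def)
  let ?\<Phi> = "\<lambda>z. snd c' (?\<phi> z)"
  have "inj (differential c c' f (param c w))" using imm pM pc c' unfolding immersion_def by blast
  then have injD: "inj (D1 ?\<Phi> w)" by (simp add: differential_def rep p(2))
  interpret pb: pullback_metric "snd c' ` fst c'" "param c'" A ?\<Phi> "\<lambda>y. round_metric c' (param c' y)" w
  proof
    show "inj (D1 (param c') (?\<Phi> w))" by (rule round_sphere_param(1)[OF c'S]) (use in' A in auto)
    show "round_metric c' (param c' y) X Y = D1 (param c') y X \<bullet> D1 (param c') y Y" if "y \<in> snd c' ` fst c'" for y X Y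
      using that by (simp add: round_metric_def f_inv_into_f)
  qed (use cS smA' A in' injD in auto)
  have recover: "param c' (?\<Phi> z) = ?\<phi> z" if "z \<in> A" for z using in'[OF that] cS(2) by simp
  have smc: "smooth_on A (\<lambda>z. param c' (?\<Phi> z))" by (rule smooth_on_cong[OF smA]) (simp add: recover)
  have D1: "D1 (\<lambda>z. param c' (?\<Phi> z)) w = D1 ?\<phi> w" and D2: "D2 (\<lambda>z. param c' (?\<Phi> z)) w X = D2 ?\<phi> w X" for X
    by (rule D1_cong_open[OF A(1,2) recover smc] D2_cong_open[OF A(1,2) recover smc]; assumption)+
  show "inj (D1 ?\<phi> w)" using pb.inj_comp unfolding D1 .
  fix v E assume v: "?\<phi> w \<bullet> v = 0" "\<And>X. D1 ?\<phi> w X \<bullet> v = 0" and E: "orthonormal_for (D1 ?\<phi> w) E"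
  have "mean_curvature (\<lambda>y. round_metric c' (param c' y)) (local_rep c c' f) (snd c (param c w)) = 0"
    using f pM pc c' unfolding minimal_immersion_def by blast
  then have "mean_curvature (\<lambda>y. round_metric c' (param c' y)) ?\<Phi> w = 0"
    by (simp only: rep p(2))
  moreover obtain N where "v = D1 (param c') (?\<Phi> w) N"
    using round_sphere_param(2)[OF c'S _ dim, of "?\<Phi> w" v] v(1) recover[OF A(2)] in'[OF A(2)] by auto
  ultimately show "(\<Sum>X\<in>E. D2 ?\<phi> w X X) \<bullet> v = 0"
    using pb.mean_curvature_eq_0_iff[unfolded D1, OF E] v(2) unfolding D2 by (simp add: inner_commute)
qed

section \<open>The Gauss map in a pair of charts\<close>

locale gauss_map_chart = unit_normal_graph U \<phi> W \<upsilon> \<nu> + geodesic_chart c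
  for U :: "'a::euclidean_space set" and \<phi> :: "'a \<Rightarrow> real^'m" and W :: "'e::euclidean_space set" and \<upsilon> \<nu>
    and c :: "(((real^'m) \<times> (real^'m)) set, 'h::euclidean_space) chart"
begin

definition \<mu> :: "'e \<Rightarrow> (real^'m) \<times> (real^'m)" where "\<mu> y = (F y, \<nu> y)"

lemma \<mu>: "smooth_on W \<mu>" "y \<in> W \<Longrightarrow> \<mu> y \<in> unit_tangent_sphere" "y \<in> W \<Longrightarrow> D1 \<mu> y X = L y X"
proof -
  show "smooth_on W \<mu>" unfolding \<mu>_def[abs_def] by (intro smooth_on_Pair F \<nu>)
  show "y \<in> W \<Longrightarrow> \<mu> y \<in> unit_tangent_sphere"
    using orthogonality[of y] \<nu>_unit[of y] by (simp add: \<mu>_def unit_tangent_sphere_def norm_eq_1)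
  show "D1 \<mu> y X = L y X" if "y \<in> W"
    using D1_eqI[OF has_derivative_Pair[OF smooth_on_has_derivative[OF F W that] smooth_on_has_derivative[OF \<nu> W that]]]
    by (simp add: L_def \<mu>_def[abs_def])
qed

definition "W1 = {y \<in> W. proj_geodesics (\<mu> y) \<in> fst c}"

lemma open_W1: "open W1"
proof -
  obtain A where A: "open A" "unit_tangent_sphere \<inter> proj_geodesics -` fst c = unit_tangent_sphere \<inter> A"
    using open_dom by (auto simp: openin_open)
  have "proj_geodesics z \<in> fst c \<longleftrightarrow> z \<in> A" if "z \<in> unit_tangent_sphere" for z using A(2) that by blast
  then have "W1 = W \<inter> \<mu> -` A" using \<mu>(2) unfolding W1_def by blast
  then show ?thesis
    using smooth_on_continuous_on[OF \<mu>(1)] W A(1) by (simp add: continuous_on_open_vimage Int_commute)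
qed

definition \<Phi> :: "'e \<Rightarrow> 'h" where "\<Phi> y = snd c (proj_geodesics (\<mu> y))"

lemma smooth_\<Phi>: "smooth_on W1 \<Phi>"
  unfolding \<Phi>_def[abs_def]
  by (rule smooth_on_compose[OF smooth_on_subset[OF \<mu>(1)] smooth_proj]) (use \<mu>(2) in \<open>auto simp: W1_def\<close>)

lemma \<Psi>_\<Phi>: "y \<in> W1 \<Longrightarrow> \<Psi> (\<Phi> y) = wedge (F y) (\<nu> y)"
  by (simp add: \<Psi>_def \<Phi>_def W1_def param_snd pluecker_proj) (simp add: \<mu>_def)

lemma \<Phi>_img: "\<Phi> ` W1 \<subseteq> img"
  by (auto simp: \<Phi>_def W1_def)

lemma W1_W: "y \<in> W1 \<Longrightarrow> y \<in> W" by (simp add: W1_def)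

lemma D1_wedge:
  assumes "y \<in> W"
  shows "D1 (\<lambda>y. wedge (F y) (\<nu> y)) y X = wedge (D1 F y X) (\<nu> y) + wedge (F y) (D1 \<nu> y X)"
  using D1_eqI[OF wedge.FDERIV[OF smooth_on_has_derivative[OF F W assms] smooth_on_has_derivative[OF \<nu> W assms]]]
  by (simp add: add.commute)

lemma smooth_\<Psi>_\<Phi>: "smooth_on W1 (\<lambda>y. \<Psi> (\<Phi> y))"
  by (rule smooth_on_compose[OF smooth_\<Phi> smooth_\<Psi> \<Phi>_img])

lemma D1_\<Psi>_\<Phi>:
  assumes y: "y \<in> W1"
  shows "D1 (\<lambda>y. \<Psi> (\<Phi> y)) y X = wedge (D1 F y X) (\<nu> y) + wedge (F y) (D1 \<nu> y X)"
  using D1_cong_open[OF open_W1 y \<Psi>_\<Phi> smooth_\<Psi>_\<Phi>] D1_wedge[OF W1_W[OF y]] by simp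

lemma D2_\<Psi>_\<Phi>:
  assumes y: "y \<in> W1"
  shows "D2 (\<lambda>y. \<Psi> (\<Phi> y)) y X X =
    wedge (D2 F y X X) (\<nu> y) + 2 *\<^sub>R wedge (D1 F y X) (D1 \<nu> y X) + wedge (F y) (D2 \<nu> y X X)"
proof -
  note yW = W1_W[OF y]
  have "((\<lambda>y. wedge (D1 F y X) (\<nu> y) + wedge (F y) (D1 \<nu> y X)) has_derivative
     (\<lambda>Y. (wedge (D1 F y X) (D1 \<nu> y Y) + wedge (D2 F y X Y) (\<nu> y)) + (wedge (F y) (D2 \<nu> y X Y) + wedge (D1 F y Y) (D1 \<nu> y X)))) (at y)"
    by (intro has_derivative_add wedge.FDERIV D2_has_derivative[OF F W yW] D2_has_derivative[OF \<nu> W yW]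
       smooth_on_has_derivative[OF F W yW] smooth_on_has_derivative[OF \<nu> W yW])
  then have "((\<lambda>z. D1 (\<lambda>y. \<Psi> (\<Phi> y)) z X) has_derivative
     (\<lambda>Y. (wedge (D1 F y X) (D1 \<nu> y Y) + wedge (D2 F y X Y) (\<nu> y)) + (wedge (F y) (D2 \<nu> y X Y) + wedge (D1 F y Y) (D1 \<nu> y X)))) (at y)"
    by (rule has_derivative_transform_within_open[OF _ open_W1 y]) (simp add: D1_\<Psi>_\<Phi>)
  from D1_eqI[OF this] show ?thesis by (simp add: scaleR_2)
qed

text \<open>The derivatives of F and \<open>\<nu>\<close> are orthogonal to both F and
  \<open>\<nu>\<close>: the spherical Gauss map is horizontal for the projection to the space of
  geodesics.\<close>

lemma inner_D1_\<Psi>_\<Phi>: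
  assumes y: "y \<in> W1"
  shows "D1 (\<lambda>y. \<Psi> (\<Phi> y)) y X \<bullet> D1 (\<lambda>y. \<Psi> (\<Phi> y)) y Y = L y X \<bullet> L y Y"
  using wedge_horizontal_inner[OF \<mu>(2)[OF W1_W[OF y]], of "D1 F y X" "D1 \<nu> y X" "D1 F y Y" "D1 \<nu> y Y"] orthogonality[OF W1_W[OF y]]
  by (simp add: D1_\<Psi>_\<Phi>[OF y] L_def \<mu>_def)

lemma inj_D1_\<Phi>:
  assumes y: "y \<in> W1"
  shows "inj (D1 \<Phi> y)"
proof -
  have \<Phi>y: "\<Phi> y \<in> img" using \<Phi>_img y by auto
  have lin: "linear (D1 \<Phi> y)" by (rule D1_linear[OF smooth_\<Phi> open_W1 y])
  have "X = 0" if "D1 \<Phi> y X = 0" for X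
  proof -
    have "D1 (\<lambda>y. \<Psi> (\<Phi> y)) y X = 0"
      using that linear_0[OF D1_linear[OF smooth_\<Psi> open_img \<Phi>y]]
      by (simp add: D1_compose[OF smooth_\<Phi> open_W1 y smooth_\<Psi> open_img \<Phi>y])
    then have "L y X \<bullet> L y X = 0" using inner_D1_\<Psi>_\<Phi>[OF y, of X X] by simp
    then show ?thesis using inj_L[OF W1_W[OF y]] by simp
  qed
  then show ?thesis using linear_injective_0[OF lin] by blast
qed

theorem mean_curvature_0:
  assumes y: "y \<in> W1"
  shows "mean_curvature (\<lambda>z. geodesic_metric c (param c z)) \<Phi> y = 0"
proof -
  note yW = W1_W[OF y]
  interpret pb: pullback_metric img \<Psi> W1 \<Phi> "\<lambda>z. geodesic_metric c (param c z)" y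
    by unfold_locales (use smooth_\<Psi> open_img smooth_\<Phi> open_W1 y \<Phi>_img inj_\<Psi> inj_D1_\<Phi> geodesic_metric in auto)
  have inj: "inj (L y)" using linear_injective_0[OF linears(5)[OF yW]] inj_L[OF yW] by blast
  obtain E where E: "orthonormal_for (L y) E"
    by (rule orthonormal_for_exists[OF linears(5)[OF yW] inj])
  then have E': "orthonormal_for (D1 (\<lambda>w. \<Psi> (\<Phi> w)) y) E"
    by (simp add: orthonormal_for_def inner_D1_\<Psi>_\<Phi>[OF y])
  have "(\<Sum>X\<in>E. D2 (\<lambda>w. \<Psi> (\<Phi> w)) y X X) \<bullet> D1 \<Psi> (\<Phi> y) N = 0"
    if N: "\<And>X. D1 \<Psi> (\<Phi> y) N \<bullet> D1 (\<lambda>w. \<Psi> (\<Phi> w)) y X = 0" for N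
  proof -
    have "proj_geodesics (\<mu> y) \<in> fst c" using y by (simp add: W1_def)
    then obtain a b where ab: "a \<bullet> fst (\<mu> y) = 0" "a \<bullet> snd (\<mu> y) = 0" "b \<bullet> fst (\<mu> y) = 0" "b \<bullet> snd (\<mu> y) = 0"
      "D1 \<Psi> (snd c (proj_geodesics (\<mu> y))) N = wedge a (snd (\<mu> y)) + wedge (fst (\<mu> y)) b"
      by (rule horizontal_representative[OF \<mu>(2)[OF yW], of N]) blast
    then have ab': "a \<bullet> F y = 0" "a \<bullet> \<nu> y = 0" "b \<bullet> F y = 0" "b \<bullet> \<nu> y = 0"
      and eq: "D1 \<Psi> (\<Phi> y) N = wedge a (\<nu> y) + wedge (F y) b"
      by (simp_all add: \<Phi>_def) (simp_all add: \<mu>_def)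
    have "(a, b) \<bullet> L y X = 0" for X
      using wedge_horizontal_inner[OF \<mu>(2)[OF yW] ab(1-4), of "D1 F y X" "D1 \<nu> y X"] N[of X]
      by (simp add: eq D1_\<Psi>_\<Phi>[OF y] L_def \<mu>_def)
    then obtain Y where Y: "a = - D1 \<nu> y Y" "b = D1 F y Y"
      by (rule lagrangian_normal[OF yW ab']) blast
    \<comment> \<open>The middle term of \<open>D2_\<Psi>_\<Phi>\<close> has both factors orthogonal
      to F and \<open>\<nu>\<close>, while each wedge in the normal vector contains one of these
      two; only the outer terms contribute, and they form C.\<close>
    have "D2 (\<lambda>w. \<Psi> (\<Phi> w)) y X X \<bullet> D1 \<Psi> (\<Phi> y) N = C y X X Y" for X
      using orthogonality[OF yW] \<nu>_unit[OF yW] ab'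
      by (simp add: D2_\<Psi>_\<Phi>[OF y] eq inner_add_left inner_add_right wedge_inner C_def Y
         inner_commute[of "\<nu> y" "D1 _ _ _"] inner_commute[of "F y" "D1 _ _ _"] inner_commute[of "\<nu> y" "F y"])
    then have "(\<Sum>X\<in>E. D2 (\<lambda>w. \<Psi> (\<Phi> w)) y X X) \<bullet> D1 \<Psi> (\<Phi> y) N = (\<Sum>X\<in>E. C y X X Y)"
      by (simp add: inner_sum_left)
    also have "\<dots> = 0" by (rule trace_C[OF yW E])
    finally show ?thesis .
  qed
  then show ?thesis using pb.mean_curvature_eq_0_iff[OF E'] by blast
qed

theorem symplectic_0:
  assumes y: "y \<in> W1"
  shows "geodesic_symplectic c (proj_geodesics (\<mu> y)) (D1 \<Phi> y X) (D1 \<Phi> y Y) = 0"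
proof -
  note yW = W1_W[OF y]
  have pf: "pushes_geodesics c (\<mu> y) (L y X) (D1 \<Phi> y X)" for X
    using pushes_forwardI[OF open_W1 y, of \<mu> unit_tangent_sphere c proj_geodesics X] smooth_\<Phi> \<mu> yW
      smooth_on_subset[OF \<mu>(1), of W1]
    by (auto simp: \<Phi>_def[abs_def] W1_def)
  have "proj_geodesics (\<mu> y) \<in> fst c" using y by (simp add: W1_def)
  from geodesic_symplectic[OF \<mu>(2)[OF yW] this pf pf] show ?thesis
    using isotropic[OF yW, of X Y] by (simp add: L_def inner_commute)
qed

end

lemma mean_curvature_cong:
  assumes "open S" "u \<in> S" "\<And>z. z \<in> S \<Longrightarrow> \<Phi> z = \<Phi>' z" "smooth_on S \<Phi>"
  shows "mean_curvature G \<Phi> u = mean_curvature G \<Phi>' u"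
proof -
  have 1: "D1 \<Phi> u = D1 \<Phi>' u" by (rule D1_cong_open[OF assms])
  have 2: "D2 \<Phi> u = D2 \<Phi>' u" by (rule ext) (rule D2_cong_open[OF assms])
  have 3: "\<Phi> u = \<Phi>' u" using assms by simp
  have 4: "normal_part G \<Phi> u = normal_part G \<Phi>' u" by (rule ext) (simp add: normal_part_def 1 3)
  have 5: "second_fundamental_form G \<Phi> u X Y = second_fundamental_form G \<Phi>' u X Y" for X Y
    using fun_cong[OF fun_cong[OF 2, of Y], of X] by (simp add: second_fundamental_form_def 1 3 4)
  show ?thesis by (simp add: mean_curvature_def orthonormal_frame_def 1 3 5)
qed

section \<open>Charts of products and submanifolds\<close>

lemma times_euclidean_chart:
  fixes M :: "('p, 'a::euclidean_space) manifold"
  assumes M: "smooth_manifold M"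
    and b: "b \<in> atlas (times_euclidean M :: ('p \<times> 'v::euclidean_space, 'a \<times> 'v) manifold)"
    and b': "b' \<in> atlas (times_euclidean M :: ('p \<times> 'v, 'a \<times> 'v) manifold)"
  shows "inj_on (snd b) (fst b)" "open (snd b ` (fst b \<inter> fst b'))"
    "smooth_on (snd b ` (fst b \<inter> fst b')) (\<lambda>w. snd b' (param b w))"
proof -
  obtain a where a: "a \<in> atlas M" "b = (fst a \<times> UNIV, map_prod (snd a) id)" using b by (auto simp: times_euclidean_def)
  obtain a' where a': "a' \<in> atlas M" "b' = (fst a' \<times> UNIV, map_prod (snd a') id)" using b' by (auto simp: times_euclidean_def)
  note aM = smooth_manifold_chart[OF M a(1)]
  show inj: "inj_on (snd b) (fst b)" using aM(2) by (auto simp: a inj_on_def)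
  have img: "snd b ` (fst b \<inter> fst b') = (snd a ` (fst a \<inter> fst a')) \<times> UNIV"
    by (force simp: a a')
  show "open (snd b ` (fst b \<inter> fst b'))" unfolding img by (intro open_Times aM(4)[OF a'(1)] open_UNIV)
  have "smooth_on ((snd a ` (fst a \<inter> fst a')) \<times> (UNIV :: 'v set)) (\<lambda>w. (snd a' (param a (fst w)), snd w))"
    by (intro smooth_on_Pair smooth_on_compose[OF smooth_on_fst[OF smooth_on_id] aM(5)[OF a'(1)]] smooth_on_snd smooth_on_id) auto
  then show "smooth_on (snd b ` (fst b \<inter> fst b')) (\<lambda>w. snd b' (param b w))"
    unfolding img
  proof (rule smooth_on_cong)
    fix w assume "w \<in> (snd a ` (fst a \<inter> fst a')) \<times> (UNIV :: 'v set)"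
    then obtain p v where p: "p \<in> fst a" "w = (snd a p, v)" by auto
    then have "param b w = (p, v)" using inv_into_f_f[OF inj, of "(p, v)"] by (simp add: a)
    then show "(snd a' (param a (fst w)), snd w) = snd b' (param b w)"
      using p aM(2) by (simp add: a')
  qed
qed

text \<open>The atlas demands compatibility with every chart b of N. It is enough to check one chart
  a whose domain contains that of c, since b is reached from a by a smooth transition.\<close>

lemma submanifold_chartI:
  fixes N :: "('p, 'e::euclidean_space) manifold" and c :: "('p, 'd::euclidean_space) chart"
  assumes N: "\<And>b. b \<in> atlas N \<Longrightarrow> inj_on (snd b) (fst b)"
      "\<And>b b'. b \<in> atlas N \<Longrightarrow> b' \<in> atlas N \<Longrightarrow> open (snd b ` (fst b \<inter> fst b'))"
      "\<And>b b'. b \<in> atlas N \<Longrightarrow> b' \<in> atlas N \<Longrightarrow> smooth_on (snd b ` (fst b \<inter> fst b')) (\<lambda>w. snd b' (param b w))"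
    and a: "a \<in> atlas N" and c: "fst c \<subseteq> S \<inter> fst a" "inj_on (snd c) (fst c)" "open (snd c ` fst c)"
    and op: "openin (top_of_set (snd a ` (S \<inter> fst a))) (snd a ` fst c)"
    and fw: "smooth_on (snd a ` fst c) (\<lambda>w. snd c (param a w))"
    and bw: "smooth_on (snd c ` fst c) (\<lambda>w. snd a (param c w))"
  shows "c \<in> atlas (submanifold N S)"
proof -
  have main: "openin (top_of_set (snd b ` (S \<inter> fst b))) (snd b ` (fst c \<inter> fst b)) \<and> open (snd c ` (fst c \<inter> fst b)) \<and>
    smooth_on (snd b ` (fst c \<inter> fst b)) (\<lambda>w. snd c (param b w)) \<and> smooth_on (snd c ` (fst c \<inter> fst b)) (\<lambda>w. snd b (param c w))"
    if b: "b \<in> atlas N" for b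
  proof -
    note pc = inv_into_f_f[OF c(2)] and pa = inv_into_f_f[OF N(1)[OF a]] and pb = inv_into_f_f[OF N(1)[OF b]]
    let ?\<tau> = "\<lambda>w. snd b (param a w)" and ?\<tau>' = "\<lambda>w. snd a (param b w)"
    have ca: "p \<in> fst a" "p \<in> S" if "p \<in> fst c" for p using that c(1) by auto
    have eq: "snd c ` (fst c \<inter> fst b) = snd c ` fst c \<inter> (\<lambda>w. snd a (param c w)) -` (snd a ` (fst a \<inter> fst b))"
    proof (intro equalityI subsetI)
      fix w assume "w \<in> snd c ` fst c \<inter> (\<lambda>w. snd a (param c w)) -` (snd a ` (fst a \<inter> fst b))"
      then obtain p q where pq: "p \<in> fst c" "w = snd c p" "snd a p = snd a q" "q \<in> fst a" "q \<in> fst b"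
        using pc by auto
      then have "p = q" using pa ca(1) by metis
      then show "w \<in> snd c ` (fst c \<inter> fst b)" using pq by auto
    qed (auto simp: pc ca)
    have o: "open (snd c ` (fst c \<inter> fst b))"
      unfolding eq using smooth_on_continuous_on[OF bw] c(3) N(2)[OF a b]
      by (simp add: continuous_on_open_vimage Int_commute)
    have "smooth_on (snd c ` (fst c \<inter> fst b)) (\<lambda>w. ?\<tau> (snd a (param c w)))"
      by (rule smooth_on_compose[OF smooth_on_subset[OF bw] N(3)[OF a b]]) (auto simp: pc ca)
    then have s1: "smooth_on (snd c ` (fst c \<inter> fst b)) (\<lambda>w. snd b (param c w))"
      by (rule smooth_on_cong) (auto simp: pc pa ca)
    have "smooth_on (snd b ` (fst c \<inter> fst b)) (\<lambda>w. snd c (param a (?\<tau>' w)))"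
      by (rule smooth_on_compose[OF smooth_on_subset[OF N(3)[OF b a]] fw]) (auto simp: pb dest: ca)
    then have s2: "smooth_on (snd b ` (fst c \<inter> fst b)) (\<lambda>w. snd c (param b w))"
      by (rule smooth_on_cong) (auto simp: pb pa ca)
    obtain B where B: "open B" "snd a ` fst c = snd a ` (S \<inter> fst a) \<inter> B" using op by (auto simp: openin_open)
    have "open (snd b ` (fst b \<inter> fst a) \<inter> ?\<tau>' -` B)"
      using smooth_on_continuous_on[OF N(3)[OF b a]] N(2)[OF b a] B(1) by (simp add: continuous_on_open_vimage Int_commute)
    moreover have "snd b ` (fst c \<inter> fst b) = snd b ` (S \<inter> fst b) \<inter> (snd b ` (fst b \<inter> fst a) \<inter> ?\<tau>' -` B)"
    proof (intro equalityI subsetI)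
      fix w assume "w \<in> snd b ` (fst c \<inter> fst b)"
      then obtain p where p: "p \<in> fst c" "p \<in> fst b" "w = snd b p" by auto
      have "snd a p \<in> B" using B(2) p(1) by blast
      then show "w \<in> snd b ` (S \<inter> fst b) \<inter> (snd b ` (fst b \<inter> fst a) \<inter> ?\<tau>' -` B)"
        using p ca[OF p(1)] by (auto simp: pb)
    next
      fix w assume w: "w \<in> snd b ` (S \<inter> fst b) \<inter> (snd b ` (fst b \<inter> fst a) \<inter> ?\<tau>' -` B)"
      then obtain p where p: "p \<in> S" "p \<in> fst b" "w = snd b p" by auto
      obtain q where q: "q \<in> fst b" "q \<in> fst a" "w = snd b q" using w by auto
      have "p = q" using p q pb by metis
      then have pa': "p \<in> fst a" using q by simp
      have "snd a p \<in> B" using w p by (auto simp: pb)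
      then have "snd a p \<in> snd a ` fst c" unfolding B(2) using p pa' by auto
      then obtain r where r: "r \<in> fst c" "snd a p = snd a r" by auto
      then have "p = r" using pa pa' ca(1) by metis
      then show "w \<in> snd b ` (fst c \<inter> fst b)" using r p by auto
    qed
    ultimately have "openin (top_of_set (snd b ` (S \<inter> fst b))) (snd b ` (fst c \<inter> fst b))" by (metis openin_open_Int)
    then show ?thesis using o s1 s2 by simp
  qed
  show ?thesis
    unfolding submanifold_def using main c by (auto simp: local_rep_def o_def)
qed

section \<open>The unit normal bundle and its Gauss map in arbitrary charts\<close>

locale minimal_surface_in_sphere =
  fixes M :: "('p, 'a::euclidean_space) manifold" and f :: "'p \<Rightarrow> real^'m"
  assumes M: "smooth_manifold M" and dim_a: "DIM('a) = 2"
    and f_smooth: "\<And>c. c \<in> atlas M \<Longrightarrow> smooth_on (snd c ` fst c) (\<lambda>w. f (param c w))"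
    and f_unit: "\<And>c w. c \<in> atlas M \<Longrightarrow> w \<in> snd c ` fst c \<Longrightarrow> f (param c w) \<bullet> f (param c w) = 1"
    and f_inj: "\<And>c w. c \<in> atlas M \<Longrightarrow> w \<in> snd c ` fst c \<Longrightarrow> inj (D1 (\<lambda>w. f (param c w)) w)"
    and f_minimal: "\<And>c w v E. c \<in> atlas M \<Longrightarrow> w \<in> snd c ` fst c \<Longrightarrow> f (param c w) \<bullet> v = 0 \<Longrightarrow>
        (\<And>X. D1 (\<lambda>w. f (param c w)) w X \<bullet> v = 0) \<Longrightarrow>
        orthonormal_for (D1 (\<lambda>w. f (param c w)) w) E \<Longrightarrow> (\<Sum>X\<in>E. D2 (\<lambda>w. f (param c w)) w X X) \<bullet> v = 0"
begin

definition normals :: "('p \<times> (real^'m)) set" where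
  "normals = {(p, v). p \<in> carrier M \<and> norm v = 1 \<and> f p \<bullet> v = 0 \<and>
        (\<forall>c\<in>charts_at M p. \<forall>X. D1 (f \<circ> param c) (snd c p) X \<bullet> v = 0)}"

lemma unit_normal_bundle: "unit_normal_bundle M f = submanifold (times_euclidean M) normals"
  by (simp add: unit_normal_bundle_def normals_def)

abbreviation gauss :: "'p \<times> (real^'m) \<Rightarrow> ((real^'m) \<times> (real^'m)) set" where
  "gauss z \<equiv> proj_geodesics (f (fst z), snd z)"

text \<open>The bundle is defined by conditions in all charts at p; by the chain rule the range of
  the derivative of f is the same for each, so one chart decides.\<close>

lemma normals_chart:
  assumes b: "b \<in> charts_at M p"
  shows "(p, v) \<in> normals \<longleftrightarrow> norm v = 1 \<and> f p \<bullet> v = 0 \<and> (\<forall>X. D1 (\<lambda>w. f (param b w)) (snd b p) X \<bullet> v = 0)"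
proof
  assume "(p, v) \<in> normals"
  then show "norm v = 1 \<and> f p \<bullet> v = 0 \<and> (\<forall>X. D1 (\<lambda>w. f (param b w)) (snd b p) X \<bullet> v = 0)"
    using b by (auto simp: normals_def o_def)
next
  assume v: "norm v = 1 \<and> f p \<bullet> v = 0 \<and> (\<forall>X. D1 (\<lambda>w. f (param b w)) (snd b p) X \<bullet> v = 0)"
  have b': "b \<in> atlas M" "p \<in> fst b" using b by auto
  note bM = smooth_manifold_chart[OF M b'(1)]
  have "D1 (\<lambda>w. f (param c w)) (snd c p) X \<bullet> v = 0" if "c \<in> charts_at M p" for c X
  proof -
    have c: "c \<in> atlas M" "p \<in> fst c" using that by auto
    note cM = smooth_manifold_chart[OF M c(1)]
    let ?A = "snd c ` (fst c \<inter> fst b)" and ?\<tau> = "\<lambda>w. snd b (param c w)"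
    have A: "open ?A" "snd c p \<in> ?A" "smooth_on ?A ?\<tau>" using cM(4,5)[OF b'(1)] b' c by auto
    have pc: "param c (snd c q) = q" if "q \<in> fst c" for q using cM(2) that by (rule inv_into_f_f)
    have pb: "param b (snd b q) = q" if "q \<in> fst b" for q using bM(2) that by (rule inv_into_f_f)
    have sm: "smooth_on ?A (\<lambda>w. f (param b (?\<tau> w)))"
      by (rule smooth_on_compose[OF A(3) f_smooth[OF b'(1)]]) (auto simp: pc)
    have "D1 (\<lambda>w. f (param c w)) (snd c p) = D1 (\<lambda>w. f (param b (?\<tau> w))) (snd c p)"
      by (rule D1_cong_open[OF A(1,2) _ sm, symmetric]) (auto simp: pc pb)
    also have "\<dots> = (\<lambda>X. D1 (\<lambda>w. f (param b w)) (?\<tau> (snd c p)) (D1 ?\<tau> (snd c p) X))"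
      by (rule D1_compose[OF A(3,1,2) f_smooth[OF b'(1)] bM(3)]) (use b' c pc in auto)
    finally show ?thesis using v c by (simp add: pc)
  qed
  then show "(p, v) \<in> normals" using v b' bM(1) by (auto simp: normals_def o_def)
qed

context
  fixes c :: "('p \<times> (real^'m), 'e::euclidean_space) chart"
  assumes c: "c \<in> atlas (unit_normal_bundle M f)" and dim: "CARD('m) = DIM('e) + 2"
begin

lemma unit_normal_bundle_chart:
  shows "fst c \<subseteq> normals" "inj_on (snd c) (fst c)" "open (snd c ` fst c)"
    and "\<And>b. b \<in> atlas M \<Longrightarrow> open (snd c ` (fst c \<inter> (fst b \<times> UNIV)))"
    and "\<And>b. b \<in> atlas M \<Longrightarrow> smooth_on (map_prod (snd b) id ` (fst c \<inter> (fst b \<times> UNIV)))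
        (\<lambda>z. snd c (inv_into (fst b \<times> UNIV) (map_prod (snd b) id) z))"
    and "\<And>b. b \<in> atlas M \<Longrightarrow> smooth_on (snd c ` (fst c \<inter> (fst b \<times> UNIV))) (\<lambda>y. (snd b (fst (param c y)), snd (param c y)))"
  using c unfolding unit_normal_bundle submanifold_def times_euclidean_def local_rep_def
  by (auto simp: o_def map_prod_def case_prod_beta)

lemma unit_normal_graph:
  assumes b: "b \<in> atlas M"
  shows "unit_normal_graph (snd b ` fst b) (\<lambda>w. f (param b w)) (snd c ` (fst c \<inter> (fst b \<times> UNIV)))
     (\<lambda>y. snd b (fst (param c y))) (\<lambda>y. snd (param c y))"
proof -
  let ?W = "snd c ` (fst c \<inter> (fst b \<times> UNIV))" and ?\<sigma> = "\<lambda>y. (snd b (fst (param c y)), snd (param c y))"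
  note bM = smooth_manifold_chart[OF M b] and cc = unit_normal_bundle_chart
  have sm: "smooth_on ?W ?\<sigma>" by (rule cc(6)[OF b])
  have pc: "param c (snd c q) = q" if "q \<in> fst c" for q using cc(2) that by (rule inv_into_f_f)
  have pb: "param b (snd b q) = q" if "q \<in> fst b" for q using bM(2) that by (rule inv_into_f_f)
  have inj': "inj_on (map_prod (snd b) id) (fst b \<times> UNIV)" using bM(2) by (auto simp: inj_on_def)
  have smp: "smooth_on ?W (\<lambda>y. snd b (fst (param c y)))" "smooth_on ?W (\<lambda>y. snd (param c y))"
    using smooth_on_fst[OF sm] smooth_on_snd[OF sm] by simp_all
  have W: "open ?W" by (rule cc(4)[OF b])
  have nor: "norm v = 1 \<and> f p \<bullet> v = 0 \<and> (\<forall>X. D1 (\<lambda>w. f (param b w)) (snd b p) X \<bullet> v = 0)"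
    if "(p, v) \<in> fst c" "p \<in> fst b" for p v
    using normals_chart[of b p v] b that cc(1) by auto
  show ?thesis
  proof
    fix y X assume y: "y \<in> ?W" and X: "D1 (\<lambda>y. snd b (fst (param c y))) y X = 0" "D1 (\<lambda>y. snd (param c y)) y X = 0"
    \<comment> \<open>The coordinates of c, read in the product chart of b, are a smooth left
      inverse of \<open>?\<sigma>\<close>.\<close>
    have "inj (D1 ?\<sigma> y)"
    proof (rule smooth_left_inverse_inj[OF W y sm cc(5)[OF b]])
      show "?\<sigma> ` ?W \<subseteq> map_prod (snd b) id ` (fst c \<inter> (fst b \<times> UNIV))"
        by (auto simp: pc intro!: rev_image_eqI)
      show "snd c (inv_into (fst b \<times> UNIV) (map_prod (snd b) id) (?\<sigma> z)) = z" if "z \<in> ?W" for z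
      proof -
        obtain p v where p: "(p, v) \<in> fst c" "p \<in> fst b" "z = snd c (p, v)" using \<open>z \<in> ?W\<close> by auto
        have "inv_into (fst b \<times> UNIV) (map_prod (snd b) id) (map_prod (snd b) id (p, v)) = (p, v)"
          by (rule inv_into_f_f[OF inj']) (use p in auto)
        then show ?thesis using p by (simp add: pc)
      qed
    qed
    moreover have "D1 ?\<sigma> y X = 0"
      using D1_eqI[OF has_derivative_Pair[OF smooth_on_has_derivative[OF smp(1) W y] smooth_on_has_derivative[OF smp(2) W y]]] X
      by (simp add: zero_prod_def)
    ultimately show "X = 0" using linear_injective_0[OF D1_linear[OF sm W y]] by blast
  next
    show "DIM(real^'m) = DIM('e) + 2" using dim by simp
  qed (use f_smooth[OF b] bM f_unit[OF b] f_inj[OF b] f_minimal[OF b] W smp dim_a nor in \<open>auto simp: pc pb norm_eq_1\<close>)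
qed

lemma gauss_map_local:
  fixes c' :: "(((real^'m) \<times> (real^'m)) set, 'h::euclidean_space) chart"
  assumes c': "c' \<in> atlas geodesic_space" and z: "z \<in> fst c" and in': "gauss z \<in> fst c'"
  obtains W where "open W" "snd c z \<in> W" "W \<subseteq> snd c ` fst c" "gauss ` param c ` W \<subseteq> fst c'"
    "smooth_on W (local_rep c c' gauss)" "inj (differential c c' gauss z)"
    "mean_curvature (\<lambda>y. geodesic_metric c' (param c' y)) (local_rep c c' gauss) (snd c z) = 0"
    "\<And>X Y. geodesic_symplectic c' (gauss z) (differential c c' gauss z X) (differential c c' gauss z Y) = 0"
proof -
  note cc = unit_normal_bundle_chart
  have pc: "param c (snd c q) = q" if "q \<in> fst c" for q using cc(2) that by (rule inv_into_f_f)
  have "fst z \<in> carrier M" using cc(1) z by (auto simp: normals_def)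
  then obtain b where b: "b \<in> atlas M" "fst z \<in> fst b" using M unfolding smooth_manifold_def by blast
  have pb: "param b (snd b q) = q" if "q \<in> fst b" for q
    using smooth_manifold_chart(2)[OF M b(1)] that by (rule inv_into_f_f)
  interpret g: gauss_map_chart "snd b ` fst b" "\<lambda>w. f (param b w)" "snd c ` (fst c \<inter> (fst b \<times> UNIV))"
    "\<lambda>y. snd b (fst (param c y))" "\<lambda>y. snd (param c y)" c'
    using unit_normal_graph[OF b(1)] c' by (intro gauss_map_chart.intro geodesic_chart.intro)
  have \<mu>: "g.\<mu> y = (f (fst (param c y)), snd (param c y))" if "y \<in> snd c ` (fst c \<inter> (fst b \<times> UNIV))" for y
    using that by (auto simp: g.\<mu>_def g.F_def pc pb)
  have W1: "snd c z \<in> g.W1"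
  proof -
    have "snd c z \<in> snd c ` (fst c \<inter> (fst b \<times> UNIV))" using z b by (auto simp: mem_Times_iff)
    then show ?thesis using in' z by (simp add: g.W1_def \<mu> pc)
  qed
  have rep: "g.\<Phi> y = local_rep c c' gauss y" if "y \<in> g.W1" for y
    using \<mu>[OF g.W1_W[OF that]] by (simp add: g.\<Phi>_def local_rep_def)
  have D: "differential c c' gauss z = D1 g.\<Phi> (snd c z)"
    unfolding differential_def by (rule D1_cong_open[OF g.open_W1 W1 rep g.smooth_\<Phi>, symmetric])
  show thesis
  proof (rule that[OF g.open_W1 W1])
    show "g.W1 \<subseteq> snd c ` fst c" using g.W1_W by blast
    show "gauss ` param c ` g.W1 \<subseteq> fst c'"
      using \<mu>[OF g.W1_W] by (auto simp: g.W1_def)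
    show "smooth_on g.W1 (local_rep c c' gauss)" by (rule smooth_on_cong[OF g.smooth_\<Phi> rep])
    show "inj (differential c c' gauss z)" unfolding D by (rule g.inj_D1_\<Phi>[OF W1])
    show "mean_curvature (\<lambda>y. geodesic_metric c' (param c' y)) (local_rep c c' gauss) (snd c z) = 0"
      using g.mean_curvature_0[OF W1] mean_curvature_cong[OF g.open_W1 W1 rep g.smooth_\<Phi>] by simp
    show "geodesic_symplectic c' (gauss z) (differential c c' gauss z X) (differential c c' gauss z Y) = 0" for X Y
      using g.symplectic_0[OF W1, of X Y] \<mu>[OF g.W1_W[OF W1]] z by (simp add: D pc)
  qed
qed

end

end

section \<open>Existence of charts\<close>

text \<open>Lagrange's identity gives determinant 1 or -1, and the sign condition selects 1. Then
  \<open>(c + b)^2 + (d - a)^2\<close> equals 2 minus twice the determinant, hence 0.\<close>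

lemma rotation_of_orthonormal_pair:
  fixes a b c d :: real
  assumes "a * a + b * b = 1" "c * c + d * d = 1" "a * c + b * d = 0" "a * d - b * c > 0"
  shows "c = - b" "d = a"
proof -
  have "(a * d - b * c) * (a * d - b * c) + (a * c + b * d) * (a * c + b * d) = (a * a + b * b) * (c * c + d * d)"
    by (simp add: algebra_simps)
  then have "(a * d - b * c)\<^sup>2 = 1" using assms by (simp add: power2_eq_square)
  then have "a * d - b * c = 1" using assms(4) by (simp add: power2_eq_1_iff)
  then have "(c + b) * (c + b) + (d - a) * (d - a) = 0" using assms(1,2) by (simp add: algebra_simps)
  then show "c = - b" "d = a" by (simp_all add: sum_squares_eq_zero_iff)
qed

text \<open>An oriented plane close to the one spanned by \<open>p0 = (x0, v0)\<close> is the graph of a linear map from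
  \<open>span {x0, v0}\<close> to its orthogonal complement.  For a basis \<open>p\<close> of the plane, \<open>graph_fst p0 p\<close> and
  \<open>graph_snd p0 p\<close> are the points of the graph over \<open>x0\<close> and \<open>v0\<close>.\<close>

definition plane_det :: "(real^'m) \<times> (real^'m) \<Rightarrow> (real^'m) \<times> (real^'m) \<Rightarrow> real" where
  "plane_det p0 p = (fst p \<bullet> fst p0) * (snd p \<bullet> snd p0) - (fst p \<bullet> snd p0) * (snd p \<bullet> fst p0)"

definition graph_fst :: "(real^'m) \<times> (real^'m) \<Rightarrow> (real^'m) \<times> (real^'m) \<Rightarrow> real^'m" where
  "graph_fst p0 p = (1 / plane_det p0 p) *\<^sub>R ((snd p \<bullet> snd p0) *\<^sub>R fst p - (fst p \<bullet> snd p0) *\<^sub>R snd p)"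

definition graph_snd :: "(real^'m) \<times> (real^'m) \<Rightarrow> (real^'m) \<times> (real^'m) \<Rightarrow> real^'m" where
  "graph_snd p0 p = (1 / plane_det p0 p) *\<^sub>R ((fst p \<bullet> fst p0) *\<^sub>R snd p - (snd p \<bullet> fst p0) *\<^sub>R fst p)"

lemma graph_flow:
  "plane_det p0 (geodesic_flow t p) = plane_det p0 p"
  "graph_fst p0 (geodesic_flow t p) = graph_fst p0 p"
  "graph_snd p0 (geodesic_flow t p) = graph_snd p0 p"
proof -
  have cs: "cos t * cos t + sin t * sin t = 1"
    using sin_cos_squared_add[of t] by (simp add: power2_eq_square)
  obtain x v where p: "p = (x, v)" by (cases p)
  have r: "(c * a + s * b) * (c * b' - s * a') - (c * a' + s * b') * (c * b - s * a) = (c * c + s * s) * (a * b' - a' * b)"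
    for a b a' b' c s :: real by (simp add: algebra_simps)
  have "(c * b - s * a) *\<^sub>R (c *\<^sub>R x + s *\<^sub>R v) - (c * a + s * b) *\<^sub>R (c *\<^sub>R v - s *\<^sub>R x) = (c * c + s * s) *\<^sub>R (b *\<^sub>R x - a *\<^sub>R v)"
    for a b c s :: real by (simp add: algebra_simps)
  note v = this[of "cos t" _ "sin t", unfolded cs scaleR_one]
  have "(c * a + s * b) *\<^sub>R (c *\<^sub>R v - s *\<^sub>R x) - (c * b - s * a) *\<^sub>R (c *\<^sub>R x + s *\<^sub>R v) = (c * c + s * s) *\<^sub>R (a *\<^sub>R v - b *\<^sub>R x)"
    for a b c s :: real by (simp add: algebra_simps)
  note v' = this[of "cos t" _ "sin t", unfolded cs scaleR_one]
  show det: "plane_det p0 (geodesic_flow t p) = plane_det p0 p"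
    using r[of "cos t" "x \<bullet> fst p0" "sin t" "v \<bullet> fst p0" "v \<bullet> snd p0" "x \<bullet> snd p0"] cs
    by (simp add: plane_det_def p geodesic_flow_def inner_add_left inner_diff_left)
  show "graph_fst p0 (geodesic_flow t p) = graph_fst p0 p" "graph_snd p0 (geodesic_flow t p) = graph_snd p0 p"
    unfolding graph_fst_def graph_snd_def det
    by (simp_all add: p geodesic_flow_def inner_add_left inner_diff_left v v')
qed

text \<open>\<open>graph_fst\<close> and \<open>graph_snd\<close> come from Cramer's rule for the 2
  by 2 matrix of inner products with p0; here that system is substituted back.\<close>

lemma graph_expand:
  assumes "plane_det p0 p \<noteq> 0"
  shows "fst p = (fst p \<bullet> fst p0) *\<^sub>R graph_fst p0 p + (fst p \<bullet> snd p0) *\<^sub>R graph_snd p0 p"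
    "snd p = (snd p \<bullet> fst p0) *\<^sub>R graph_fst p0 p + (snd p \<bullet> snd p0) *\<^sub>R graph_snd p0 p"
proof -
  let ?D = "plane_det p0 p"
  have "?D *\<^sub>R ((fst p \<bullet> fst p0) *\<^sub>R graph_fst p0 p + (fst p \<bullet> snd p0) *\<^sub>R graph_snd p0 p) = ?D *\<^sub>R fst p"
    "?D *\<^sub>R ((snd p \<bullet> fst p0) *\<^sub>R graph_fst p0 p + (snd p \<bullet> snd p0) *\<^sub>R graph_snd p0 p) = ?D *\<^sub>R snd p"
  proof -
    have g: "?D *\<^sub>R graph_fst p0 p = (snd p \<bullet> snd p0) *\<^sub>R fst p - (fst p \<bullet> snd p0) *\<^sub>R snd p"
      "?D *\<^sub>R graph_snd p0 p = (fst p \<bullet> fst p0) *\<^sub>R snd p - (snd p \<bullet> fst p0) *\<^sub>R fst p"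
      using assms by (simp_all add: graph_fst_def graph_snd_def)
    have "?D *\<^sub>R (a *\<^sub>R graph_fst p0 p + b *\<^sub>R graph_snd p0 p) =
      a *\<^sub>R ((snd p \<bullet> snd p0) *\<^sub>R fst p - (fst p \<bullet> snd p0) *\<^sub>R snd p) + b *\<^sub>R ((fst p \<bullet> fst p0) *\<^sub>R snd p - (snd p \<bullet> fst p0) *\<^sub>R fst p)" for a b
      unfolding g[symmetric] by (simp add: scaleR_add_right mult.commute)
    note e = this
    show "?D *\<^sub>R ((fst p \<bullet> fst p0) *\<^sub>R graph_fst p0 p + (fst p \<bullet> snd p0) *\<^sub>R graph_snd p0 p) = ?D *\<^sub>R fst p"
      "?D *\<^sub>R ((snd p \<bullet> fst p0) *\<^sub>R graph_fst p0 p + (snd p \<bullet> snd p0) *\<^sub>R graph_snd p0 p) = ?D *\<^sub>R snd p"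
      unfolding e by (simp_all add: plane_det_def algebra_simps)
  qed
  then show "fst p = (fst p \<bullet> fst p0) *\<^sub>R graph_fst p0 p + (fst p \<bullet> snd p0) *\<^sub>R graph_snd p0 p"
    "snd p = (snd p \<bullet> fst p0) *\<^sub>R graph_fst p0 p + (snd p \<bullet> snd p0) *\<^sub>R graph_snd p0 p"
    using assms by (metis scaleR_left_imp_eq)+
qed

lemma graph_inner:
  assumes "plane_det p0 p \<noteq> 0"
  shows "graph_fst p0 p \<bullet> fst p0 = 1" "graph_fst p0 p \<bullet> snd p0 = 0" "graph_snd p0 p \<bullet> fst p0 = 0" "graph_snd p0 p \<bullet> snd p0 = 1"
  using assms by (simp_all add: graph_fst_def graph_snd_def inner_diff_left) (simp_all add: plane_det_def mult.commute)

text \<open>Equal graphs mean equal planes, and two positive determinants mean equal orientations.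
  Two orthonormal bases of one oriented plane differ by a rotation, which is a time of the
  flow.\<close>

lemma proj_geodesics_eqI:
  assumes p: "p \<in> unit_tangent_sphere" "q \<in> unit_tangent_sphere"
    and D: "plane_det p0 p > 0" "plane_det p0 q > 0"
    and eq: "graph_fst p0 p = graph_fst p0 q" "graph_snd p0 p = graph_snd p0 q"
  shows "proj_geodesics p = proj_geodesics q"
proof -
  obtain x v y w where xv: "p = (x, v)" "q = (y, w)" by (metis surj_pair)
  have o: "x \<bullet> x = 1" "v \<bullet> v = 1" "x \<bullet> v = 0" "v \<bullet> x = 0" "y \<bullet> y = 1" "w \<bullet> w = 1" "y \<bullet> w = 0" "w \<bullet> y = 0"
    using unit_tangentD[OF p(1)] unit_tangentD[OF p(2)] by (auto simp: xv)
  have comb: "\<exists>a b. s *\<^sub>R graph_fst p0 p + t *\<^sub>R graph_snd p0 p = a *\<^sub>R x + b *\<^sub>R v" for s t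
  proof -
    let ?d = "1 / plane_det p0 p"
    have "s *\<^sub>R graph_fst p0 p + t *\<^sub>R graph_snd p0 p =
       (?d * (s * (v \<bullet> snd p0) - t * (v \<bullet> fst p0))) *\<^sub>R x + (?d * (t * (x \<bullet> fst p0) - s * (x \<bullet> snd p0))) *\<^sub>R v"
      by (simp add: graph_fst_def graph_snd_def xv algebra_simps)
    then show ?thesis by blast
  qed
  obtain a b where y: "y = a *\<^sub>R x + b *\<^sub>R v"
    using comb graph_expand(1)[of p0 q] D(2) unfolding eq by (metis fst_conv less_irrefl xv(2))
  obtain c d where w: "w = c *\<^sub>R x + d *\<^sub>R v"
    using comb graph_expand(2)[of p0 q] D(2) unfolding eq by (metis snd_conv less_irrefl xv(2))
  have "a * a + b * b = 1" "c * c + d * d = 1" "a * c + b * d = 0"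
    using o(5-7) unfolding y w by (simp_all add: inner_add_left inner_add_right o(1-4) mult.commute)
  moreover have "plane_det p0 q = (a * d - b * c) * plane_det p0 p"
    by (simp add: plane_det_def xv y w inner_add_left algebra_simps)
  then have "a * d - b * c > 0" using D by (simp add: zero_less_mult_iff)
  ultimately have cd: "c = - b" "d = a" by (rule rotation_of_orthonormal_pair)+
  obtain t where "a = cos t" "b = sin t"
    using sincos_total_2pi[of a b] \<open>a * a + b * b = 1\<close> by (metis power2_eq_square)
  then have "q = geodesic_flow t p" by (simp add: xv y w cd geodesic_flow_def)
  then show ?thesis by (simp add: proj_geodesics_flow)
qed

definition gram_schmidt :: "(real^'m) \<times> (real^'m) \<Rightarrow> (real^'m) \<times> (real^'m)" where
  "gram_schmidt p = (let x = (1 / norm (fst p)) *\<^sub>R fst p; u = snd p - (snd p \<bullet> x) *\<^sub>R x in (x, (1 / norm u) *\<^sub>R u))"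

text \<open>Orthonormalisation preserves the oriented plane, so the graph vectors are recovered from
  the result. The last two claims keep the norms in the denominators away from zero, as smoothness
  requires.\<close>

lemma gram_schmidt:
  assumes "p0 \<in> unit_tangent_sphere"
    and p: "fst p \<bullet> fst p0 = 1" "fst p \<bullet> snd p0 = 0" "snd p \<bullet> fst p0 = 0" "snd p \<bullet> snd p0 = 1"
  shows "gram_schmidt p \<in> unit_tangent_sphere" "plane_det p0 (gram_schmidt p) > 0"
    "graph_fst p0 (gram_schmidt p) = fst p" "graph_snd p0 (gram_schmidt p) = snd p"
    "fst p \<noteq> 0" "snd p - (snd p \<bullet> ((1 / norm (fst p)) *\<^sub>R fst p)) *\<^sub>R ((1 / norm (fst p)) *\<^sub>R fst p) \<noteq> 0"
proof -
  obtain X Y where XY: "p = (X, Y)" by (cases p)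
  define r where "r = 1 / norm X"
  define x where "x = r *\<^sub>R X"
  define u where "u = Y - (Y \<bullet> x) *\<^sub>R x"
  define s where "s = 1 / norm u"
  have X: "X \<bullet> fst p0 = 1" "X \<bullet> snd p0 = 0" "Y \<bullet> fst p0 = 0" "Y \<bullet> snd p0 = 1" using p by (auto simp: XY)
  then have "X \<noteq> 0" by auto
  then have r: "r > 0" "r \<noteq> 0" and xx: "x \<bullet> x = 1"
    by (simp_all add: r_def x_def dot_square_norm power2_eq_square)
  have x0: "x \<bullet> fst p0 = r" "x \<bullet> snd p0 = 0" by (simp_all add: x_def X)
  have u0: "u \<bullet> fst p0 = - (Y \<bullet> x) * r" "u \<bullet> snd p0 = 1" by (simp_all add: u_def inner_diff_left X x0)
  then have "u \<noteq> 0" by auto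
  then have s: "s > 0" "s \<noteq> 0" "s *\<^sub>R u \<bullet> s *\<^sub>R u = 1"
    by (simp_all add: s_def dot_square_norm power2_eq_square)
  have ux: "x \<bullet> u = 0" by (simp add: u_def inner_diff_right xx inner_commute)
  have gs: "gram_schmidt p = (x, s *\<^sub>R u)" by (simp add: gram_schmidt_def Let_def XY x_def u_def s_def r_def)
  have D: "plane_det p0 (gram_schmidt p) = r * s" by (simp add: plane_det_def gs x0 u0)
  show "gram_schmidt p \<in> unit_tangent_sphere"
    using xx s(3) ux by (simp add: gs unit_tangent_sphere_def norm_eq_1)
  show "plane_det p0 (gram_schmidt p) > 0" using r s by (simp add: D)
  show "graph_fst p0 (gram_schmidt p) = fst p"
    using r s by (simp add: graph_fst_def D) (simp add: gs x0 u0, simp add: x_def XY)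
  have "graph_snd p0 (gram_schmidt p) = u + (Y \<bullet> x) *\<^sub>R x"
    using r s by (simp add: graph_snd_def D) (simp add: gs x0 u0 scaleR_diff_right, simp add: scaleR_add_right)
  then show "graph_snd p0 (gram_schmidt p) = snd p" by (simp add: u_def XY)
  show "fst p \<noteq> 0" "snd p - (snd p \<bullet> ((1 / norm (fst p)) *\<^sub>R fst p)) *\<^sub>R ((1 / norm (fst p)) *\<^sub>R fst p) \<noteq> 0"
    using \<open>X \<noteq> 0\<close> \<open>u \<noteq> 0\<close> by (simp_all add: XY u_def x_def r_def)
qed

text \<open>The coordinates are the deviations of the two graph vectors from p0, each in the
  orthogonal complement P of the plane, which is identified with \<open>'e\<close>. Every pair of
  deviations occurs, so the chart is onto and s is a section over the whole model space.\<close>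

lemma geodesic_space_chart_exists:
  fixes p0 :: "(real^'m) \<times> (real^'m)"
  assumes p0: "p0 \<in> unit_tangent_sphere" and dim: "CARD('m) = DIM('e::euclidean_space) + 2"
  obtains c where "c \<in> atlas (geodesic_space :: (((real^'m) \<times> (real^'m)) set, 'e \<times> 'e) manifold)" "proj_geodesics p0 \<in> fst c"
proof -
  have o: "fst p0 \<bullet> fst p0 = 1" "snd p0 \<bullet> snd p0 = 1" "fst p0 \<bullet> snd p0 = 0" "snd p0 \<bullet> fst p0 = 0"
    using unit_tangentD[OF p0] by auto
  let ?T = "span {fst p0, snd p0}"
  define P where "P = {\<eta> \<in> UNIV. \<forall>x\<in>?T. orthogonal x \<eta>}"
  have P: "\<eta> \<in> P \<longleftrightarrow> \<eta> \<bullet> fst p0 = 0 \<and> \<eta> \<bullet> snd p0 = 0" for \<eta>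
    unfolding P_def orthogonal_span_iff by (auto simp: orthogonal_def inner_commute)
  have subP: "subspace P" unfolding P_def using subspace_orthogonal_to_vectors[of ?T] by simp
  have "snd p0 \<noteq> 0" using o by auto
  moreover have "fst p0 \<notin> span {snd p0}" using o by (auto simp: span_singleton)
  ultimately have "dim {fst p0, snd p0} = 2" by (simp add: dim_insert)
  then have "dim P = DIM('e)"
    using dim_subspace_orthogonal_to_vectors[OF subspace_span subspace_UNIV, of "{fst p0, snd p0}"]
    unfolding P_def by (simp add: dim_UNIV dim)
  then have "dim (UNIV :: 'e set) = dim P" by (simp add: dim_UNIV)
  then obtain \<Lambda> :: "'e \<Rightarrow> real^'m" and \<Lambda>' where \<Lambda>: "linear \<Lambda>" "linear \<Lambda>'" "\<Lambda> ` UNIV = P"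
    "\<And>x. \<Lambda>' (\<Lambda> x) = x" "\<And>x. x \<in> P \<Longrightarrow> \<Lambda> (\<Lambda>' x) = x"
    by (rule isometries_subspaces[OF subspace_UNIV subP]) (metis UNIV_I)
  have \<Lambda>0: "\<Lambda> a \<bullet> fst p0 = 0" "\<Lambda> a \<bullet> snd p0 = 0" for a using \<Lambda>(3) P by blast+
  define \<xi> where "\<xi> p = (\<Lambda>' (graph_fst p0 p - fst p0), \<Lambda>' (graph_snd p0 p - snd p0))" for p
  define k where "k q = \<xi> (SOME p. proj_geodesics p = q)" for q
  have k: "k (proj_geodesics p) = \<xi> p" for p
  proof -
    have "proj_geodesics (SOME p'. proj_geodesics p' = proj_geodesics p) = proj_geodesics p"
      by (rule someI[of "\<lambda>p'. proj_geodesics p' = proj_geodesics p"]) simp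
    from proj_geodesics_eqD[OF this] obtain t where "p = geodesic_flow t (SOME p'. proj_geodesics p' = proj_geodesics p)" .
    then show ?thesis using graph_flow[of p0 t] unfolding k_def \<xi>_def by metis
  qed
  define B where "B = {p. plane_det p0 p > 0}"
  define A where "A = proj_geodesics ` (unit_tangent_sphere \<inter> B)"
  have "continuous_on UNIV (plane_det p0)" unfolding plane_det_def[abs_def] by (intro continuous_intros)
  then have openB: "open B" unfolding B_def by (intro open_Collect_less) (auto intro: continuous_intros)
  have A: "proj_geodesics p \<in> A \<longleftrightarrow> p \<in> B" if "p \<in> unit_tangent_sphere" for p
  proof
    assume "proj_geodesics p \<in> A"
    then obtain q where "q \<in> B" "proj_geodesics p = proj_geodesics q" by (auto simp: A_def)
    then show "p \<in> B" using graph_flow(1)[of p0] by (metis B_def mem_Collect_eq proj_geodesics_eqD)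
  qed (use that in \<open>auto simp: A_def\<close>)
  have graph_P: "graph_fst p0 p - fst p0 \<in> P" "graph_snd p0 p - snd p0 \<in> P" if "p \<in> B" for p
    using graph_inner[of p0 p] that by (auto simp: P inner_diff_left o B_def)
  have inj: "inj_on k A"
  proof (rule inj_onI)
    fix q q' assume "q \<in> A" "q' \<in> A" and eq: "k q = k q'"
    then obtain p p' where p: "p \<in> unit_tangent_sphere" "p \<in> B" "q = proj_geodesics p"
      and p': "p' \<in> unit_tangent_sphere" "p' \<in> B" "q' = proj_geodesics p'" by (auto simp: A_def)
    have "\<xi> p = \<xi> p'" using eq by (simp add: p p' k)
    then have "\<Lambda>' (graph_fst p0 p - fst p0) = \<Lambda>' (graph_fst p0 p' - fst p0)"
      "\<Lambda>' (graph_snd p0 p - snd p0) = \<Lambda>' (graph_snd p0 p' - snd p0)" by (simp_all add: \<xi>_def)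
    then have "graph_fst p0 p - fst p0 = graph_fst p0 p' - fst p0" "graph_snd p0 p - snd p0 = graph_snd p0 p' - snd p0"
      using \<Lambda>(5) graph_P p(2) p'(2) by metis+
    then show "q = q'" using proj_geodesics_eqI[OF p(1) p'(1), of p0] p(2,3) p'(2,3) by (simp add: B_def)
  qed
  define s where "s y = gram_schmidt (fst p0 + \<Lambda> (fst y), snd p0 + \<Lambda> (snd y))" for y
  have s: "s y \<in> unit_tangent_sphere" "s y \<in> B" "\<xi> (s y) = y" for y
    using gram_schmidt(1-4)[OF p0, of "(fst p0 + \<Lambda> (fst y), snd p0 + \<Lambda> (snd y))"]
    by (auto simp: s_def B_def \<xi>_def inner_add_left o \<Lambda>0 \<Lambda>(4))
  have sA: "proj_geodesics (s y) \<in> A" for y using s A by blast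
  have img: "k ` A = UNIV" using sA s(3) k by (metis UNIV_eq_I image_eqI)
  have nz: "fst p0 + \<Lambda> a \<noteq> 0"
    "snd p0 + \<Lambda> b - ((snd p0 + \<Lambda> b) \<bullet> ((1 / norm (fst p0 + \<Lambda> a)) *\<^sub>R (fst p0 + \<Lambda> a))) *\<^sub>R ((1 / norm (fst p0 + \<Lambda> a)) *\<^sub>R (fst p0 + \<Lambda> a)) \<noteq> 0" for a b
    using gram_schmidt(5,6)[OF p0, of "(fst p0 + \<Lambda> a, snd p0 + \<Lambda> b)"]
    by (simp_all add: inner_add_left o \<Lambda>0)
  have smooth_s: "smooth_on UNIV s"
    unfolding s_def[abs_def] gram_schmidt_def Let_def fst_conv snd_conv
    by (intro smooth_on_intros smooth_on_UNIV_compose[OF smooth_on_linear[OF \<Lambda>(1)]]) (use nz in auto)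
  have smooth_\<xi>: "smooth_on B \<xi>"
    unfolding \<xi>_def[abs_def] graph_fst_def graph_snd_def plane_det_def
    by (intro smooth_on_Pair smooth_on_UNIV_compose[OF smooth_on_linear[OF \<Lambda>(2)]] smooth_on_intros) (auto simp: B_def plane_det_def)
  have "(A, k) \<in> atlas (geodesic_space :: (((real^'m) \<times> (real^'m)) set, 'e \<times> 'e) manifold)"
    unfolding geodesic_space_def quotient_manifold_def
  proof (simp, intro conjI allI)
    show "A \<subseteq> proj_geodesics ` unit_tangent_sphere" by (auto simp: A_def)
    show "inj_on k A" by (rule inj)
    show "open (k ` A)" by (simp add: img)
    have eq: "unit_tangent_sphere \<inter> proj_geodesics -` A = unit_tangent_sphere \<inter> B" using A by blast
    show "openin (top_of_set unit_tangent_sphere) (unit_tangent_sphere \<inter> proj_geodesics -` A)"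
      unfolding eq using openB by (rule openin_open_Int)
    show "smooth_on (unit_tangent_sphere \<inter> proj_geodesics -` A) (k \<circ> proj_geodesics)"
      unfolding eq o_def k by (rule smooth_on_subset[OF smooth_\<xi>]) simp
    have "proj_geodesics (s w) = inv_into A k w" for w
      using inv_into_f_f[OF inj sA[of w]] by (simp add: k s(3))
    then show "\<forall>y\<in>A. \<exists>V. open V \<and> k y \<in> V \<and> V \<subseteq> k ` A \<and> (\<exists>s. smooth_on V s \<and> s ` V \<subseteq> unit_tangent_sphere \<and>
        (\<forall>w\<in>V. proj_geodesics (s w) = inv_into A k w))"
      using smooth_s s(1) by (intro ballI exI[of _ UNIV] conjI exI[of _ s]) (auto simp: img)
  qed
  moreover have "p0 \<in> B" by (simp add: B_def plane_det_def o)
  then have "proj_geodesics p0 \<in> A" using A[OF p0] by simp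
  ultimately show thesis using that[of "(A, k)"] by simp
qed

section \<open>Charts of the unit normal bundle\<close>

lemma smooth_on_det_3:
  fixes A :: "'a::real_normed_vector \<Rightarrow> real^3^3"
  assumes "\<And>i j. smooth_on S (\<lambda>x. A x $ i $ j)"
  shows "smooth_on S (\<lambda>x. det (A x))"
  unfolding det_3 by (intro smooth_on_intros assms)

context minimal_surface_in_sphere
begin

text \<open>The chart sends \<open>(p, v)\<close> to the coordinates of \<open>p\<close> and the component of \<open>v / (v \<bullet> v0)\<close> in the normal space
  at \<open>p0\<close> perpendicular to \<open>v0\<close>.  Its inverse applies \<open>Q u\<close>, which moves a vector into the normal space
  at \<open>u\<close> along the span of the vectors \<open>T u0 i\<close>; the coefficients solve a linear system.\<close>

lemma unit_normal_bundle_chart_exists: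
  assumes z0: "(p0, v0) \<in> normals" and dim: "CARD('m) = DIM('e::euclidean_space) + 2"
  obtains c :: "('p \<times> (real^'m), 'e::euclidean_space) chart" where "c \<in> atlas (unit_normal_bundle M f)" "(p0, v0) \<in> fst c"
proof -
  have "p0 \<in> carrier M" using z0 by (simp add: normals_def)
  then obtain b where b: "b \<in> atlas M" "p0 \<in> fst b" using M unfolding smooth_manifold_def by blast
  note bM = smooth_manifold_chart[OF M b(1)]
  have pb: "param b (snd b q) = q" if "q \<in> fst b" for q using bM(2) that by (rule inv_into_f_f)
  define \<phi> where "\<phi> w = f (param b w)" for w
  define U where "U = snd b ` fst b"
  have \<phi>: "smooth_on U \<phi>" "open U" using f_smooth[OF b(1)] bM(3) by (auto simp: \<phi>_def[abs_def] U_def)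
  define u0 where "u0 = snd b p0"
  have u0: "u0 \<in> U" "\<phi> u0 = f p0" using b by (auto simp: u0_def U_def \<phi>_def pb)
  have lin: "linear (D1 \<phi> u)" if "u \<in> U" for u by (rule D1_linear[OF \<phi> that])
  have inj: "inj (D1 \<phi> u0)" using f_inj[OF b(1)] u0(1) by (simp add: \<phi>_def[abs_def] U_def)
  obtain E where E: "orthonormal_for (D1 \<phi> u0) E" by (rule orthonormal_for_exists[OF lin[OF u0(1)] inj])
  then have "card E = 2" by (simp add: orthonormal_for_def dim_a)
  then obtain E1 E2 where E12: "E = {E1, E2}" "E1 \<noteq> E2" by (auto simp: card_2_iff)
  have on: "D1 \<phi> u0 E1 \<bullet> D1 \<phi> u0 E1 = 1" "D1 \<phi> u0 E2 \<bullet> D1 \<phi> u0 E2 = 1" "D1 \<phi> u0 E1 \<bullet> D1 \<phi> u0 E2 = 0" "D1 \<phi> u0 E2 \<bullet> D1 \<phi> u0 E1 = 0"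
    using E E12 by (auto simp: orthonormal_for_def)
  have span_E: "\<exists>a b. X = a *\<^sub>R E1 + b *\<^sub>R E2" for X
    using orthonormal_for_expansion(2)[OF lin[OF u0(1)] E, of X] E12 by auto
  \<comment> \<open>The three vectors to which a normal at u must be orthogonal: the position and
    the images of a basis of coordinate vectors. They are orthonormal at u0 only; the index type 3
    prepares for Cramer's rule.\<close>
  define T :: "'a \<Rightarrow> 3 \<Rightarrow> real^'m" where "T u i = (if i = 1 then \<phi> u else if i = 2 then D1 \<phi> u E1 else D1 \<phi> u E2)" for u i
  have all3: "(\<forall>i::3. P i) \<longleftrightarrow> P 1 \<and> P 2 \<and> P 3" for P by (rule forall_3)
  have smooth_T: "smooth_on U (\<lambda>u. T u i)" for i
    by (cases "i = 1"; cases "i = 2") (simp_all add: T_def \<phi> smooth_on_frechet_derivative[OF \<phi>])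
  have normals_T: "(p, v) \<in> normals \<longleftrightarrow> norm v = 1 \<and> (\<forall>i. T (snd b p) i \<bullet> v = 0)" if p: "p \<in> fst b" for p v
  proof -
    have "snd b p \<in> U" using p by (simp add: U_def)
    note l = lin[OF this]
    have "(\<forall>X. D1 \<phi> (snd b p) X \<bullet> v = 0) \<longleftrightarrow> D1 \<phi> (snd b p) E1 \<bullet> v = 0 \<and> D1 \<phi> (snd b p) E2 \<bullet> v = 0"
    proof (intro iffI allI)
      fix X assume *: "D1 \<phi> (snd b p) E1 \<bullet> v = 0 \<and> D1 \<phi> (snd b p) E2 \<bullet> v = 0"
      obtain a c where "X = a *\<^sub>R E1 + c *\<^sub>R E2" using span_E by blast
      then show "D1 \<phi> (snd b p) X \<bullet> v = 0" using * by (simp add: linear_add[OF l] linear_scale[OF l] inner_add_left)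
    qed auto
    moreover have "(p, v) \<in> normals \<longleftrightarrow> norm v = 1 \<and> f p \<bullet> v = 0 \<and> (\<forall>X. D1 \<phi> (snd b p) X \<bullet> v = 0)"
      unfolding \<phi>_def[abs_def] by (rule normals_chart) (use b(1) p in simp)
    moreover have "\<phi> (snd b p) = f p" by (simp add: \<phi>_def pb[OF p])
    ultimately show ?thesis unfolding all3 by (simp add: T_def)
  qed
  have T0: "T u0 i \<bullet> T u0 j = (if i = j then 1 else 0)" for i j
  proof -
    have "\<phi> u0 \<bullet> \<phi> u0 = 1" using f_unit[OF b(1)] u0(1) by (simp add: \<phi>_def U_def)
    moreover have "D1 \<phi> u0 X \<bullet> \<phi> u0 = 0" for X
      using smooth_on_inner_const_derivative[OF \<phi>(1,1,2) u0(1), of 1 X] f_unit[OF b(1)] by (simp add: \<phi>_def U_def inner_commute)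
    moreover have "\<phi> u0 \<bullet> D1 \<phi> u0 X = 0" for X using calculation(2) by (simp add: inner_commute)
    ultimately have "\<forall>i j. T u0 i \<bullet> T u0 j = (if i = j then 1 else 0)"
      unfolding all3 by (simp add: T_def on)
    then show ?thesis by blast
  qed
  have v0: "v0 \<bullet> v0 = 1" "T u0 i \<bullet> v0 = 0" "v0 \<bullet> T u0 i = 0" for i
    using z0 normals_T[OF b(2)] by (auto simp: norm_eq_1 u0_def inner_commute)
  define A where "A u = (\<chi> i j. T u i \<bullet> T u0 j)" for u
  \<comment> \<open>Cramer's rule for \<open>A u *v x = (\<chi> i. T u i \<bullet> z)\<close>; the
    quotient of determinants shows that the solution depends smoothly on u and z wherever
    \<open>det (A u)\<close> is nonzero.\<close>
  define co where "co u z = (\<chi> k. det (\<chi> i j. if j = k then (\<chi> i. T u i \<bullet> z) $ i else A u $ i $ j) / det (A u))" for u z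
  define U' where "U' = {u \<in> U. det (A u) \<noteq> 0}"
  have smooth_A: "smooth_on U (\<lambda>u. det (A u))"
    by (rule smooth_on_det_3) (simp add: A_def smooth_on_inner smooth_T smooth_on_const)
  have U': "open U'"
  proof -
    have "U' = U \<inter> (\<lambda>u. det (A u)) -` (- {0})" by (auto simp: U'_def)
    then show ?thesis using smooth_on_continuous_on[OF smooth_A] \<phi>(2)
      by (simp add: continuous_on_open_vimage Int_commute open_Compl)
  qed
  have "A u0 = mat 1" by (simp add: A_def T0 mat_def vec_eq_iff)
  then have u0': "u0 \<in> U'" using u0 by (simp add: U'_def)
  have A_mult: "(A u *v x) $ i = T u i \<bullet> (\<Sum>j\<in>UNIV. x $ j *\<^sub>R T u0 j)" for u x i
    by (simp add: A_def matrix_vector_mult_def inner_sum_right mult.commute)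
  have co: "A u *v x = (\<chi> i. T u i \<bullet> z) \<longleftrightarrow> x = co u z" if "u \<in> U'" for u x z
    unfolding co_def by (rule cramer) (use that in \<open>simp add: U'_def\<close>)
  define Q where "Q u z = z - (\<Sum>j\<in>UNIV. co u z $ j *\<^sub>R T u0 j)" for u z
  have Q_normal: "T u i \<bullet> Q u z = 0" if "u \<in> U'" for u i z
  proof -
    have "A u *v co u z = (\<chi> i. T u i \<bullet> z)" using co[OF that] by simp
    then have "(A u *v co u z) $ i = T u i \<bullet> z" by simp
    then show ?thesis by (simp add: Q_def inner_diff_right A_mult)
  qed
  have Q_unique: "Q u z = y" if u: "u \<in> U'" and y: "\<And>i. T u i \<bullet> y = 0" "z - y = (\<Sum>j\<in>UNIV. x $ j *\<^sub>R T u0 j)" for u z y x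
  proof -
    have "(A u *v x) $ i = T u i \<bullet> z" for i using y(1)[of i] by (simp add: A_mult inner_diff_right flip: y(2))
    then have "A u *v x = (\<chi> i. T u i \<bullet> z)" by (simp add: vec_eq_iff)
    then have "x = co u z" by (rule co[OF u, THEN iffD1])
    then show ?thesis using y(2) by (simp add: Q_def algebra_simps)
  qed
  let ?S = "insert v0 (range (T u0))"
  define P where "P = {\<eta> \<in> UNIV. \<forall>x\<in>span ?S. orthogonal x \<eta>}"
  have P: "\<eta> \<in> P \<longleftrightarrow> \<eta> \<bullet> v0 = 0 \<and> (\<forall>i. T u0 i \<bullet> \<eta> = 0)" for \<eta>
    unfolding P_def orthogonal_span_iff by (auto simp: orthogonal_def inner_commute)
  have subP: "subspace P" unfolding P_def using subspace_orthogonal_to_vectors[of "span ?S"] by simp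
  have dimP: "dim P + 2 = DIM('e)"
  proof -
    have injT: "inj (T u0)" by (rule injI) (metis T0 zero_neq_one)
    have "0 \<notin> ?S" using T0 v0(1) by (metis (no_types) inner_zero_left insert_iff rangeE zero_neq_one)
    moreover have "pairwise orthogonal ?S"
      using v0 T0 injT by (auto simp: pairwise_def orthogonal_def inj_eq)
    ultimately have "independent ?S" by (intro pairwise_orthogonal_independent)
    then have "dim ?S = card ?S" by (rule dim_eq_card_independent)
    also have "v0 \<notin> range (T u0)" using v0 by (metis rangeE zero_neq_one)
    then have "card ?S = Suc (card (range (T u0)))" by simp
    also have "card (range (T u0)) = 3" using card_image[OF injT] by simp
    finally have "dim ?S = 4" by simp
    then show ?thesis
      using dim_subspace_orthogonal_to_vectors[OF subspace_span subspace_UNIV, of ?S] dim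
      unfolding P_def by (simp add: dim_UNIV)
  qed
  have "dim (UNIV :: 'e set) = dim ((UNIV :: 'a set) \<times> P)"
    using dimP dim_a by (simp add: dim_Times[OF subspace_UNIV subP] dim_UNIV)
  then obtain \<Lambda> :: "'e \<Rightarrow> 'a \<times> (real^'m)" and \<Lambda>' where \<Lambda>: "linear \<Lambda>" "linear \<Lambda>'" "\<Lambda> ` UNIV = UNIV \<times> P"
    "\<And>x. \<Lambda>' (\<Lambda> x) = x" "\<And>x. x \<in> UNIV \<times> P \<Longrightarrow> \<Lambda> (\<Lambda>' x) = x"
    by (rule isometries_subspaces[OF subspace_UNIV subspace_Times[OF subspace_UNIV subP]]) (metis UNIV_I)
  have \<Lambda>P: "snd (\<Lambda> y) \<in> P" for y using \<Lambda>(3) by (metis mem_Times_iff rangeI)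
  \<comment> \<open>Orthogonal projection to P, written out by means of the orthonormal system
    formed by v0 and the \<open>T u0 i\<close>.\<close>
  define pr where "pr z = z - (z \<bullet> v0) *\<^sub>R v0 - (\<Sum>i\<in>UNIV. (z \<bullet> T u0 i) *\<^sub>R T u0 i)" for z
  have prP: "pr z \<in> P" for z
    unfolding P
  proof (intro conjI allI)
    show "pr z \<bullet> v0 = 0" by (simp add: pr_def inner_diff_left inner_sum_left v0)
    show "T u0 i \<bullet> pr z = 0" for i
      by (simp add: pr_def inner_diff_right inner_sum_right v0 T0 if_distrib[of "(*) _"] cong: if_cong) (simp add: inner_commute)
  qed
  define Z where "Z y = Q (fst (\<Lambda> y)) (v0 + snd (\<Lambda> y))" for y
  define \<Omega> where "\<Omega> = {y. fst (\<Lambda> y) \<in> U'}"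
  define dm where "dm = {z \<in> normals. fst z \<in> fst b \<and> snd b (fst z) \<in> U' \<and> snd z \<bullet> v0 > 0}"
  \<comment> \<open>Central projection of the hemisphere \<open>v \<bullet> v0 > 0\<close> to the
    affine space where the inner product with v0 is 1. The inverse only has to normalise.\<close>
  define k where "k z = \<Lambda>' (snd b (fst z), pr ((1 / (snd z \<bullet> v0)) *\<^sub>R snd z))" for z :: "'p \<times> (real^'m)"
  define l where "l y = (param b (fst (\<Lambda> y)), (1 / norm (Z y)) *\<^sub>R Z y)" for y
  \<comment> \<open>Q changes a vector only along the \<open>T u0 i\<close>, and P and these are
    orthogonal to v0; hence the normalisation is preserved and Z never vanishes.\<close>
  have Zv0: "Z y \<bullet> v0 = 1" for y
    using \<Lambda>P[of y] by (simp add: Z_def Q_def inner_diff_left inner_add_left inner_sum_left v0 P)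
  have Z0: "Z y \<noteq> 0" for y using Zv0[of y] by auto
  have l: "l y \<in> dm" "k (l y) = y" if y: "y \<in> \<Omega>" for y
  proof -
    let ?u = "fst (\<Lambda> y)" and ?w = "snd (\<Lambda> y)"
    have u: "?u \<in> U'" "?u \<in> U" using y by (auto simp: \<Omega>_def U'_def)
    then have q: "param b ?u \<in> fst b" "snd b (param b ?u) = ?u" by (auto simp: U_def intro: inv_into_into f_inv_into_f)
    have "norm ((1 / norm (Z y)) *\<^sub>R Z y) = 1" using Z0 by simp
    moreover have "T ?u i \<bullet> ((1 / norm (Z y)) *\<^sub>R Z y) = 0" for i
      using Q_normal[OF u(1)] by (simp add: Z_def)
    ultimately have "l y \<in> normals" using normals_T[OF q(1)] q(2) by (simp add: l_def)
    then show "l y \<in> dm" using q u Z0[of y] by (simp add: dm_def l_def Zv0)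
    \<comment> \<open>The \<open>T u0 i\<close> are orthonormal, so \<open>pr\<close> removes
      precisely the correction that Q has added.\<close>
    have "pr (Z y) = ?w"
    proof -
      define d where "d = co ?u (v0 + ?w)"
      have Zy: "Z y = v0 + ?w - (\<Sum>j\<in>UNIV. d $ j *\<^sub>R T u0 j)" by (simp add: Z_def Q_def d_def)
      have "Z y \<bullet> T u0 i = - d $ i" for i
        using \<Lambda>P[of y] by (simp add: Zy inner_diff_left inner_add_left inner_sum_left T0 v0 P inner_commute[of ?w]
           if_distrib[of "(*) _"] cong: if_cong)
      then show ?thesis by (simp add: pr_def Zv0) (simp add: Zy sum_negf)
    qed
    then show "k (l y) = y" using q Z0[of y] by (simp add: k_def l_def Zv0 \<Lambda>(4))
  qed
  have k: "k z \<in> \<Omega>" "l (k z) = z" if z: "z \<in> dm" for z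
  proof -
    obtain p v where pv: "z = (p, v)" by (cases z)
    have p: "(p, v) \<in> normals" "p \<in> fst b" "snd b p \<in> U'" "v \<bullet> v0 > 0" using z by (auto simp: dm_def pv)
    define y where "y = (1 / (v \<bullet> v0)) *\<^sub>R v"
    have \<Lambda>k: "\<Lambda> (k z) = (snd b p, pr y)" using prP by (simp add: k_def pv y_def \<Lambda>(5))
    then show "k z \<in> \<Omega>" using p by (simp add: \<Omega>_def)
    have yv0: "y \<bullet> v0 = 1" using p(4) by (simp add: y_def)
    \<comment> \<open>y is already normal at p and differs from \<open>v0 + pr y\<close> by a
      combination of the \<open>T u0 i\<close>, which characterises the value of Q.\<close>
    have "Q (snd b p) (v0 + pr y) = y"
    proof (rule Q_unique[OF p(3)])
      show "T (snd b p) i \<bullet> y = 0" for i using normals_T[OF p(2)] p(1) by (simp add: y_def)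
      show "v0 + pr y - y = (\<Sum>j\<in>UNIV. (\<chi> j. - (y \<bullet> T u0 j)) $ j *\<^sub>R T u0 j)"
        by (simp add: pr_def yv0 sum_negf)
    qed
    then have "Z (k z) = y" by (simp add: Z_def \<Lambda>k)
    moreover have "norm v = 1" using normals_T[OF p(2)] p(1) by blast
    then have "(1 / norm y) *\<^sub>R y = v" using p(4) by (simp add: y_def)
    ultimately show "l (k z) = z" by (simp add: l_def \<Lambda>k pb[OF p(2)]) (simp add: pv)
  qed
  have inj_k: "inj_on k dm" using k(2) by (metis inj_onI)
  have img: "k ` dm = \<Omega>"
  proof
    show "k ` dm \<subseteq> \<Omega>" using k(1) by blast
    show "\<Omega> \<subseteq> k ` dm" using l by (metis image_eqI subsetI)
  qed
  have param: "param (dm, k) y = l y" if "y \<in> \<Omega>" for y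
    using inv_into_f_f[OF inj_k l(1)[OF that]] l(2)[OF that] by simp
  have open_\<Omega>: "open \<Omega>"
  proof -
    have "continuous_on UNIV (\<lambda>y. fst (\<Lambda> y))"
      by (intro continuous_on_fst linear_continuous_on) (use \<Lambda>(1) in \<open>simp add: linear_conv_bounded_linear\<close>)
    from open_vimage[OF U' this] show ?thesis by (simp add: \<Omega>_def vimage_def)
  qed
  let ?a = "(fst b \<times> (UNIV :: (real^'m) set), map_prod (snd b) id :: 'p \<times> (real^'m) \<Rightarrow> 'a \<times> (real^'m))"
  have a: "?a \<in> atlas (times_euclidean M)" using b(1) by (auto simp: times_euclidean_def)
  have inj_a: "inj_on (map_prod (snd b) id) (fst b \<times> (UNIV :: (real^'m) set))" using bM(2) by (auto simp: inj_on_def)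
  have smooth_Z: "smooth_on \<Omega> Z"
  proof -
    have s: "smooth_on \<Omega> (\<lambda>y. fst (\<Lambda> y))" "smooth_on \<Omega> (\<lambda>y. snd (\<Lambda> y))"
      by (intro smooth_on_fst smooth_on_snd smooth_on_linear \<Lambda>(1))+
    have sub: "(\<lambda>y. fst (\<Lambda> y)) ` \<Omega> \<subseteq> U" by (auto simp: \<Omega>_def U'_def)
    have sT: "smooth_on \<Omega> (\<lambda>y. T (fst (\<Lambda> y)) i)" for i by (rule smooth_on_compose[OF s(1) smooth_T sub])
    have sA: "smooth_on \<Omega> (\<lambda>y. A (fst (\<Lambda> y)) $ i $ j)" for i j
      by (simp add: A_def smooth_on_inner sT smooth_on_const)
    have "smooth_on \<Omega> (\<lambda>y. co (fst (\<Lambda> y)) (v0 + snd (\<Lambda> y)) $ j)" for j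
      unfolding co_def vec_lambda_beta
    proof (rule smooth_on_divide)
      show "smooth_on \<Omega> (\<lambda>y. det (\<chi> i ja. if ja = j then T (fst (\<Lambda> y)) i \<bullet> (v0 + snd (\<Lambda> y)) else A (fst (\<Lambda> y)) $ i $ ja))"
      proof (rule smooth_on_det_3)
        show "smooth_on \<Omega> (\<lambda>y. (\<chi> i ja. if ja = j then T (fst (\<Lambda> y)) i \<bullet> (v0 + snd (\<Lambda> y)) else A (fst (\<Lambda> y)) $ i $ ja) $ i $ ja)" for i ja
          by (cases "ja = j") (simp_all add: sA smooth_on_inner sT smooth_on_add smooth_on_const s)
      qed
      show "smooth_on \<Omega> (\<lambda>y. det (A (fst (\<Lambda> y))))" by (rule smooth_on_det_3) (rule sA)
    qed (simp add: \<Omega>_def U'_def)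
    then show ?thesis
      unfolding Z_def[abs_def] Q_def by (intro smooth_on_intros s)
  qed
  have "(dm, k) \<in> atlas (submanifold (times_euclidean M) normals)"
  proof (rule submanifold_chartI[where a = ?a])
    show "?a \<in> atlas (times_euclidean M)" by (rule a)
    show "fst (dm, k) \<subseteq> normals \<inter> fst ?a" by (auto simp: dm_def)
    show "inj_on (snd (dm, k)) (fst (dm, k))" "open (snd (dm, k) ` fst (dm, k))" by (simp_all add: inj_k img open_\<Omega>)
    have "snd ?a ` dm = snd ?a ` (normals \<inter> fst ?a) \<inter> (U' \<times> {v. v \<bullet> v0 > 0})" by (auto simp: dm_def)
    moreover have "open (U' \<times> {v. v \<bullet> v0 > 0})"
      by (intro open_Times U' open_Collect_less continuous_intros)
    ultimately show "openin (top_of_set (snd ?a ` (normals \<inter> fst ?a))) (snd ?a ` fst (dm, k))"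
      by (metis fst_conv openin_open_Int)
    have "smooth_on (snd ?a ` dm) (\<lambda>w. \<Lambda>' (fst w, pr ((1 / (snd w \<bullet> v0)) *\<^sub>R snd w)))"
      unfolding pr_def
      by (intro smooth_on_UNIV_compose[OF smooth_on_linear[OF \<Lambda>(2)]] smooth_on_intros) (auto simp: dm_def)
    then show "smooth_on (snd ?a ` fst (dm, k)) (\<lambda>w. snd (dm, k) (param ?a w))"
    proof (rule smooth_on_cong[OF smooth_on_subset])
      fix w assume "w \<in> snd ?a ` fst (dm, k)"
      then obtain p v where pv: "(p, v) \<in> dm" "w = map_prod (snd b) id (p, v)" by auto
      then have "param ?a w = (p, v)"
        using inv_into_f_f[OF inj_a, of "(p, v)"] by (simp add: dm_def)
      then show "\<Lambda>' (fst w, pr ((1 / (snd w \<bullet> v0)) *\<^sub>R snd w)) = snd (dm, k) (param ?a w)"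
        by (simp add: k_def pv)
    qed simp
    have "smooth_on \<Omega> (\<lambda>y. (fst (\<Lambda> y), (1 / norm (Z y)) *\<^sub>R Z y))"
      by (intro smooth_on_intros smooth_on_linear \<Lambda>(1) smooth_Z) (use Z0 in auto)
    then show "smooth_on (snd (dm, k) ` fst (dm, k)) (\<lambda>w. snd ?a (param (dm, k) w))"
      unfolding fst_conv snd_conv img
    proof (rule smooth_on_cong)
      fix y assume y: "y \<in> \<Omega>"
      then have "snd b (param b (fst (\<Lambda> y))) = fst (\<Lambda> y)" by (auto simp: \<Omega>_def U'_def U_def intro: f_inv_into_f)
      then show "(fst (\<Lambda> y), (1 / norm (Z y)) *\<^sub>R Z y) = map_prod (snd b) id (inv_into dm k y)"
        using param[OF y] by (simp add: l_def)
    qed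
  qed (rule times_euclidean_chart[OF M]; assumption)+
  moreover have "(p0, v0) \<in> dm" using z0 b u0' v0 by (simp add: dm_def u0_def)
  ultimately show thesis using that[of "(dm, k)"] by (simp add: unit_normal_bundle)
qed

end

section \<open>The geodesic Gauss map of a minimal surface\<close>

theorem mainTheorem2:
  fixes M :: "('p, real^2) manifold"
    and g :: "('p, real^2) tensor2"
    and f :: "'p \<Rightarrow> real^'m"
    and n :: nat
  assumes "n \<ge> 3"
    and "CARD('m) = n + 1"
    and "CARD('k::finite) = n - 1"
    and "oriented_manifold M"
    and "riemannian_metric M g"
    and "isometric_immersion M g
           (round_sphere :: (real^'m, (real^'k) \<times> real) manifold) round_metric f"
    and "minimal_immersion M
           (round_sphere :: (real^'m, (real^'k) \<times> real) manifold) round_metric f"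
  shows "minimal_immersion
           (unit_normal_bundle M f :: ('p \<times> (real^'m), real^'k) manifold)
           (geodesic_space :: (((real^'m) \<times> (real^'m)) set, (real^'k) \<times> (real^'k)) manifold)
           geodesic_metric (geodesic_gauss_map f) \<and>
         lagrangian
           (unit_normal_bundle M f :: ('p \<times> (real^'m), real^'k) manifold)
           (geodesic_space :: (((real^'m) \<times> (real^'m)) set, (real^'k) \<times> (real^'k)) manifold)
           geodesic_symplectic (geodesic_gauss_map f)"
proof -
  let ?N = "unit_normal_bundle M f :: ('p \<times> (real^'m), real^'k) manifold"
  let ?Q = "geodesic_space :: (((real^'m) \<times> (real^'m)) set, (real^'k) \<times> (real^'k)) manifold"
  have M: "smooth_manifold M" using assms(4) by (simp add: oriented_manifold_def)
  \<comment> \<open>The model spaces have dimension n for the sphere and n - 1 for the unit normal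
    bundle; since n is at least 3, the natural number subtraction is genuine.\<close>
  have dims: "CARD('m) = DIM((real^'k) \<times> real) + 1" "CARD('m) = DIM(real^'k) + 2" using assms(1-3) by simp_all
  interpret minimal_surface_in_sphere M f
    by (unfold_locales; (rule minimal_sphere_immersion_chart[OF M assms(7) dims(1)] M; assumption)?) simp
  have gauss: "geodesic_gauss_map f = gauss"
    by (auto simp: geodesic_gauss_map_def spherical_gauss_map_def case_prod_beta)
  have carrier_N: "carrier ?N = normals" by (simp add: unit_normal_bundle submanifold_def)
  have carrier_Q: "carrier ?Q = proj_geodesics ` unit_tangent_sphere" by (simp add: geodesic_space_def quotient_manifold_def)
  have UT: "(f (fst z), snd z) \<in> unit_tangent_sphere" if "z \<in> normals" for z
  proof -
    have z: "fst z \<in> carrier M" "norm (snd z) = 1" "f (fst z) \<bullet> snd z = 0" using that by (auto simp: normals_def)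
    then obtain b where b: "b \<in> atlas M" "fst z \<in> fst b" using M unfolding smooth_manifold_def by blast
    have "param b (snd b (fst z)) = fst z" using smooth_manifold_chart(2)[OF M b(1)] b(2) by (rule inv_into_f_f)
    then have "f (fst z) \<bullet> f (fst z) = 1" using f_unit[OF b(1), of "snd b (fst z)"] b(2) by simp
    then show ?thesis using z by (simp add: unit_tangent_sphere_def norm_eq_1)
  qed
  have smooth: "smooth_map ?N ?Q gauss"
    unfolding smooth_map_def
  proof (intro conjI ballI)
    show "gauss ` carrier ?N \<subseteq> carrier ?Q" unfolding carrier_N carrier_Q using UT by blast
    fix z assume "z \<in> carrier ?N"
    then have z: "z \<in> normals" by (simp add: carrier_N)
    \<comment> \<open>Here charts must exist. The remaining conditions concern every pair of charts
      and follow from \<open>gauss_map_local\<close> alone.\<close>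
    obtain c where c: "c \<in> atlas ?N" "z \<in> fst c"
      using unit_normal_bundle_chart_exists[of "fst z" "snd z", OF _ dims(2)] z by (metis prod.collapse)
    obtain c' where c': "c' \<in> atlas ?Q" "gauss z \<in> fst c'"
      by (rule geodesic_space_chart_exists[OF UT[OF z] dims(2)])
    obtain W where "open W" "snd c z \<in> W" "W \<subseteq> snd c ` fst c" "gauss ` param c ` W \<subseteq> fst c'" "smooth_on W (local_rep c c' gauss)"
      by (rule gauss_map_local[OF c(1) dims(2) c'(1) c(2) c'(2)])
    then show "\<exists>c\<in>charts_at ?N z. \<exists>c'\<in>charts_at ?Q (gauss z). \<exists>W. open W \<and> snd c z \<in> W \<and> W \<subseteq> snd c ` fst c \<and>
       gauss ` param c ` W \<subseteq> fst c' \<and> smooth_on W (local_rep c c' gauss)"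
      using c c' by (intro bexI[of _ c] bexI[of _ c'] exI[of _ W]) auto
  qed
  have "inj (differential c c' gauss z)"
    "mean_curvature (\<lambda>y. geodesic_metric c' (param c' y)) (local_rep c c' gauss) (snd c z) = 0"
    "geodesic_symplectic c' (gauss z) (differential c c' gauss z X) (differential c c' gauss z Y) = 0"
    if "c \<in> charts_at ?N z" "c' \<in> charts_at ?Q (gauss z)" for z c c' X Y
  proof -
    have c: "c \<in> atlas ?N" "z \<in> fst c" and c': "c' \<in> atlas ?Q" "gauss z \<in> fst c'" using that by auto
    show "inj (differential c c' gauss z)"
      "mean_curvature (\<lambda>y. geodesic_metric c' (param c' y)) (local_rep c c' gauss) (snd c z) = 0"
      "geodesic_symplectic c' (gauss z) (differential c c' gauss z X) (differential c c' gauss z Y) = 0"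
      by (rule gauss_map_local[OF c(1) dims(2) c'(1) c(2) c'(2)], assumption)+
  qed
  then show ?thesis
    unfolding minimal_immersion_def lagrangian_def immersion_def gauss
    using smooth by simp
qed

end
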